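(* Let $n$ and $m$ be integers such that $\alpha_n=\beta_m$. Put $$a=\min\{v_p(F_{k_n})+k_{n-1}\alpha_n,\ v_p(G_{l_m})+l_{m-1}\alpha_n\},\qquad b=\max\{v_p(F_{k_n})+k_{n-1}\alpha_n,\ v_p(G_{l_m})+l_{m-1}\alpha_n\},$$ and $r=\mathrm{Res}(\mathscr{C}(F,\alpha_n),\mathscr{C}(G,\beta_m))$. Then $$a+\frac{v_p(r)}{\min\{l_m-l_{m-1},\,k_n-k_{n-1}\}}\ \le\ \max_{x\in C(\alpha_n)}\phi(x)\ \le\ b+v_p(r).$$ Furthermore, if $F$ and $G$ are in $K[[X]]$, where $K$ is a finite extension of $\mathbf{Q}_p$ with ramification index $e$ and uniformizer $\pi$, then the upper bound can be sharpened to $$\max_{x\in C(\alpha_n)}\phi(x)\le b+c\,v_p(r),$$ where $$c=\max\left\{\frac{\gcd(v_{\pi}(F_{k_n})-v_{\pi}(F_{k_{n-1}}),\,k_n-k_{n-1})}{k_n-k_{n-1}},\ \frac{\gcd(v_{\pi}(G_{l_m})-v_{\pi}(G_{l_{m-1}}),\,l_m-l_{m-1})}{l_m-l_{m-1}}\right\}.$$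
   Context: $p$ is a prime, $\mathbf{C}_p$ the completion of $\overline{\mathbf{Q}}_p$, $v_p$ its valuation with $v_p(p)=1$ and $v_p(0)=+\infty$; $v_\pi=e\,v_p$ on $K$. Characteristic sequence of $F=\sum F_iX^i\in\mathbf{C}_p[[X]]$ (with $F_0\ne0$): $k_0=0$; given $k_{j-1}$, consider $l^{(j)}(q)=\frac{v_p(F_{k_{j-1}})-v_p(F_q)}{q-k_{j-1}}$ for integers $q>k_{j-1}$, and let $k_j$ be the largest $q$ at which $l^{(j)}$ attains its maximum; if no such largest integer exists, the procedure stops. Put $\alpha_j=\frac{v_p(F_{k_{j-1}})-v_p(F_{k_j})}{k_j-k_{j-1}}$; these are the $p$-adic valuations of the roots of $F$. $F$ and $G=\sum G_iX^i$ are power series in $\mathbf{C}_p[[X]]$ with no common root, with characteristic sequences $\{k_0=0,k_1,\dots\}$ and $\{l_0=0,l_1,\dots\}$ and associated valuation sequences $\{\alpha_1,\alpha_2,\dots\}$ and $\{\beta_1,\beta_2,\dots\}$ respectively. They are considered on the unit disc (open or closed), which is the intersection of their regions of convergence; in particular the common valuation $\alpha_n=\beta_m$ is $\ge 0$. For rational $t$, $C(t)=\{x\in\mathbf{C}_p: v_p(x)=t\}$ and $\mathscr{C}(F,t)=\prod_{F(z)=0,\,v_p(z)=t}(X-z)$ (roots with multiplicity), similarly for $G$. $\mathrm{Res}$ is the usual resultant of polynomials. $\phi(x)=\min(v_p(F(x)),v_p(G(x)))$. *)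

theory Defs
  imports
    "HOL-Library.Extended_Real"
    "HOL-Analysis.Elementary_Metric_Spaces"
    "HOL-Computational_Algebra.Formal_Power_Series"
    "Subresultants.Resultant_Prelim"
begin

text \<open>
  There is no library type of p-adic complex numbers, so \<open>\<^bold>C\<^sub>p\<close> is described as any field with a valuation
  that is literally a completion of an algebraic closure of \<open>\<^bold>Q\<^sub>p\<close>; this determines it up to
  isometric isomorphism. Inside such a field \<open>\<^bold>Q\<^sub>p\<close> is the topological closure of the rationals and
  the algebraic closure of \<open>\<^bold>Q\<^sub>p\<close> is the set of elements algebraic over it. The locale \<open>padic_complex\<close>
  below ties the metric to the valuation.
\<close>

definition Qp :: "'a::{field_char_0, metric_space} set" where
  "Qp = closure \<rat>"

definition Qp_bar :: "'a::{field_char_0, metric_space} set" where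
  "Qp_bar = {x. \<exists>P. P \<noteq> 0 \<and> (\<forall>i. coeff P i \<in> Qp) \<and> poly P x = 0}"

locale padic_complex =
  fixes p :: nat and v :: "'a::{field_char_0, complete_space} \<Rightarrow> ereal"
  assumes prime_p: "prime p"
    and v_infinity_iff: "v x = \<infinity> \<longleftrightarrow> x = 0"
    and v_not_minus_infinity: "v x \<noteq> -\<infinity>"
    and v_mult: "v (x * y) = v x + v y"
    and v_add: "min (v x) (v y) \<le> v (x + y)"
    and v_p: "v (of_nat p) = 1"
    and dist_eq: "dist x y = (if x = y then 0 else real p powr (- real_of_ereal (v (x - y))))"
    and Qp_bar_alg_closed:
      "degree P > 0 \<Longrightarrow> (\<And>i. coeff P i \<in> Qp_bar) \<Longrightarrow> \<exists>z\<in>Qp_bar. poly (P :: 'a poly) z = 0"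
    and Qp_bar_dense: "closure (Qp_bar :: 'a set) = UNIV"

definition fps_conv_region :: "'a::{field_char_0, complete_space} fps \<Rightarrow> 'a set" where
  "fps_conv_region F = {x. summable (\<lambda>i. fps_nth F i * x ^ i)}"

definition fps_value :: "'a::{field_char_0, complete_space} fps \<Rightarrow> 'a \<Rightarrow> 'a" where
  "fps_value F x = (\<Sum>i. fps_nth F i * x ^ i)"

definition fps_root :: "'a::{field_char_0, complete_space} fps \<Rightarrow> 'a \<Rightarrow> bool" where
  "fps_root F z \<longleftrightarrow> z \<in> fps_conv_region F \<and> fps_value F z = 0"

text \<open>Multiplicity is the order of vanishing: the least \<open>i\<close> whose \<open>i\<close>-th derivative is nonzero at
  the point (the characteristic is 0).\<close>

definition fps_root_mult :: "'a::{field_char_0, complete_space} fps \<Rightarrow> 'a \<Rightarrow> nat" where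
  "fps_root_mult F z = (LEAST i. fps_value ((fps_deriv ^^ i) F) z \<noteq> 0)"

text \<open>The set of roots below is finite whenever the circle lies in the region of convergence of
  \<open>F \<noteq> 0\<close>, so the product is a genuine one there.\<close>

definition circle_poly ::
    "('a::{field_char_0, complete_space} \<Rightarrow> ereal) \<Rightarrow> 'a fps \<Rightarrow> ereal \<Rightarrow> 'a poly" where
  "circle_poly v F t = (\<Prod>z\<in>{z. fps_root F z \<and> v z = t}. [:- z, 1:] ^ fps_root_mult F z)"

text \<open>Only used for \<open>q > k\<close> and \<open>fps_nth F k \<noteq> 0\<close>; the value is \<open>-\<infinity>\<close> when \<open>fps_nth F q = 0\<close>.\<close>

definition char_slope ::
    "('a::{field_char_0, complete_space} \<Rightarrow> ereal) \<Rightarrow> 'a fps \<Rightarrow> nat \<Rightarrow> nat \<Rightarrow> ereal" where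
  "char_slope v F k q = (v (fps_nth F k) - v (fps_nth F q)) / ereal (real (q - k))"

definition char_step ::
    "('a::{field_char_0, complete_space} \<Rightarrow> ereal) \<Rightarrow> 'a fps \<Rightarrow> nat \<Rightarrow> nat \<Rightarrow> bool" where
  "char_step v F k q \<longleftrightarrow>
     is_arg_max (char_slope v F k) (\<lambda>q. k < q) q \<and>
     (\<forall>q'. is_arg_max (char_slope v F k) (\<lambda>q. k < q) q' \<longrightarrow> q' \<le> q)"

text \<open>\<open>None\<close> means that the procedure stopped before reaching the index.\<close>

primrec char_seq ::
    "('a::{field_char_0, complete_space} \<Rightarrow> ereal) \<Rightarrow> 'a fps \<Rightarrow> nat \<Rightarrow> nat option" where
  "char_seq v F 0 = Some 0"
| "char_seq v F (Suc j) = Option.bind (char_seq v F j)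
     (\<lambda>k. if \<exists>q. char_step v F k q then Some (THE q. char_step v F k q) else None)"

definition char_index ::
    "('a::{field_char_0, complete_space} \<Rightarrow> ereal) \<Rightarrow> 'a fps \<Rightarrow> nat \<Rightarrow> nat" where
  "char_index v F j = the (char_seq v F j)"

text \<open>Meaningful for \<open>j \<ge> 1\<close> only.\<close>

definition char_val ::
    "('a::{field_char_0, complete_space} \<Rightarrow> ereal) \<Rightarrow> 'a fps \<Rightarrow> nat \<Rightarrow> ereal" where
  "char_val v F j =
     (v (fps_nth F (char_index v F (j - 1))) - v (fps_nth F (char_index v F j))) /
     ereal (real (char_index v F j - char_index v F (j - 1)))"

definition finite_extension_Qp :: "'a::{field_char_0, metric_space} set \<Rightarrow> bool" where
  "finite_extension_Qp K \<longleftrightarrow>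
     Qp \<subseteq> K \<and>
     (\<forall>x\<in>K. \<forall>y\<in>K. x - y \<in> K \<and> x * y \<in> K \<and> inverse x \<in> K) \<and>
     (\<exists>B. finite B \<and> B \<subseteq> K \<and> (\<forall>x\<in>K. \<exists>c. (\<forall>b\<in>B. c b \<in> Qp) \<and> x = (\<Sum>b\<in>B. c b * b)))"

definition value_group :: "('a::field \<Rightarrow> ereal) \<Rightarrow> 'a set \<Rightarrow> real set" where
  "value_group v K = (\<lambda>x. real_of_ereal (v x)) ` (K - {0})"

text \<open>The index of the value group of \<open>\<^bold>Q\<^sub>p\<close> in that of \<open>K\<close>, counted as a number of cosets.\<close>

definition ramification_index :: "('a::{field_char_0, metric_space} \<Rightarrow> ereal) \<Rightarrow> 'a set \<Rightarrow> nat" where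
  "ramification_index v K =
     card (value_group v K //
       {(s, t). s \<in> value_group v K \<and> t \<in> value_group v K \<and> s - t \<in> value_group v Qp})"

definition uniformizer :: "('a::field \<Rightarrow> ereal) \<Rightarrow> 'a set \<Rightarrow> 'a \<Rightarrow> bool" where
  "uniformizer v K \<pi> \<longleftrightarrow> \<pi> \<in> K \<and> \<pi> \<noteq> 0 \<and> 0 < v \<pi> \<and> (\<forall>x\<in>K. 0 < v x \<longrightarrow> v \<pi> \<le> v x)"

text \<open>The normalised valuation \<open>e v\<^sub>p\<close> of a nonzero element of \<open>K\<close>. It is an integer there, so
  the floor only serves to change the type.\<close>

definition v_unif :: "('a::{field_char_0, metric_space} \<Rightarrow> ereal) \<Rightarrow> 'a set \<Rightarrow> 'a \<Rightarrow> int" where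
  "v_unif v K x = \<lfloor>real (ramification_index v K) * real_of_ereal (v x)\<rfloor>"

end

theory Submission
  imports Defs "Jordan_Normal_Form.Char_Poly" "HOL-Computational_Algebra.Polynomial_FPS"
begin

text \<open>
  Write \<open>\<bar>x\<bar>\<close> for the norm \<open>p\<^sup>-\<^sup>v\<^sup>(\<^sup>x\<^sup>)\<close> (called \<open>nrm\<close> below) and \<open>R\<close> for the radius \<open>p\<^sup>-\<^sup>\<alpha>\<close> of the
  circle of valuation \<open>\<alpha> = \<alpha>\<^sub>n = \<beta>\<^sub>m\<close>. On this circle \<open>F\<close> factors as the product of \<open>P = \<Prod>(X - z)\<close>, over its
  roots \<open>z\<close> there, and a series of constant norm \<open>A\<close> with \<open>- log\<^sub>p A = v(F\<^sub>k) + k' \<alpha>\<close>, where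
  \<open>k' = k\<^sub>n\<^sub>-\<^sub>1\<close> and \<open>k = k\<^sub>n\<close>; similarly \<open>\<bar>G\<bar> = B \<bar>Q\<bar>\<close>. So \<open>\<phi>(x)\<close> is governed by
  \<open>max (A \<bar>P(x)\<bar>) (B \<bar>Q(x)\<bar>)\<close>, and \<open>r = Res(P, Q)\<close> is the product of all differences \<open>z - w\<close> of roots
  (\<open>resultant_prod_linear_left\<close>).

  Moving \<open>x\<close> to the closest root of \<open>F G\<close> on the circle brings it no further from any other root, by the
  ultrametric inequality (\<open>max_le_at_nearest_root\<close>). Hence the maximum of \<open>\<phi>\<close> exists and is attained at one
  of finitely many roots. At a root \<open>w\<close> of \<open>G\<close> one has \<open>\<bar>F(w)\<bar> = A \<Prod>\<bar>w - z\<bar>\<close>, and the product of these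
  values over all \<open>w\<close> is \<open>A\<^sup>l\<^sup>-\<^sup>l\<^sup>' \<bar>r\<bar>\<close>. The mean of the valuations gives the lower bound
  (\<open>log_min_le_mean\<close>). As \<open>\<alpha> \<ge> 0\<close>, all differences of roots are integral, so every partial product of \<open>r\<close>
  has at least the norm of \<open>r\<close>, which gives the upper bound (\<open>max_ge_root_dist\<close>).

  If the coefficients lie in a finite extension \<open>K\<close> of \<open>Qp\<close>, the conjugates of \<open>w\<close> over \<open>K\<close> are roots of \<open>G\<close> on
  the circle at which \<open>F\<close> has the same norm as at \<open>w\<close>. If there are \<open>d\<close> of them, the factor of \<open>r\<close> belonging to
  \<open>w\<close> occurs \<open>d\<close> times, so \<open>v(r)\<close> may be divided by \<open>d\<close>; and the denominator of \<open>e \<alpha>\<close> divides \<open>d\<close>, which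
  is the origin of the greatest common divisors (\<open>conjugates_on_circle\<close>, \<open>log_nrm_at_root_ge\<close>). To have
  algebraic roots, \<open>F\<close> and \<open>G\<close> are first truncated so far out that neither \<open>\<bar>r\<bar>\<close> nor \<open>\<phi>\<close> changes
  (\<open>log_max_ge_over_finite_extension\<close>).

  Two facts about the field carry this. First, the factorisation on a circle: \<open>F\<close> is approximated by
  polynomials over the algebraic closure of \<open>Qp\<close>, which split; their roots on the circle are counted by the
  Newton polygon and converge to a root of \<open>F\<close>, which is divided out (\<open>ex_root_on_circle\<close>,
  \<open>circle_poly_factorization\<close>). Second, conjugate elements have the same norm: on the finite-dimensional space
  \<open>Qp(w)\<close> over the complete field \<open>Qp\<close> the norm is comparable to the size of the coordinates, and passing to
  powers removes the constant of comparison (\<open>nrm_poly_conj\<close>).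
\<close>

section \<open>Resultants of products of linear factors\<close>

abbreviation lin_prod :: "'a::comm_ring_1 list \<Rightarrow> 'a poly" where
  "lin_prod zs \<equiv> \<Prod>z\<leftarrow>zs. [:- z, 1:]"

text \<open>The Sylvester matrix lists the coefficients of shifted copies of two polynomials. Describing its rows as
  polynomials turns row and column operations into identities between polynomials.\<close>

definition coeff_mat :: "nat \<Rightarrow> (nat \<Rightarrow> 'a::comm_ring_1 poly) \<Rightarrow> 'a mat" where
  "coeff_mat d r = mat d d (\<lambda>(i, j). coeff (r i) (d - 1 - j))"

lemma coeff_synthetic_div:
  fixes q :: "'a::comm_ring_1 poly"
  shows "coeff q t = coeff (pCons (poly q z) (synthetic_div q z)) t - z * coeff (synthetic_div q z) t"
proof -
  have "q + smult z (synthetic_div q z) = pCons (poly q z) (synthetic_div q z)"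
    by (rule synthetic_div_correct)
  hence "coeff (q + smult z (synthetic_div q z)) t
       = coeff (pCons (poly q z) (synthetic_div q z)) t" by simp
  thus ?thesis by (simp add: algebra_simps)
qed

text \<open>Replacing the basis \<open>X\<^sup>d, \<dots>, X, 1\<close> by \<open>(X - z) X\<^sup>d\<^sup>-\<^sup>1, \<dots>, X - z, 1\<close> is a unitriangular column
  operation. Since \<open>r = r(z) + (X - z) h\<close> with \<open>h\<close> the quotient of synthetic division, the new coordinates of
  \<open>r\<close> are the coefficients of \<open>h\<close> together with \<open>r(z)\<close>.\<close>

lemma det_coeff_mat_synthetic_div:
  fixes r :: "nat \<Rightarrow> 'a::field poly"
  assumes deg: "\<And>i. i < Suc d \<Longrightarrow> degree (r i) \<le> d"
  shows "det (coeff_mat (Suc d) r)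
       = det (coeff_mat (Suc d) (\<lambda>i. pCons (poly (r i) z) (synthetic_div (r i) z)))"
proof -
  define B where "B = coeff_mat (Suc d) (\<lambda>i. pCons (poly (r i) z) (synthetic_div (r i) z))"
  define C where "C = mat (Suc d) (Suc d)
    (\<lambda>(i, j). if i = j then 1 else if Suc i = j then - z else 0 :: 'a)"
  have B: "B \<in> carrier_mat (Suc d) (Suc d)" and C: "C \<in> carrier_mat (Suc d) (Suc d)"
    by (auto simp: B_def C_def coeff_mat_def)
  have detC: "det C = 1"
  proof -
    have "det C = prod_list (diag_mat C)"
      by (rule det_upper_triangular[OF _ C]) (auto simp: C_def upper_triangular_def)
    also have "diag_mat C = map (\<lambda>_. 1) [0..<Suc d]"
      unfolding diag_mat_def by (rule map_cong) (auto simp: C_def)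
    finally show ?thesis by (simp add: map_replicate_const prod_list_replicate)
  qed
  have "coeff_mat (Suc d) r = B * C"
  proof (rule eq_matI)
    fix i j assume "i < dim_row (B * C)" "j < dim_col (B * C)"
    hence i: "i < Suc d" and j: "j < Suc d" using B C by auto
    have "(B * C) $$ (i, j) = (\<Sum>k<Suc d. B $$ (i, k) * C $$ (k, j))"
      using i j B C by (simp add: scalar_prod_def atLeast0LessThan)
    also have "\<dots> = (\<Sum>k<Suc d. (if k = j then B $$ (i, k) else 0)
                 + (if Suc k = j then - z * B $$ (i, k) else 0))"
      by (rule sum.cong) (auto simp: C_def j)
    also have "\<dots> = B $$ (i, j) + (if j = 0 then 0 else - z * B $$ (i, j - 1))"
    proof -
      have "(\<Sum>k<Suc d. (if Suc k = j then - z * B $$ (i, k) else 0))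
         = (if j = 0 then 0 else - z * B $$ (i, j - 1))"
        using j by (cases j) (auto simp: sum.delta)
      thus ?thesis using j by (simp only: sum.distrib) (simp add: sum.delta del: sum.lessThan_Suc)
    qed
    also have "\<dots> = coeff (r i) (d - j)"
    proof (cases "j = 0")
      case True
      have "coeff (synthetic_div (r i) z) d = 0"
        using deg[OF i] by (cases "degree (r i) = 0")
          (auto intro!: coeff_eq_0 simp: degree_synthetic_div synthetic_div_eq_0_iff[THEN iffD2])
      thus ?thesis using i True by (simp add: B_def coeff_mat_def coeff_synthetic_div[of "r i" d z])
    next
      case False
      hence "Suc d - 1 - (j - 1) = Suc (d - j)" using j by simp
      thus ?thesis using i j False
        by (simp add: B_def coeff_mat_def coeff_synthetic_div[of "r i" "d - j" z])
    qed
    finally show "coeff_mat (Suc d) r $$ (i, j) = (B * C) $$ (i, j)"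
      using i j by (simp add: coeff_mat_def)
  qed (use B C in \<open>auto simp: coeff_mat_def\<close>)
  hence "det (coeff_mat (Suc d) r) = det B * det C" using det_mult[OF B C] by simp
  thus ?thesis by (simp add: detC B_def)
qed

text \<open>In the basis \<open>(X - z) X\<^sup>i, 1\<close> the multiples of \<open>X - z\<close> have no component along \<open>1\<close>, so the last column
  contains only the value at \<open>z\<close> of the last row.\<close>

lemma det_coeff_mat_factor:
  fixes r :: "nat \<Rightarrow> 'a::field poly"
  assumes r: "\<And>i. i < d \<Longrightarrow> r i = [:- z, 1:] * s i"
    and deg: "\<And>i. i < Suc d \<Longrightarrow> degree (r i) \<le> d"
  shows "det (coeff_mat (Suc d) r) = poly (r d) z * det (coeff_mat d s)"
proof -
  have syn: "synthetic_div (r i) z = s i" if "i < d" for i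
  proof -
    have "r i + smult z (s i) = pCons 0 (s i)" by (simp add: r[OF that] algebra_simps)
    thus ?thesis using synthetic_div_unique by metis
  qed
  define B where "B = coeff_mat (Suc d) (\<lambda>i. pCons (poly (r i) z) (synthetic_div (r i) z))"
  have "B = four_block_mat (coeff_mat d s) (0\<^sub>m d 1)
     (mat 1 d (\<lambda>(i, j). coeff (synthetic_div (r d) z) (d - 1 - j))) (mat 1 1 (\<lambda>_. poly (r d) z))"
  proof (rule eq_matI, goal_cases)
    case (1 i j)
    hence i: "i < Suc d" and j: "j < Suc d" by (auto simp: coeff_mat_def)
    consider "i < d" "j < d" | "i < d" "j = d" | "i = d" "j < d" | "i = d" "j = d"
      using i j by linarith
    thus ?case
    proof cases
      case 1
      moreover obtain t where "d - j = Suc t" "d - 1 - j = t" using 1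
        by (metis Suc_diff_Suc diff_Suc_eq_diff_pred diff_commute)
      ultimately show ?thesis by (auto simp: B_def coeff_mat_def syn)
    next
      case 3
      moreover obtain t where "d - j = Suc t" "d - 1 - j = t" using 3
        by (metis Suc_diff_Suc diff_Suc_eq_diff_pred diff_commute)
      ultimately show ?thesis by (auto simp: B_def coeff_mat_def)
    qed (auto simp: B_def coeff_mat_def r)
  qed (auto simp: B_def coeff_mat_def)
  hence "det B = det (coeff_mat d s) * det (mat 1 1 (\<lambda>_. poly (r d) z))"
    by (simp, intro det_four_block_mat_upper_right_zero) (auto simp: coeff_mat_def)
  also have "det (mat 1 1 (\<lambda>_. poly (r d) z)) = poly (r d) z" by (simp add: det_single)
  finally show ?thesis using det_coeff_mat_synthetic_div[of d r z] deg by (simp add: B_def)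
qed

text \<open>This turns the shifted copies \<open>X\<^sup>i\<^sup>+\<^sup>1 Q\<close> into \<open>(X - z) X\<^sup>i Q\<close>, for all of them except \<open>Q\<close> itself.\<close>

lemma det_coeff_mat_row_op:
  fixes r :: "nat \<Rightarrow> 'a::field poly"
  shows "det (coeff_mat d (\<lambda>i. r i - smult (if n \<le> i \<and> Suc i < d then z else 0) (r (Suc i))))
       = det (coeff_mat d r)"
proof -
  define A where "A = mat d d (\<lambda>(i, j). if i = j then 1
      else if j = Suc i \<and> n \<le> i then - z else 0 :: 'a)"
  let ?B = "coeff_mat d r"
  have A: "A \<in> carrier_mat d d" and B: "?B \<in> carrier_mat d d"
    by (auto simp: A_def coeff_mat_def)
  have detA: "det A = 1"
  proof -
    have "det A = prod_list (diag_mat A)"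
      by (rule det_upper_triangular[OF _ A]) (auto simp: A_def upper_triangular_def)
    also have "diag_mat A = map (\<lambda>_. 1) [0..<d]"
      unfolding diag_mat_def by (rule map_cong) (auto simp: A_def)
    finally show ?thesis by (simp add: map_replicate_const prod_list_replicate)
  qed
  have "coeff_mat d (\<lambda>i. r i - smult (if n \<le> i \<and> Suc i < d then z else 0) (r (Suc i))) = A * ?B"
  proof (rule eq_matI, goal_cases)
    case (1 i j)
    hence i: "i < d" and j: "j < d" using A B by auto
    have "(A * ?B) $$ (i, j) = (\<Sum>k<d. A $$ (i, k) * ?B $$ (k, j))"
      using i j A B by (simp add: scalar_prod_def atLeast0LessThan)
    also have "\<dots> = (\<Sum>k<d. (if k = i then ?B $$ (k, j) else 0)
                 + (if k = Suc i then (if n \<le> i then - z else 0) * ?B $$ (k, j) else 0))"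
      by (rule sum.cong) (auto simp: A_def i)
    also have "\<dots> = ?B $$ (i, j) + (if Suc i < d then (if n \<le> i then - z else 0) * ?B $$ (Suc i, j) else 0)"
      unfolding sum.distrib using i by (simp add: sum.delta)
    finally show ?case using i j by (auto simp: coeff_mat_def)
  qed (auto simp: A_def coeff_mat_def)
  thus ?thesis using det_mult[OF A B] by (simp add: detA)
qed

definition sylvester_row :: "'a::comm_ring_1 poly \<Rightarrow> 'a poly \<Rightarrow> nat \<Rightarrow> nat \<Rightarrow> nat \<Rightarrow> 'a poly" where
  "sylvester_row P Q m n i =
     (if i < n then monom 1 (n - 1 - i) * P else monom 1 (m + n - 1 - i) * Q)"

lemma resultant_eq_det_coeff_mat:
  assumes m: "m = degree P" and n: "n = degree Q"
  shows "resultant P Q = det (coeff_mat (m + n) (sylvester_row P Q m n))"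
proof -
  have "sylvester_mat P Q = coeff_mat (m + n) (sylvester_row P Q m n)"
  proof (rule eq_matI, goal_cases)
    case (1 i j)
    hence ij: "i < m + n" "j < m + n" by (auto simp: coeff_mat_def)
    have shift: "coeff (monom 1 (Suc a) * p) (Suc b) = coeff (monom 1 a * p) b"
      for a b and p :: "'a poly"
      by (simp add: coeff_monom_mult)
    have "m + n - j = Suc (m + n - 1 - j)" using ij by simp
    moreover have "i < n \<Longrightarrow> n - i = Suc (n - 1 - i)" by simp
    moreover have "m + n - i = Suc (m + n - 1 - i)" using ij by simp
    ultimately show ?case using ij m n
      by (auto simp: sylvester_index_mat2 coeff_mat_def sylvester_row_def shift)
  qed (auto simp: coeff_mat_def m n)
  thus ?thesis by (simp add: resultant_def)
qed

text \<open>After the row operations every row but the last is \<open>X - z\<close> times a row of the Sylvester matrix of \<open>P\<close> and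
  \<open>Q\<close>, and the last row is \<open>Q\<close>.\<close>

lemma resultant_linear_mult:
  fixes P Q :: "'a::field poly"
  assumes P: "P \<noteq> 0"
  shows "resultant ([:- z, 1:] * P) Q = poly Q z * resultant P Q"
proof -
  define m n where "m = degree P" and "n = degree Q"
  have degP: "degree ([:- z, 1:] * P) = Suc m" using degree_mult_eq[of "[:- z, 1:]" P] P by (simp add: m_def del: mult_pCons_left)
  let ?r = "sylvester_row ([:- z, 1:] * P) Q (Suc m) n"
  let ?s = "sylvester_row P Q m n"
  let ?r' = "\<lambda>i. ?r i - smult (if n \<le> i \<and> Suc i < Suc (m + n) then z else 0) (?r (Suc i))"
  have "resultant ([:- z, 1:] * P) Q = det (coeff_mat (Suc m + n) ?r)"
    by (rule resultant_eq_det_coeff_mat) (simp_all only: degP n_def)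
  also have "Suc m + n = Suc (m + n)" by simp
  also have "det (coeff_mat (Suc (m + n)) ?r) = det (coeff_mat (Suc (m + n)) ?r')"
    by (rule det_coeff_mat_row_op[symmetric])
  also have "det (coeff_mat (Suc (m + n)) ?r') = poly (?r' (m + n)) z * det (coeff_mat (m + n) ?s)"
  proof (rule det_coeff_mat_factor)
    fix i assume i: "i < m + n"
    show "?r' i = [:- z, 1:] * ?s i"
    proof (cases "i < n")
      case True thus ?thesis by (simp add: sylvester_row_def algebra_simps)
    next
      case False
      then obtain t where t: "m + n - i = Suc t" "m + n - Suc i = t" "m + n - 1 - i = t"
        using i by (metis Suc_diff_Suc diff_Suc_eq_diff_pred diff_commute)
      have "monom 1 (Suc t) = [:0, 1:] * monom (1::'a) t" by (simp add: monom_Suc)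
      thus ?thesis using False i t by (simp add: sylvester_row_def algebra_simps)
    qed
  next
    fix i assume i: "i < Suc (m + n)"
    have "degree (?r i) \<le> m + n" if "i < Suc (m + n)" for i
    proof (cases "i < n")
      case True
      have "degree (?r i) \<le> (n - 1 - i) + Suc m"
        using True degree_mult_le[of "monom 1 (n - 1 - i)" "[:- z, 1:] * P"]
          degree_monom_le[of "1::'a" "n - 1 - i"] unfolding degP sylvester_row_def by simp
      thus ?thesis using True by simp
    next
      case False
      have "degree (?r i) \<le> (m + n - i) + n"
        using False degree_mult_le[of "monom 1 (m + n - i)" Q]
          degree_monom_le[of "1::'a" "m + n - i"] unfolding n_def sylvester_row_def by simp
      thus ?thesis using False that by simp
    qed
    note d = this
    show "degree (?r' i) \<le> m + n"
    proof (cases "Suc i < Suc (m + n)")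
      case True
      thus ?thesis using d[OF i] d[OF True]
        by (intro degree_diff_le) (auto intro: order_trans[OF degree_smult_le])
    qed (use d[OF i] in auto)
  qed
  also have "?r' (m + n) = Q" by (simp add: sylvester_row_def)
  also have "det (coeff_mat (m + n) ?s) = resultant P Q"
    by (rule resultant_eq_det_coeff_mat[symmetric]) (simp_all add: m_def n_def)
  finally show ?thesis .
qed

lemma resultant_prod_linear_left:
  fixes Q :: "'a::field poly"
  shows "resultant (lin_prod zs) Q = (\<Prod>z\<leftarrow>zs. poly Q z)"
proof (induction zs)
  case (Cons z zs)
  have "lin_prod zs \<noteq> (0 :: 'a poly)" by (auto simp: prod_list_zero_iff)
  from resultant_linear_mult[OF this, of z Q] Cons show ?case
    by (simp del: mult_pCons_left)
qed simp

section \<open>Elements algebraic over a subfield\<close>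

text \<open>Subfields and subrings are subsets of one ambient field here, because \<open>Qp\<close>, its algebraic closure and
  its finite extensions are all given as subsets of the complete field.\<close>

definition sub_field :: "'a::field set \<Rightarrow> bool" where
  "sub_field k \<longleftrightarrow> 1 \<in> k \<and> (\<forall>x\<in>k. \<forall>y\<in>k. x - y \<in> k \<and> x * y \<in> k \<and> inverse x \<in> k)"

definition sub_ring :: "'a::comm_ring_1 set \<Rightarrow> bool" where
  "sub_ring k \<longleftrightarrow> 1 \<in> k \<and> (\<forall>x\<in>k. \<forall>y\<in>k. x - y \<in> k \<and> x * y \<in> k)"

definition poly_over :: "'a::zero set \<Rightarrow> 'a poly \<Rightarrow> bool" where
  "poly_over k f \<longleftrightarrow> (\<forall>i. coeff f i \<in> k)"

definition alg_over :: "'a::comm_ring_1 set \<Rightarrow> 'a set" where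
  "alg_over k = {x. \<exists>P. P \<noteq> 0 \<and> poly_over k P \<and> poly P x = 0}"

definition span_over :: "'a::comm_ring_1 set \<Rightarrow> ('i \<Rightarrow> 'a) \<Rightarrow> 'i set \<Rightarrow> 'a set" where
  "span_over k b I = {\<Sum>i\<in>I. c i * b i | c. \<forall>i\<in>I. c i \<in> k}"

lemma sub_field_imp_sub_ring: "sub_field k \<Longrightarrow> sub_ring k"
  by (auto simp: sub_field_def sub_ring_def)

context
  fixes k :: "'a::comm_ring_1 set" assumes k: "sub_ring k"
begin

lemma sub_ring_1: "1 \<in> k" and sub_ring_diff: "x \<in> k \<Longrightarrow> y \<in> k \<Longrightarrow> x - y \<in> k"
  and sub_ring_mult: "x \<in> k \<Longrightarrow> y \<in> k \<Longrightarrow> x * y \<in> k"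
  using k by (auto simp: sub_ring_def)

lemma sub_ring_0: "0 \<in> k" using sub_ring_diff[OF sub_ring_1 sub_ring_1] by simp

lemma sub_ring_uminus: "x \<in> k \<Longrightarrow> - x \<in> k" using sub_ring_diff[OF sub_ring_0] by simp

lemma sub_ring_add: "x \<in> k \<Longrightarrow> y \<in> k \<Longrightarrow> x + y \<in> k"
  using sub_ring_diff[of x "- y"] sub_ring_uminus by simp

lemma sub_ring_sum: "(\<And>i. i \<in> A \<Longrightarrow> f i \<in> k) \<Longrightarrow> sum f A \<in> k"
  by (induction A rule: infinite_finite_induct) (simp_all add: sub_ring_0 sub_ring_add)

lemma sub_ring_prod: "(\<And>i. i \<in> A \<Longrightarrow> f i \<in> k) \<Longrightarrow> prod f A \<in> k"
  by (induction A rule: infinite_finite_induct) (simp_all add: sub_ring_1 sub_ring_mult)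

lemma sub_ring_power: "x \<in> k \<Longrightarrow> x ^ n \<in> k"
  by (induction n) (simp_all add: sub_ring_1 sub_ring_mult)

lemma sub_ring_of_nat: "of_nat n \<in> k"
  by (induction n) (simp_all add: sub_ring_1 sub_ring_0 sub_ring_add)

lemma sub_ring_poly_over: "sub_ring {f. poly_over k f}"
  unfolding sub_ring_def
proof (intro conjI ballI)
  show "1 \<in> {f. poly_over k f}" by (simp add: poly_over_def coeff_1 sub_ring_1 sub_ring_0)
  fix f g assume fg: "f \<in> {f. poly_over k f}" "g \<in> {f. poly_over k f}"
  show "f - g \<in> {f. poly_over k f}" using fg by (simp add: poly_over_def sub_ring_diff)
  have "coeff (f * g) n \<in> k" for n unfolding coeff_mult
    by (rule sub_ring_sum, rule sub_ring_mult) (use fg in \<open>auto simp: poly_over_def\<close>)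
  thus "f * g \<in> {f. poly_over k f}" by (simp add: poly_over_def)
qed

lemma poly_in_sub_ring: "poly_over k f \<Longrightarrow> x \<in> k \<Longrightarrow> poly f x \<in> k"
  unfolding poly_altdef poly_over_def
  by (rule sub_ring_sum, rule sub_ring_mult) (simp_all add: sub_ring_power)

lemma poly_over_synthetic_div: "poly_over k f \<Longrightarrow> z \<in> k \<Longrightarrow> poly_over k (synthetic_div f z)"
proof (induction f)
  case (pCons a f)
  hence f: "poly_over k f" unfolding poly_over_def by (metis coeff_pCons_Suc)
  show ?case using pCons.IH[OF f pCons.prems(2)] poly_in_sub_ring[OF f pCons.prems(2)]
    by (auto simp: char_poly_matrix_def poly_over_def coeff_pCons split: nat.splits)
qed (simp add: poly_over_def sub_ring_0)

lemma span_over_I: "(\<And>i. i \<in> I \<Longrightarrow> c i \<in> k) \<Longrightarrow> (\<Sum>i\<in>I. c i * b i) \<in> span_over k b I"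
  by (auto simp: span_over_def)

lemma span_over_base: "finite I \<Longrightarrow> i \<in> I \<Longrightarrow> b i \<in> span_over k b I"
proof -
  assume i: "finite I" "i \<in> I"
  have "(\<Sum>j\<in>I. (if j = i then 1 else 0) * b j) = (\<Sum>j\<in>I. if j = i then b j else 0)"
    by (rule sum.cong) auto
  also have "\<dots> = b i" using i by simp
  finally show ?thesis
    using span_over_I[of I "\<lambda>j. if j = i then 1 else 0" b] by (simp add: sub_ring_1 sub_ring_0)
qed

lemma span_over_diff:
  assumes "x \<in> span_over k b I" "y \<in> span_over k b I" shows "x - y \<in> span_over k b I"
proof -
  obtain c d where "\<forall>i\<in>I. c i \<in> k" "\<forall>i\<in>I. d i \<in> k" "x = (\<Sum>i\<in>I. c i * b i)" "y = (\<Sum>i\<in>I. d i * b i)"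
    using assms by (auto simp: span_over_def)
  thus ?thesis using span_over_I[of I "\<lambda>i. c i - d i" b]
    by (simp add: sub_ring_diff left_diff_distrib sum_subtractf)
qed

lemma span_over_scale:
  assumes "x \<in> span_over k b I" "a \<in> k" shows "a * x \<in> span_over k b I"
proof -
  obtain c where "\<forall>i\<in>I. c i \<in> k" "x = (\<Sum>i\<in>I. c i * b i)"
    using assms by (auto simp: span_over_def)
  thus ?thesis using span_over_I[of I "\<lambda>i. a * c i" b] assms(2)
    by (simp add: sub_ring_mult sum_distrib_left mult.assoc)
qed

lemma span_over_0: "0 \<in> span_over k b I"
  using span_over_I[of I "\<lambda>_. 0" b] by (simp add: sub_ring_0)

lemma span_over_add:
  assumes "x \<in> span_over k b I" "y \<in> span_over k b I" shows "x + y \<in> span_over k b I"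
  using span_over_diff[OF assms(1) span_over_diff[OF span_over_0 assms(2)]] by simp

lemma span_over_sum: "(\<And>j. j \<in> J \<Longrightarrow> f j \<in> span_over k b I) \<Longrightarrow> sum f J \<in> span_over k b I"
  by (induction J rule: infinite_finite_induct) (simp_all add: span_over_0 span_over_add)

lemma span_over_stable:
  assumes "\<And>i. i \<in> I \<Longrightarrow> y * b i \<in> span_over k b I" "x \<in> span_over k b I"
  shows "y * x \<in> span_over k b I"
proof -
  obtain c where c: "\<forall>i\<in>I. c i \<in> k" "x = (\<Sum>i\<in>I. c i * b i)"
    using assms by (auto simp: span_over_def)
  have "(\<Sum>i\<in>I. c i * (y * b i)) \<in> span_over k b I"
    using c assms(1) by (intro span_over_sum, intro span_over_scale[of "y * b i" b I "c i" for i]) auto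
  also have "(\<Sum>i\<in>I. c i * (y * b i)) = y * x"
    by (simp add: c sum_distrib_left algebra_simps)
  finally show ?thesis .
qed

end

lemma poly_over_char_poly:
  assumes k: "sub_ring k" and A: "A \<in> carrier_mat n n" "\<And>i j. i < n \<Longrightarrow> j < n \<Longrightarrow> A $$ (i, j) \<in> k"
  shows "poly_over k (char_poly A)"
proof -
  note R = sub_ring_poly_over[OF k]
  have entry: "char_poly_matrix A $$ (i, j) \<in> {f. poly_over k f}" if "i < n" "j < n" for i j
    using that A sub_ring_uminus[OF k A(2)] sub_ring_0[OF k] sub_ring_1[OF k]
    by (auto simp: char_poly_matrix_def poly_over_def coeff_pCons split: nat.splits)
  have "char_poly A = (\<Sum>p\<in>{p. p permutes {0..<n}}. signof p *
      (\<Prod>i = 0..<n. char_poly_matrix A $$ (i, p i)))"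
    unfolding char_poly_def by (rule det_def'[of _ n]) (simp add: A(1))
  also have "\<dots> \<in> {f. poly_over k f}"
  proof (rule sub_ring_sum[OF R], rule sub_ring_mult[OF R])
    fix p assume p: "p \<in> {p. p permutes {0..<n}}"
    show "signof p \<in> {f. poly_over k f}"
      using sub_ring_1[OF R] sub_ring_uminus[OF R sub_ring_1[OF R]] by (cases "evenperm p") (simp_all add: sign_def)
    show "(\<Prod>i = 0..<n. char_poly_matrix A $$ (i, p i)) \<in> {f. poly_over k f}"
    proof (rule sub_ring_prod[OF R])
      fix i assume i: "i \<in> {0..<n}"
      hence "p i \<in> {0..<n}" using p permutes_in_image[of p "{0..<n}" i] by blast
      thus "char_poly_matrix A $$ (i, p i) \<in> {f. poly_over k f}" using i entry by simp
    qed
  qed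
  finally show ?thesis by simp
qed

text \<open>Multiplication by \<open>y\<close> acts on the spanning family through a matrix with entries in \<open>k\<close>; the
  family itself is an eigenvector of that matrix with eigenvalue \<open>y\<close>, so \<open>y\<close> is a root of its
  characteristic polynomial.\<close>

lemma alg_over_if_stable:
  fixes k :: "'a::field set"
  assumes k: "sub_ring k" and I: "finite I" and nz: "i\<^sub>0 \<in> I" "b i\<^sub>0 \<noteq> 0"
    and stable: "\<And>i. i \<in> I \<Longrightarrow> y * b i \<in> span_over k b I"
  shows "y \<in> alg_over k"
proof -
  obtain h where h: "bij_betw h {0..<card I} I" using ex_bij_betw_nat_finite[OF I] by blast
  define n where "n = card I"
  have hI: "h i \<in> I" if "i < n" for i using h that by (auto simp: bij_betw_def n_def)
  have "\<forall>i\<in>I. \<exists>c. (\<forall>j\<in>I. c j \<in> k) \<and> y * b i = (\<Sum>j\<in>I. c j * b j)"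
    using stable by (auto simp: span_over_def)
  then obtain c where c: "\<And>i j. i \<in> I \<Longrightarrow> j \<in> I \<Longrightarrow> c i j \<in> k"
    "\<And>i. i \<in> I \<Longrightarrow> y * b i = (\<Sum>j\<in>I. c i j * b j)" by metis
  define A where "A = mat n n (\<lambda>(i, j). c (h i) (h j))"
  define w where "w = vec n (\<lambda>i. b (h i))"
  have A: "A \<in> carrier_mat n n" by (simp add: A_def)
  obtain j\<^sub>0 where j0: "j\<^sub>0 < n" "h j\<^sub>0 = i\<^sub>0"
  proof -
    have "i\<^sub>0 \<in> h ` {0..<card I}" using h nz(1) by (simp add: bij_betw_def)
    thus ?thesis using that by (auto simp: n_def)
  qed
  have "eigenvector A w y"
    unfolding eigenvector_def
  proof (intro conjI)
    show "w \<in> carrier_vec (dim_row A)" by (simp add: w_def A_def)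
    show "w \<noteq> 0\<^sub>v (dim_row A)"
    proof
      assume "w = 0\<^sub>v (dim_row A)"
      hence "w $ j\<^sub>0 = 0" using j0 by (simp add: A_def)
      thus False using j0 nz by (simp add: w_def)
    qed
    show "A *\<^sub>v w = y \<cdot>\<^sub>v w"
    proof (rule eq_vecI)
      fix i assume "i < dim_vec (y \<cdot>\<^sub>v w)"
      hence i: "i < n" by (simp add: w_def)
      have "(A *\<^sub>v w) $ i = (\<Sum>j = 0..<n. c (h i) (h j) * b (h j))"
        using i by (simp add: A_def w_def scalar_prod_def)
      also have "\<dots> = (\<Sum>j\<in>I. c (h i) j * b j)"
        using h by (intro sum.reindex_bij_betw) (simp add: n_def)
      also have "\<dots> = y * b (h i)" using c(2)[OF hI[OF i]] by simp
      finally show "(A *\<^sub>v w) $ i = (y \<cdot>\<^sub>v w) $ i" using i by (simp add: w_def)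
    qed (simp add: A_def w_def)
  qed
  hence "eigenvalue A y" unfolding eigenvalue_def by blast
  hence "poly (char_poly A) y = 0" using eigenvalue_root_char_poly[OF A] by simp
  moreover have "char_poly A \<noteq> 0" using degree_monic_char_poly[OF A] by auto
  moreover have "poly_over k (char_poly A)"
    by (rule poly_over_char_poly[OF k A]) (simp add: A_def c(1) hI)
  ultimately show ?thesis by (auto simp: alg_over_def)
qed

lemma alg_over_power_reduction:
  fixes k :: "'a::field set"
  assumes k: "sub_field k" and x: "x \<in> alg_over k"
  obtains d c where "d > 0" "\<And>i. c i \<in> k" "x ^ d = (\<Sum>i<d. c i * x ^ i)"
proof -
  note kr = sub_field_imp_sub_ring[OF k]
  from x obtain P where P: "P \<noteq> 0" "poly_over k P" "poly P x = 0" by (auto simp: alg_over_def)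
  define d where "d = degree P"
  have d: "d > 0"
  proof (rule ccontr)
    assume "\<not> d > 0"
    then obtain a where "P = [:a:]" by (auto simp: d_def dest: degree_eq_zeroE)
    thus False using P by simp
  qed
  define c where "c i = - coeff P i * inverse (coeff P d)" for i
  have "coeff P d * x ^ d + (\<Sum>i<d. coeff P i * x ^ i) = 0"
    using P(3) unfolding poly_altdef d_def by (simp add: lessThan_Suc_atMost[symmetric] add.commute)
  hence "coeff P d * x ^ d = - (\<Sum>i<d. coeff P i * x ^ i)" by (simp add: add_eq_0_iff2)
  moreover have "coeff P d \<noteq> 0" using P by (simp add: d_def)
  ultimately have "x ^ d = inverse (coeff P d) * (- (\<Sum>i<d. coeff P i * x ^ i))"
    by (metis mult.assoc left_inverse mult_1)
  also have "\<dots> = (\<Sum>i<d. c i * x ^ i)"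
    by (simp add: c_def sum_distrib_left sum_negf algebra_simps)
  finally have "x ^ d = (\<Sum>i<d. c i * x ^ i)" .
  moreover have "c i \<in> k" for i
    using P(2) k sub_ring_uminus[OF kr] unfolding c_def poly_over_def sub_field_def by blast
  ultimately show ?thesis using d that by blast
qed

text \<open>The monomials \<open>x\<^sup>i y\<^sup>j\<close> of bounded degree span a module stable under multiplication by \<open>x\<close> and by \<open>y\<close>,
  hence also by \<open>x - y\<close> and \<open>x y\<close>.\<close>

lemma sub_ring_alg_over:
  fixes k :: "'a::field set"
  assumes k: "sub_field k"
  shows "sub_ring (alg_over k)"
proof -
  note kr = sub_field_imp_sub_ring[OF k]
  have main: "x - y \<in> alg_over k \<and> x * y \<in> alg_over k" if x: "x \<in> alg_over k" and y: "y \<in> alg_over k" for x y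
  proof -
    obtain d c where d: "d > 0" "\<And>i. c i \<in> k" "x ^ d = (\<Sum>i<d. c i * x ^ i)"
      using alg_over_power_reduction[OF k x] by blast
    obtain e c' where e: "e > 0" "\<And>i. c' i \<in> k" "y ^ e = (\<Sum>i<e. c' i * y ^ i)"
      using alg_over_power_reduction[OF k y] by blast
    define I where "I = {..<d} \<times> {..<e}"
    define b where "b = (\<lambda>(i, j). x ^ i * y ^ j)"
    have I: "finite I" "(0, 0) \<in> I" "b (0, 0) \<noteq> 0" using d e by (auto simp: I_def b_def)
    have in_span: "x ^ i * y ^ j \<in> span_over k b I" if "i < d" "j < e" for i j
      using span_over_base[OF kr I(1), of "(i, j)" b] that by (simp add: I_def b_def)
    have sx: "x * b i \<in> span_over k b I" if i: "i \<in> I" for i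
    proof -
      obtain u v where uv: "i = (u, v)" "u < d" "v < e" using i by (auto simp: I_def)
      show ?thesis
      proof (cases "Suc u < d")
        case True
        thus ?thesis using in_span[OF True uv(3)] uv by (simp add: b_def mult.assoc)
      next
        case False
        hence "Suc u = d" using uv by simp
        hence "x * b i = x ^ d * y ^ v" using uv by (auto simp: b_def mult.assoc)
        also have "\<dots> = (\<Sum>i<d. c i * (x ^ i * y ^ v))" by (simp add: d(3) sum_distrib_right mult.assoc)
        also have "\<dots> \<in> span_over k b I"
          by (rule span_over_sum[OF kr], rule span_over_scale[OF kr in_span]) (use uv d(2) in auto)
        finally show ?thesis .
      qed
    qed
    have sy: "y * b i \<in> span_over k b I" if i: "i \<in> I" for i
    proof -
      obtain u v where uv: "i = (u, v)" "u < d" "v < e" using i by (auto simp: I_def)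
      show ?thesis
      proof (cases "Suc v < e")
        case True
        thus ?thesis using in_span[OF uv(2) True] uv by (simp add: b_def mult_ac)
      next
        case False
        hence "Suc v = e" using uv by simp
        hence "y * b i = x ^ u * y ^ e" using uv by (auto simp: b_def mult_ac)
        also have "\<dots> = (\<Sum>i<e. c' i * (x ^ u * y ^ i))"
          by (simp add: e(3) sum_distrib_left mult_ac)
        also have "\<dots> \<in> span_over k b I"
          by (rule span_over_sum[OF kr], rule span_over_scale[OF kr in_span]) (use uv e(2) in auto)
        finally show ?thesis .
      qed
    qed
    have "(x - y) * b i \<in> span_over k b I" if "i \<in> I" for i
      using span_over_diff[OF kr sx[OF that] sy[OF that]] by (simp add: left_diff_distrib)
    moreover have "(x * y) * b i \<in> span_over k b I" if "i \<in> I" for i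
      using span_over_stable[OF kr sx sy[OF that]] by (simp add: mult.assoc)
    ultimately show ?thesis using alg_over_if_stable[where b = b, OF kr I] by blast
  qed
  have "1 \<in> alg_over k"
    unfolding alg_over_def poly_over_def
    by (rule CollectI, rule exI[of _ "[:-1, 1:]"])
       (auto simp: coeff_pCons sub_ring_0[OF kr] sub_ring_1[OF kr] sub_ring_uminus[OF kr sub_ring_1[OF kr]] split: nat.split)
  thus ?thesis using main by (simp add: sub_ring_def)
qed

section \<open>Minimal polynomials\<close>

definition min_poly_over :: "'a::field set \<Rightarrow> 'a \<Rightarrow> 'a poly \<Rightarrow> bool" where
  "min_poly_over k w f \<longleftrightarrow> lead_coeff f = 1 \<and> poly_over k f \<and> poly f w = 0 \<and>
     (\<forall>g. poly_over k g \<and> g \<noteq> 0 \<and> poly g w = 0 \<longrightarrow> degree f \<le> degree g)"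

lemma poly_over_smult: "sub_ring k \<Longrightarrow> a \<in> k \<Longrightarrow> poly_over k f \<Longrightarrow> poly_over k (smult a f)"
  by (simp add: poly_over_def sub_ring_mult)

lemma ex_min_poly_over:
  assumes k: "sub_field k" and w: "w \<in> alg_over k"
  obtains f where "min_poly_over k w f"
proof -
  define Q where "Q g \<longleftrightarrow> poly_over k g \<and> g \<noteq> 0 \<and> poly g w = 0" for g
  obtain g0 where "Q g0" using w by (auto simp: alg_over_def Q_def)
  then obtain g where g: "Q g" "\<And>h. Q h \<Longrightarrow> degree g \<le> degree h"
    using ex_has_least_nat[of Q g0 degree] by blast
  define f where "f = smult (inverse (lead_coeff g)) g"
  have "inverse (lead_coeff g) \<in> k"
    using g(1) k by (auto simp: Q_def poly_over_def sub_field_def)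
  moreover have "lead_coeff g \<noteq> 0" using g(1) by (simp add: Q_def)
  ultimately have "min_poly_over k w f"
    using g poly_over_smult[OF sub_field_imp_sub_ring[OF k]]
    by (auto simp: min_poly_over_def f_def Q_def)
  thus ?thesis by (rule that)
qed

lemma poly_over_division:
  fixes k :: "'a::field set"
  assumes k: "sub_ring k" and f: "poly_over k f" "lead_coeff f = 1" and g: "poly_over k g"
  obtains q r where "poly_over k q" "poly_over k r" "g = f * q + r" "r = 0 \<or> degree r < degree f"
proof -
  note R = sub_ring_poly_over[OF k]
  have f0: "f \<noteq> 0" using f(2) by auto
  have "poly_over k g \<Longrightarrow> \<exists>q r. poly_over k q \<and> poly_over k r \<and> g = f * q + r \<and> (r = 0 \<or> degree r < degree f)"
  proof (induction "if g = 0 then 0 else Suc (degree g)" arbitrary: g rule: less_induct)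
    case less
    show ?case
    proof (cases "g = 0 \<or> degree g < degree f")
      case True
      thus ?thesis using less.prems sub_ring_0[OF R] by (intro exI[of _ 0] exI[of _ g]) auto
    next
      case False
      define m where "m = monom (lead_coeff g) (degree g - degree f)"
      define g' where "g' = g - f * m"
      have m: "poly_over k m" using less.prems sub_ring_0[OF k] by (auto simp: m_def poly_over_def)
      have g': "poly_over k g'"
        using sub_ring_diff[OF R, of g "f * m"] sub_ring_mult[OF R, of f m] m f less.prems
        by (simp add: g'_def)
      have m0: "m \<noteq> 0" using False by (simp add: m_def monom_eq_0_iff)
      have dm: "degree (f * m) = degree g" using False f0 m0
        by (subst degree_mult_eq) (auto simp: m_def degree_monom_eq)
      have lm: "coeff (f * m) (degree g) = lead_coeff g"
        using lead_coeff_mult[of f m] False unfolding dm by (simp add: m_def degree_monom_eq f(2))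
      have "g' = 0 \<or> degree g' < degree g"
      proof (cases "degree g = 0")
        case True
        hence "degree g' = 0" using dm degree_diff_le[of g 0 "f * m"] by (simp add: g'_def)
        moreover have "coeff g' 0 = 0" using lm True by (simp add: g'_def)
        ultimately show ?thesis by (metis degree_eq_zeroE coeff_pCons_0 pCons_0_0)
      next
        case False
        have "degree g' \<le> degree g" using dm by (auto simp: g'_def intro: degree_diff_le)
        moreover have "coeff g' (degree g) = 0" using lm by (simp add: g'_def)
        ultimately show ?thesis using False eq_zero_or_degree_less by blast
      qed
      with False have lt: "(if g' = 0 then 0 else Suc (degree g')) < (if g = 0 then 0 else Suc (degree g))"
        by auto
      then obtain q r where qr: "poly_over k q" "poly_over k r" "g' = f * q + r" "r = 0 \<or> degree r < degree f"
        using less.hyps[OF lt g'] by blast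
      have "poly_over k (q + m)" using sub_ring_add[OF R, of q m] qr m by simp
      moreover have "g = f * (q + m) + r" using qr(3) by (simp add: g'_def algebra_simps)
      ultimately show ?thesis using qr by blast
    qed
  qed
  thus ?thesis using g that by blast
qed

context
  fixes k :: "'a::field set" assumes k: "sub_field k"
begin

lemma min_poly_over_factor:
  assumes f: "min_poly_over k w f" and g: "poly_over k g" "poly g w = 0"
  obtains q where "poly_over k q" "g = f * q"
proof -
  obtain q r where qr: "poly_over k q" "poly_over k r" "g = f * q + r" "r = 0 \<or> degree r < degree f"
    using poly_over_division[OF sub_field_imp_sub_ring[OF k] _ _ g(1), of f] f
    unfolding min_poly_over_def by blast
  have "poly r w = 0" using qr(3) g(2) f by (auto simp: min_poly_over_def)
  hence "r = 0" using qr f by (force simp: min_poly_over_def)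
  thus ?thesis using qr that by simp
qed

text \<open>If \<open>f'\<close> is the minimal polynomial of \<open>w'\<close>, then \<open>f = f' q\<close>. Here \<open>q(w) = 0\<close> would contradict the
  minimality of \<open>f\<close>, so \<open>f'(w) = 0\<close> and \<open>f'\<close> has the degree of \<open>f\<close>.\<close>

lemma min_poly_over_conj:
  assumes f: "min_poly_over k w f" and w': "poly f w' = 0"
  shows "min_poly_over k w' f"
proof -
  have f0: "f \<noteq> 0" using f by (auto simp: min_poly_over_def)
  have "w' \<in> alg_over k" using f w' f0 by (auto simp: min_poly_over_def alg_over_def)
  then obtain f' where f': "min_poly_over k w' f'" using ex_min_poly_over[OF k] by blast
  obtain q where q: "poly_over k q" "f = f' * q"
    by (rule min_poly_over_factor[OF f', of f]) (use f w' in \<open>auto simp: min_poly_over_def\<close>)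
  have nz: "f' \<noteq> 0" "q \<noteq> 0" using f0 q by auto
  have deg: "degree f = degree f' + degree q" using q nz by (simp add: degree_mult_eq)
  have df': "degree f' > 0"
  proof (rule ccontr)
    assume "\<not> degree f' > 0"
    then obtain a where "f' = [:a:]" by (auto dest: degree_eq_zeroE)
    thus False using f' by (auto simp: min_poly_over_def)
  qed
  have "poly f' w = 0"
  proof (rule ccontr)
    assume "poly f' w \<noteq> 0"
    hence "poly q w = 0" using f q by (auto simp: min_poly_over_def)
    hence "degree f \<le> degree q" using f q nz by (auto simp: min_poly_over_def)
    thus False using deg df' by simp
  qed
  hence "degree f \<le> degree f'" using f f' nz by (auto simp: min_poly_over_def)
  thus ?thesis using f f' w' unfolding min_poly_over_def by (meson order_trans)
qed

lemma min_poly_over_transfer: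
  assumes f: "min_poly_over k w f" and w': "poly f w' = 0" and g: "poly_over k g" "poly g w = 0"
  shows "poly g w' = 0"
proof -
  obtain q where "g = f * q" by (rule min_poly_over_factor[OF f g])
  thus ?thesis using w' by simp
qed

end

text \<open>In characteristic zero the derivative of the minimal polynomial is nonzero of smaller degree, so
  it cannot share a root with the minimal polynomial.\<close>

lemma distinct_roots_min_poly_over:
  fixes k :: "'a::field_char_0 set"
  assumes k: "sub_field k" and f: "min_poly_over k w (lin_prod us)"
  shows "distinct us"
proof (rule ccontr)
  let ?f = "lin_prod us"
  assume "\<not> distinct us"
  then obtain xs ys zs y where us: "us = xs @ [y] @ ys @ [y] @ zs"
    using not_distinct_decomp by blast
  define g where "g = lin_prod (xs @ ys @ zs)"
  have fg: "?f = [:- y, 1:] * ([:- y, 1:] * g)" unfolding us g_def by (simp add: mult_ac del: mult_pCons_left mult_pCons_right)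
  have "poly ?f y = 0" unfolding fg by simp
  hence fy: "min_poly_over k y ?f" by (rule min_poly_over_conj[OF k f])
  have f0: "?f \<noteq> 0" using f by (auto simp: min_poly_over_def)
  have "g \<noteq> 0" using f0 fg by auto
  hence deg: "degree ?f \<noteq> 0" unfolding fg by (simp add: degree_mult_eq del: mult_pCons_left mult_pCons_right)
  have "poly (pderiv ?f) y = 0" unfolding fg pderiv_mult by simp
  moreover have "poly_over k (pderiv ?f)"
  proof -
    have "poly_over k ?f" using f by (simp add: min_poly_over_def)
    thus ?thesis unfolding poly_over_def coeff_pderiv
      using sub_ring_mult[OF sub_field_imp_sub_ring[OF k] sub_ring_of_nat[OF sub_field_imp_sub_ring[OF k]]] by blast
  qed
  moreover have "pderiv ?f \<noteq> 0" using deg by (simp add: pderiv_eq_0_iff)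
  ultimately have "degree ?f \<le> degree (pderiv ?f)" using fy by (auto simp: min_poly_over_def)
  thus False using deg by (simp add: degree_pderiv)
qed

section \<open>Finite quotients of groups of reals\<close>

text \<open>Translation by \<open>\<gamma>\<close> permutes the \<open>e\<close> cosets. The sum of representatives of all cosets therefore changes only by an
  integer when each is increased by \<open>\<gamma>\<close>, so \<open>e \<gamma>\<close> is an integer. An infinite quotient has cardinality 0, for which the claim is
  trivial.\<close>

lemma card_cosets_mult_in_Ints:
  fixes \<Gamma> \<Delta> :: "real set"
  assumes \<Gamma>: "\<And>s t. s \<in> \<Gamma> \<Longrightarrow> t \<in> \<Gamma> \<Longrightarrow> s + t \<in> \<Gamma>"
    and \<Delta>: "0 \<in> \<Delta>" "\<And>s t. s \<in> \<Delta> \<Longrightarrow> t \<in> \<Delta> \<Longrightarrow> s - t \<in> \<Delta>" "\<Delta> \<subseteq> \<int>"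
    and \<gamma>: "\<gamma> \<in> \<Gamma>"
  shows "real (card (\<Gamma> // {(s, t). s \<in> \<Gamma> \<and> t \<in> \<Gamma> \<and> s - t \<in> \<Delta>})) * \<gamma> \<in> \<int>"
proof -
  define r where "r = {(s, t). s \<in> \<Gamma> \<and> t \<in> \<Gamma> \<and> s - t \<in> \<Delta>}"
  have neg: "- s \<in> \<Delta>" if "s \<in> \<Delta>" for s using \<Delta>(2)[OF \<Delta>(1) that] by simp
  have add: "s + t \<in> \<Delta>" if "s \<in> \<Delta>" "t \<in> \<Delta>" for s t using \<Delta>(2)[OF that(1) neg[OF that(2)]] by simp
  have eq: "equiv \<Gamma> r"
  proof (rule equivI)
    show "r \<subseteq> \<Gamma> \<times> \<Gamma>" by (auto simp: r_def)
    show "refl_on \<Gamma> r" using \<Delta>(1) by (auto simp: refl_on_def r_def)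
    show "sym r"
    proof (rule symI)
      fix s t assume "(s, t) \<in> r"
      thus "(t, s) \<in> r" using neg[of "s - t"] by (simp add: r_def)
    qed
    show "trans r"
    proof (rule transI)
      fix s t u assume "(s, t) \<in> r" "(t, u) \<in> r"
      thus "(s, u) \<in> r" using add[of "s - t" "t - u"] by (simp add: r_def)
    qed
  qed
  show ?thesis
  proof (cases "finite (\<Gamma> // r)")
    case True
    define Q where "Q = \<Gamma> // r"
    define rep where "rep c = (SOME s. s \<in> c)" for c :: "real set"
    have rep: "rep c \<in> c" if "c \<in> Q" for c
    proof -
      have "c \<noteq> {}" using in_quotient_imp_non_empty[OF eq] that by (simp add: Q_def)
      thus ?thesis unfolding rep_def by (simp add: some_in_eq)
    qed
    have rep_\<Gamma>: "rep c \<in> \<Gamma>" if "c \<in> Q" for c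
      using rep[OF that] in_quotient_imp_subset[OF eq] that by (auto simp: Q_def)
    define T where "T c = r `` {rep c + \<gamma>}" for c
    have TQ: "T c \<in> Q" if "c \<in> Q" for c
      unfolding T_def Q_def using rep_\<Gamma>[OF that] \<gamma> \<Gamma> by (intro quotientI)
    have T_rel: "rep (T c) - rep c - \<gamma> \<in> \<Delta>" if "c \<in> Q" for c
    proof -
      have "rep (T c) \<in> r `` {rep c + \<gamma>}" using rep[OF TQ[OF that]] T_def[of c] by simp
      hence "(rep c + \<gamma>, rep (T c)) \<in> r" by simp
      hence "rep c + \<gamma> - rep (T c) \<in> \<Delta>" by (simp add: r_def)
      from neg[OF this] show ?thesis by (simp add: diff_diff_eq)
    qed
    have "inj_on T Q"
    proof (rule inj_onI)
      fix c c' assume c: "c \<in> Q" "c' \<in> Q" "T c = T c'"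
      have "(rep (T c') - rep c' - \<gamma>) - (rep (T c) - rep c - \<gamma>) = rep c - rep c'" using c(3) by simp
      hence "rep c - rep c' \<in> \<Delta>" using \<Delta>(2)[OF T_rel[OF c(2)] T_rel[OF c(1)]] by (simp only:)
      hence "(rep c, rep c') \<in> r" using c rep_\<Gamma> by (simp add: r_def)
      thus "c = c'" using quotient_eqI[OF eq _ _ rep[OF c(1)] rep[OF c(2)]] c by (simp add: Q_def)
    qed
    hence "bij_betw T Q Q"
      using endo_inj_surj[of Q T] True TQ by (auto simp: bij_betw_def Q_def)
    hence "(\<Sum>c\<in>Q. rep (T c)) = (\<Sum>c\<in>Q. rep c)" by (rule sum.reindex_bij_betw)
    hence "real (card Q) * \<gamma> = - (\<Sum>c\<in>Q. rep (T c) - rep c - \<gamma>)"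
      by (simp add: sum_subtractf)
    moreover have "(\<Sum>c\<in>Q. rep (T c) - rep c - \<gamma>) \<in> \<int>"
      using T_rel \<Delta>(3) by (intro Ints_sum) auto
    ultimately show ?thesis unfolding r_def[symmetric] Q_def[symmetric] by simp
  qed (simp add: r_def)
qed

section \<open>The norm\<close>

context padic_complex
begin

text \<open>The norm carries the same information as \<open>v\<close>, but takes the value 0 instead of \<open>\<infinity>\<close>, so that limits,
  products and sums over roots stay in the real numbers. A circle \<open>v x = \<alpha>\<close> becomes \<open>nrm x = R\<close> with
  \<open>R = p\<^sup>-\<^sup>\<alpha>\<close>.\<close>

definition nrm :: "'a \<Rightarrow> real" where "nrm x = dist x 0"

lemma p_gt_1: "real p > 1" using prime_p prime_gt_1_nat by auto

lemma v_real: "x \<noteq> 0 \<Longrightarrow> v x = ereal (real_of_ereal (v x))"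
  using v_infinity_iff[of x] v_not_minus_infinity[of x] by (cases "v x") auto

lemma v_0 [simp]: "v 0 = \<infinity>" using v_infinity_iff by simp

lemma nrm_eq_powr: "nrm x = (if x = 0 then 0 else real p powr (- real_of_ereal (v x)))"
  using dist_eq[of x 0] by (simp add: nrm_def)

lemma dist_eq_nrm: "dist x y = nrm (x - y)"
  unfolding nrm_eq_powr dist_eq by simp

lemma nrm_0 [simp]: "nrm 0 = 0" and nrm_nonneg [simp]: "0 \<le> nrm x"
  and nrm_eq_0_iff [simp]: "nrm x = 0 \<longleftrightarrow> x = 0"
  by (auto simp: nrm_def)

lemma nrm_pos_iff [simp]: "0 < nrm x \<longleftrightarrow> x \<noteq> 0"
  by (simp add: nrm_def)

lemma nrm_le_0_iff [simp]: "nrm x \<le> 0 \<longleftrightarrow> x = 0"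
  using nrm_nonneg[of x] nrm_eq_0_iff[of x] by linarith

lemma v_eq_log: "x \<noteq> 0 \<Longrightarrow> v x = ereal (- log p (nrm x))"
  using v_real[of x] p_gt_1 by (simp add: nrm_eq_powr)

lemma nrm_mult: "nrm (x * y) = nrm x * nrm y"
proof (cases "x = 0 \<or> y = 0")
  case False
  hence "real_of_ereal (v (x * y)) = real_of_ereal (v x) + real_of_ereal (v y)"
    using v_real[of x] v_real[of y] v_mult[of x y] by (metis plus_ereal.simps(1) real_of_ereal.simps(1))
  thus ?thesis using False by (simp add: nrm_eq_powr flip: powr_add)
qed auto

lemma nrm_le_iff_v: "nrm x \<le> nrm y \<longleftrightarrow> v y \<le> v x"
proof (cases "x = 0 \<or> y = 0")
  case True
  thus ?thesis by (auto simp: v_infinity_iff)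
next
  case False
  hence "nrm x \<le> nrm y \<longleftrightarrow> real_of_ereal (v y) \<le> real_of_ereal (v x)"
    using p_gt_1 by (simp add: nrm_eq_powr)
  thus ?thesis using False v_real[of x] v_real[of y] by (metis ereal_less_eq(3))
qed

lemma nrm_minus [simp]: "nrm (- x) = nrm x"
  using dist_eq_nrm[of 0 x] by (simp add: nrm_def dist_commute)

lemma nrm_minus_commute: "nrm (x - y) = nrm (y - x)"
  using nrm_minus[of "x - y"] by simp

lemma nrm_add_le_max: "nrm (x + y) \<le> max (nrm x) (nrm y)"
proof -
  have "nrm (x + y) \<le> nrm x \<or> nrm (x + y) \<le> nrm y"
    using v_add[of x y] by (auto simp: nrm_le_iff_v min_le_iff_disj)
  thus ?thesis by auto
qed

lemma nrm_diff_le_max: "nrm (x - y) \<le> max (nrm x) (nrm y)"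
  using nrm_add_le_max[of x "- y"] by simp

lemma nrm_ultra: "nrm x \<le> E \<Longrightarrow> nrm y \<le> E \<Longrightarrow> nrm (x + y) \<le> E"
  using nrm_add_le_max[of x y] by simp

lemma nrm_ultra_diff: "nrm x \<le> E \<Longrightarrow> nrm y \<le> E \<Longrightarrow> nrm (x - y) \<le> E"
  using nrm_diff_le_max[of x y] by simp

lemma nrm_add_eq: "nrm x < nrm y \<Longrightarrow> nrm (x + y) = nrm y"
  using nrm_add_le_max[of x y] nrm_diff_le_max[of "x + y" x] by auto

lemma nrm_diff_eq: "nrm x < nrm y \<Longrightarrow> nrm (y - x) = nrm y"
  using nrm_add_eq[of "- x" y] by simp

lemma nrm_eq_if_close: "nrm (x - y) < nrm x \<or> nrm (x - y) < nrm y \<Longrightarrow> nrm x = nrm y"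
  using nrm_add_eq[of "x - y" y] nrm_add_eq[of "y - x" x] nrm_minus_commute[of x y] by auto

lemma nrm_1 [simp]: "nrm 1 = 1"
  using nrm_mult[of 1 1] by (metis mult_cancel_left1 mult_1 nrm_eq_0_iff zero_neq_one)

lemma nrm_power: "nrm (x ^ n) = nrm x ^ n"
  by (induction n) (auto simp: nrm_mult)

lemma nrm_inverse: "nrm (inverse x) = inverse (nrm x)"
proof (cases "x = 0")
  case False
  hence "nrm x * nrm (inverse x) = 1" by (simp flip: nrm_mult)
  thus ?thesis by (simp add: inverse_unique)
qed simp

lemma nrm_divide: "nrm (x / y) = nrm x / nrm y"
  by (simp add: divide_inverse nrm_mult nrm_inverse)

lemma nrm_prod_list: "nrm (prod_list xs) = (\<Prod>x\<leftarrow>xs. nrm x)"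
  by (induction xs) (auto simp: nrm_mult)

lemma nrm_sum_le:
  assumes "\<And>i. i \<in> A \<Longrightarrow> nrm (f i) \<le> E" "0 \<le> E"
  shows "nrm (sum f A) \<le> E"
  using assms by (induction A rule: infinite_finite_induct) (auto intro: nrm_ultra)

lemma nrm_sum_less:
  assumes "\<And>i. i \<in> A \<Longrightarrow> nrm (f i) < E" "0 < E"
  shows "nrm (sum f A) < E"
  using assms
proof (induction A rule: infinite_finite_induct)
  case (insert x A)
  have "nrm (f x + sum f A) \<le> max (nrm (f x)) (nrm (sum f A))" by (rule nrm_add_le_max)
  also have "\<dots> < E" using insert by auto
  finally show ?case using insert by simp
qed auto

lemma tendsto_nrm_iff: "(f \<longlongrightarrow> l) Fl \<longleftrightarrow> ((\<lambda>x. nrm (f x - l)) \<longlongrightarrow> 0) Fl"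
  by (subst tendsto_dist_iff) (simp add: dist_eq_nrm)

lemma Cauchy_nrm_iff: "Cauchy X \<longleftrightarrow> (\<forall>e>0. \<exists>M. \<forall>m\<ge>M. \<forall>n\<ge>M. nrm (X m - X n) < e)"
  by (simp add: Cauchy_def dist_eq_nrm)

text \<open>By the ultrametric inequality the distance of two terms is at most the largest distance of consecutive terms
  between them.\<close>

lemma Cauchy_if_consecutive:
  assumes "(\<lambda>n. nrm (X (Suc n) - X n)) \<longlonglongrightarrow> 0"
  shows "Cauchy X"
  unfolding Cauchy_nrm_iff
proof (intro allI impI)
  fix e :: real assume e: "e > 0"
  with assms obtain M where M: "\<And>n. n \<ge> M \<Longrightarrow> nrm (X (Suc n) - X n) < e"
    by (auto simp: LIMSEQ_def)
  have *: "nrm (X (M + d) - X M) < e" for d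
  proof (induction d)
    case (Suc d)
    have "nrm ((X (Suc (M + d)) - X (M + d)) + (X (M + d) - X M))
       \<le> max (nrm (X (Suc (M + d)) - X (M + d))) (nrm (X (M + d) - X M))"
      by (rule nrm_add_le_max)
    thus ?case using Suc M[of "M + d"] by auto
  qed (use e in auto)
  show "\<exists>M. \<forall>m\<ge>M. \<forall>n\<ge>M. nrm (X m - X n) < e"
  proof (intro exI[of _ M] allI impI)
    fix m n assume mn: "m \<ge> M" "n \<ge> M"
    have "nrm ((X m - X M) - (X n - X M)) \<le> max (nrm (X m - X M)) (nrm (X n - X M))"
      by (rule nrm_diff_le_max)
    thus "nrm (X m - X n) < e" using *[of "m - M"] *[of "n - M"] mn by auto
  qed
qed

text \<open>Consecutive partial sums differ by a single term, which in a complete ultrametric space decides convergence.\<close>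

lemma summable_iff_nrm: "summable f \<longleftrightarrow> (\<lambda>i. nrm (f i)) \<longlonglongrightarrow> 0"
proof
  assume "(\<lambda>i. nrm (f i)) \<longlonglongrightarrow> 0"
  hence "Cauchy (\<lambda>n. sum f {..<n})" by (intro Cauchy_if_consecutive) simp
  hence "convergent (\<lambda>n. sum f {..<n})" by (simp add: Cauchy_convergent_iff)
  thus "summable f" by (simp add: summable_iff_convergent)
next
  assume "summable f"
  hence "convergent (\<lambda>n. sum f {..<n})" by (simp add: summable_iff_convergent)
  hence C: "Cauchy (\<lambda>n. sum f {..<n})" by (simp add: Cauchy_convergent_iff)
  show "(\<lambda>i. nrm (f i)) \<longlonglongrightarrow> 0"
  proof (rule LIMSEQ_I)
    fix e :: real assume "e > 0"
    with C obtain M where M: "\<And>m n. m \<ge> M \<Longrightarrow> n \<ge> M \<Longrightarrow> nrm (sum f {..<m} - sum f {..<n}) < e"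
      unfolding Cauchy_nrm_iff by blast
    show "\<exists>no. \<forall>n\<ge>no. norm (nrm (f n) - 0) < e"
      using M[of "Suc n" n for n] by (intro exI[of _ M]) auto
  qed
qed

lemma suminf_nrm_LIMSEQ:
  "(\<lambda>i. nrm (f i)) \<longlonglongrightarrow> 0 \<Longrightarrow> (\<lambda>n. nrm (sum f {..<n} - suminf f)) \<longlonglongrightarrow> 0"
  using summable_sums[of f] by (simp add: summable_iff_nrm sums_def flip: tendsto_nrm_iff)

lemma suminf_eqI:
  assumes "(\<lambda>n. nrm (sum f {..<n} - s)) \<longlonglongrightarrow> 0"
  shows "suminf f = s"
  using assms sums_unique[of f s] by (simp add: sums_def flip: tendsto_nrm_iff)

lemma LIMSEQ_0_le_max:
  fixes X Y Z :: "nat \<Rightarrow> real"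
  assumes "\<And>n. 0 \<le> X n" "\<And>n. X n \<le> max (Y n) (Z n)" "Y \<longlonglongrightarrow> 0" "Z \<longlonglongrightarrow> 0"
  shows "X \<longlonglongrightarrow> 0"
proof (rule tendsto_sandwich[of "\<lambda>_. 0" X sequentially "\<lambda>n. max (Y n) (Z n)"])
  show "(\<lambda>n. max (Y n) (Z n)) \<longlonglongrightarrow> 0" using tendsto_max[OF assms(3,4)] by simp
  show "\<forall>\<^sub>F n in sequentially. X n \<le> max (Y n) (Z n)" by (rule always_eventually) (simp add: assms(2))
  show "\<forall>\<^sub>F n in sequentially. 0 \<le> X n" by (rule always_eventually) (simp add: assms(1))
qed (rule tendsto_const)

lemma LIMSEQ_nrm_max:
  assumes "\<And>n. nrm (X n) \<le> max (Y n) (Z n)" "Y \<longlonglongrightarrow> 0" "Z \<longlonglongrightarrow> 0"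
  shows "(\<lambda>n. nrm (X n)) \<longlonglongrightarrow> 0"
  by (rule LIMSEQ_0_le_max[OF _ assms]) simp

section \<open>Power series on a circle\<close>

text \<open>By the ultrametric inequality convergence depends only on the norm of the argument, so it is a property
  of the circle of radius \<open>R\<close>.\<close>

definition conv_on :: "'a fps \<Rightarrow> real \<Rightarrow> bool" where
  "conv_on F R \<longleftrightarrow> (\<lambda>i. nrm (fps_nth F i) * R ^ i) \<longlonglongrightarrow> 0"

lemma conv_region_iff: "x \<in> fps_conv_region F \<longleftrightarrow> conv_on F (nrm x)"
  by (simp add: fps_conv_region_def summable_iff_nrm conv_on_def nrm_mult nrm_power)

lemma fps_value_LIMSEQ:
  assumes "conv_on F (nrm x)"
  shows "(\<lambda>n. nrm ((\<Sum>i<n. fps_nth F i * x ^ i) - fps_value F x)) \<longlonglongrightarrow> 0"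
  unfolding fps_value_def using assms
  by (intro suminf_nrm_LIMSEQ) (simp add: conv_on_def nrm_mult nrm_power)

lemma fps_value_eqI:
  assumes "(\<lambda>n. nrm ((\<Sum>i<n. fps_nth F i * x ^ i) - s)) \<longlonglongrightarrow> 0"
  shows "fps_value F x = s"
  unfolding fps_value_def by (rule suminf_eqI[OF assms])

lemma conv_on_diff:
  assumes "conv_on F R" "conv_on G R" "R \<ge> 0"
  shows "conv_on (F - G) R"
proof -
  have "nrm (fps_nth (F - G) i) * R ^ i
      \<le> max (nrm (fps_nth F i) * R ^ i) (nrm (fps_nth G i) * R ^ i)" for i
    using mult_right_mono[OF nrm_diff_le_max[of "fps_nth F i" "fps_nth G i"], of "R ^ i"] assms(3)
    by (simp add: max_mult_distrib_right)
  moreover have "0 \<le> nrm (fps_nth (F - G) i) * R ^ i" for i using assms(3) by simp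
  ultimately show ?thesis unfolding conv_on_def
    by (intro LIMSEQ_0_le_max[OF _ _ assms(1,2)[unfolded conv_on_def]])
qed

lemma fps_value_diff:
  assumes "conv_on F (nrm x)" "conv_on G (nrm x)"
  shows "fps_value (F - G) x = fps_value F x - fps_value G x"
proof (rule fps_value_eqI, rule LIMSEQ_nrm_max[OF _ fps_value_LIMSEQ[OF assms(1)]
      fps_value_LIMSEQ[OF assms(2)]])
  fix n
  have *: "(\<Sum>i<n. fps_nth (F - G) i * x ^ i) - (fps_value F x - fps_value G x)
      = ((\<Sum>i<n. fps_nth F i * x ^ i) - fps_value F x) - ((\<Sum>i<n. fps_nth G i * x ^ i) - fps_value G x)"
    by (simp add: algebra_simps sum_subtractf)
  show "nrm ((\<Sum>i<n. fps_nth (F - G) i * x ^ i) - (fps_value F x - fps_value G x))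
     \<le> max (nrm ((\<Sum>i<n. fps_nth F i * x ^ i) - fps_value F x))
        (nrm ((\<Sum>i<n. fps_nth G i * x ^ i) - fps_value G x))"
    unfolding * by (rule nrm_diff_le_max)
qed

lemma fps_value_split:
  assumes "conv_on F (nrm x)" "0 < E"
  obtains n where "\<And>m. m \<ge> n \<Longrightarrow> nrm ((\<Sum>i<m. fps_nth F i * x ^ i) - fps_value F x) < E"
  using fps_value_LIMSEQ[OF assms(1)] assms(2) by (auto simp: LIMSEQ_def)

lemma nrm_fps_value_less:
  assumes F: "conv_on F (nrm x)" and E: "0 < E"
    and bound: "\<And>i. nrm (fps_nth F i) * nrm x ^ i < E"
  shows "nrm (fps_value F x) < E"
proof -
  obtain n where n: "nrm ((\<Sum>i<n. fps_nth F i * x ^ i) - fps_value F x) < E"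
    using fps_value_split[OF F E] by blast
  have "nrm (\<Sum>i<n. fps_nth F i * x ^ i) < E"
    using bound E by (intro nrm_sum_less) (auto simp: nrm_mult nrm_power)
  with n nrm_diff_le_max[of "\<Sum>i<n. fps_nth F i * x ^ i" "(\<Sum>i<n. fps_nth F i * x ^ i) - fps_value F x"]
  show ?thesis by auto
qed

lemma nrm_fps_value_le:
  assumes F: "conv_on F (nrm x)" 
    and bound: "\<And>i. nrm (fps_nth F i) * nrm x ^ i \<le> E"
  shows "nrm (fps_value F x) \<le> E"
proof (rule field_le_epsilon)
  fix e :: real assume e: "e > 0"
  have "0 \<le> E" using order_trans[OF _ bound[of 0]] by simp
  hence "nrm (fps_value F x) < E + e"
    using e by (intro nrm_fps_value_less[OF F] le_less_trans[OF bound]) auto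
  thus "nrm (fps_value F x) \<le> E + e" by simp
qed

lemma conv_on_poly: "conv_on (fps_of_poly f) R"
  unfolding conv_on_def
proof (rule tendsto_eventually)
  show "\<forall>\<^sub>F i in sequentially. nrm (fps_nth (fps_of_poly f) i) * R ^ i = 0"
    using eventually_gt_at_top[of "degree f"] by eventually_elim (simp add: coeff_eq_0)
qed

lemma fps_value_poly:
  fixes f :: "'a poly"
  shows "fps_value (fps_of_poly f) x = poly f x"
proof (rule fps_value_eqI, rule tendsto_eventually)
  show "\<forall>\<^sub>F n in sequentially. nrm ((\<Sum>i<n. fps_nth (fps_of_poly f) i * x ^ i) - poly f x) = 0"
    using eventually_gt_at_top[of "degree f"]
  proof eventually_elim
    case (elim n)
    have "(\<Sum>i<n. coeff f i * x ^ i) = (\<Sum>i\<le>degree f. coeff f i * x ^ i)"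
      using elim by (intro sum.mono_neutral_right) (auto simp: coeff_eq_0)
    thus ?case by (simp add: poly_altdef)
  qed
qed

text \<open>This is what permits replacing a power series by polynomials.\<close>

lemma nrm_fps_value_diff_poly:
  assumes F: "conv_on F (nrm x)" 
    and bound: "\<And>i. nrm (fps_nth F i - coeff f i) * nrm x ^ i \<le> E"
  shows "nrm (fps_value F x - poly f x) \<le> E"
proof -
  have "fps_value F x - poly f x = fps_value (F - fps_of_poly f) x"
    using fps_value_diff[OF F conv_on_poly[of f]] by (simp add: fps_value_poly)
  also have "nrm \<dots> \<le> E"
    by (rule nrm_fps_value_le[OF conv_on_diff[OF F conv_on_poly]]) (simp_all add: bound)
  finally show ?thesis .
qed

lemma fps_nth_linear_mult:
  fixes H :: "'b::comm_ring_1 fps"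
  shows
  "fps_nth (fps_of_poly [:- z, 1:] * H) i = (if i = 0 then 0 else fps_nth H (i - 1)) - z * fps_nth H i"
proof -
  have *: "fps_of_poly [:- z, 1:] = fps_X - fps_const z"
    by (simp add: fps_eq_iff coeff_pCons fps_X_def split: nat.split)
  show ?thesis unfolding * by (simp add: left_diff_distrib)
qed

lemma conv_on_shift:
  assumes "conv_on H R" "R \<ge> 0"
  shows "(\<lambda>i. nrm (fps_nth H i) * R ^ Suc i) \<longlonglongrightarrow> 0"
  using tendsto_mult_right_zero[OF assms(1)[unfolded conv_on_def], of R] by (simp add: algebra_simps)

lemma conv_on_linear_mult:
  assumes H: "conv_on H R" and R: "R \<ge> 0"
  shows "conv_on (fps_of_poly [:- z, 1:] * H) R"
proof -
  have 1: "(\<lambda>i. nrm (if i = 0 then 0 else fps_nth H (i - 1)) * R ^ i) \<longlonglongrightarrow> 0"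
    by (subst filterlim_sequentially_Suc[symmetric]) (use conv_on_shift[OF H R] in simp)
  have 2: "(\<lambda>i. nrm (z * fps_nth H i) * R ^ i) \<longlonglongrightarrow> 0"
    using tendsto_mult_right_zero[OF H[unfolded conv_on_def], of "nrm z"]
    by (simp add: nrm_mult algebra_simps)
  have "nrm (fps_nth (fps_of_poly [:- z, 1:] * H) i) * R ^ i
      \<le> max (nrm (if i = 0 then 0 else fps_nth H (i - 1)) * R ^ i) (nrm (z * fps_nth H i) * R ^ i)" for i
    unfolding fps_nth_linear_mult
    using mult_right_mono[OF nrm_diff_le_max[of "if i = 0 then 0 else fps_nth H (i - 1)"
          "z * fps_nth H i"], of "R ^ i"] R
    by (simp add: max_mult_distrib_right)
  moreover have "0 \<le> nrm (fps_nth (fps_of_poly [:- z, 1:] * H) i) * R ^ i" for i using R by simp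
  ultimately show ?thesis unfolding conv_on_def by (intro LIMSEQ_0_le_max[OF _ _ 1 2])
qed

lemma fps_value_linear_mult:
  assumes H: "conv_on H (nrm x)"
  shows "fps_value (fps_of_poly [:- z, 1:] * H) x = (x - z) * fps_value H x"
proof (rule fps_value_eqI, subst filterlim_sequentially_Suc[symmetric], rule LIMSEQ_nrm_max)
  fix n
  let ?S = "\<lambda>n. \<Sum>i<n. fps_nth H i * x ^ i"
  have S: "(\<Sum>i<Suc n. fps_nth (fps_of_poly [:- z, 1:] * H) i * x ^ i) = (x - z) * ?S n
      - z * fps_nth H n * x ^ n" for n
  proof (induction n)
    case (Suc n)
    have "(\<Sum>i<Suc (Suc n). fps_nth (fps_of_poly [:- z, 1:] * H) i * x ^ i)
        = (x - z) * ?S n - z * fps_nth H n * x ^ n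
          + (fps_nth H n - z * fps_nth H (Suc n)) * x ^ Suc n"
      by (subst sum.lessThan_Suc, subst Suc, subst fps_nth_linear_mult) simp
    thus ?case by (simp add: algebra_simps)
  qed (simp add: fps_nth_linear_mult)
  have eq: "(x - z) * ?S n - z * fps_nth H n * x ^ n - (x - z) * fps_value H x
      = (x - z) * (?S n - fps_value H x) - z * fps_nth H n * x ^ n" by (simp add: algebra_simps)
  have "nrm (((x - z) * (?S n - fps_value H x)) - z * fps_nth H n * x ^ n)
      \<le> max (nrm ((x - z) * (?S n - fps_value H x))) (nrm (z * fps_nth H n * x ^ n))"
    by (rule nrm_diff_le_max)
  thus "nrm ((\<Sum>i<Suc n. fps_nth (fps_of_poly [:- z, 1:] * H) i * x ^ i) - (x - z) * fps_value H x)
     \<le> max (nrm (x - z) * nrm (?S n - fps_value H x)) (nrm z * (nrm (fps_nth H n) * nrm x ^ n))"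
    unfolding S eq by (simp only: nrm_mult nrm_power mult.assoc)
next
  show "(\<lambda>n. nrm (x - z) * nrm ((\<Sum>i<n. fps_nth H i * x ^ i) - fps_value H x)) \<longlonglongrightarrow> 0"
    by (intro tendsto_mult_right_zero fps_value_LIMSEQ H)
  show "(\<lambda>n. nrm z * (nrm (fps_nth H n) * nrm x ^ n)) \<longlonglongrightarrow> 0"
    using H unfolding conv_on_def by (intro tendsto_mult_right_zero)
qed

lemma nrm_of_nat_le_1: "nrm (of_nat k) \<le> 1"
  by (induction k) (auto intro: nrm_ultra)

lemma conv_on_deriv:
  assumes H: "conv_on H R" and R: "R > 0"
  shows "conv_on (fps_deriv H) R"
proof -
  have "(\<lambda>i. inverse R * (nrm (fps_nth H (Suc i)) * R ^ Suc i)) \<longlonglongrightarrow> 0"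
    by (intro tendsto_mult_right_zero LIMSEQ_Suc H[unfolded conv_on_def])
  hence 1: "(\<lambda>i. nrm (fps_nth H (Suc i)) * R ^ i) \<longlonglongrightarrow> 0" using R by (simp add: field_simps)
  have "nrm (fps_nth (fps_deriv H) i) * R ^ i \<le> nrm (fps_nth H (Suc i)) * R ^ i" for i
  proof -
    have "nrm (of_nat (Suc i)) * nrm (fps_nth H (Suc i)) \<le> 1 * nrm (fps_nth H (Suc i))"
      using nrm_of_nat_le_1[of "Suc i"] by (rule mult_right_mono) simp
    hence "nrm (fps_nth (fps_deriv H) i) \<le> nrm (fps_nth H (Suc i))"
      by (simp add: nrm_mult)
    thus ?thesis using R by (intro mult_right_mono) auto
  qed
  hence "nrm (fps_nth (fps_deriv H) i) * R ^ i
      \<le> max (nrm (fps_nth H (Suc i)) * R ^ i) (nrm (fps_nth H (Suc i)) * R ^ i)" for i by simp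
  moreover have "0 \<le> nrm (fps_nth (fps_deriv H) i) * R ^ i" for i using R by simp
  ultimately show ?thesis unfolding conv_on_def by (intro LIMSEQ_0_le_max[OF _ _ 1 1])
qed

lemma conv_on_deriv_iter: "conv_on H R \<Longrightarrow> R > 0 \<Longrightarrow> conv_on ((fps_deriv ^^ i) H) R"
  by (induction i) (auto intro: conv_on_deriv)

lemma conv_on_linear_power_mult:
  "conv_on H R \<Longrightarrow> R \<ge> 0 \<Longrightarrow> conv_on (fps_of_poly [:- z, 1:] ^ m * H) R"
  by (induction m) (auto simp: mult.assoc simp del: fps_of_poly_pCons intro: conv_on_linear_mult)

text \<open>Leibniz' rule for a linear factor; it makes the order of vanishing computable by induction.\<close>

lemma fps_deriv_iter_linear_mult:
  fixes H :: "'b::field_char_0 fps"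
  shows "(fps_deriv ^^ i) (fps_of_poly [:- z, 1:] * H)
      = fps_of_poly [:- z, 1:] * (fps_deriv ^^ i) H + of_nat i * (fps_deriv ^^ (i - 1)) H"
proof (induction i)
  case (Suc i)
  have d: "fps_deriv (fps_of_poly [:- z, 1:]) = (1 :: 'b fps)"
    by (simp add: fps_eq_iff coeff_pCons fps_X_def split: nat.split)
  show ?case
  proof (cases i)
    case (Suc j)
    thus ?thesis using Suc.IH d by (simp add: algebra_simps del: fps_of_poly_pCons)
  qed (use d in \<open>simp add: algebra_simps del: fps_of_poly_pCons\<close>)
qed simp

section \<open>The field of p-adic numbers and its algebraic closure\<close>

lemma Qp_iff: "x \<in> Qp \<longleftrightarrow> (\<forall>e>0. \<exists>q\<in>\<rat>. nrm (x - q) < e)"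
  unfolding Qp_def closure_approachable by (simp add: dist_eq_nrm nrm_minus_commute)

lemma Qp_mult: fixes x y :: 'a assumes "x \<in> Qp" "y \<in> Qp" shows "x * y \<in> Qp"
  unfolding Qp_iff
proof (intro allI impI)
  fix e :: real assume e: "e > 0"
  have pos: "0 < e / (nrm u + 1)" for u using e nrm_nonneg[of u] by (simp add: add_nonneg_pos)
  obtain r where r: "r \<in> \<rat>" "nrm (y - r) < e / (nrm x + 1)"
    using assms(2) pos[of x] unfolding Qp_iff by blast
  obtain q where q: "q \<in> \<rat>" "nrm (x - q) < e / (nrm r + 1)"
    using assms(1) pos[of r] unfolding Qp_iff by blast
  have "nrm x * nrm (y - r) \<le> (nrm x + 1) * nrm (y - r)" by (rule mult_right_mono) auto
  also have "\<dots> < e" using r(2) add_nonneg_pos[of "nrm x" 1]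
    by (simp add: pos_less_divide_eq mult.commute)
  finally have 1: "nrm (x * (y - r)) < e" by (simp add: nrm_mult)
  have "nrm r * nrm (x - q) \<le> (nrm r + 1) * nrm (x - q)" by (rule mult_right_mono) auto
  also have "\<dots> < e" using q(2) add_nonneg_pos[of "nrm r" 1]
    by (simp add: pos_less_divide_eq mult.commute)
  finally have 2: "nrm (r * (x - q)) < e" by (simp add: nrm_mult)
  have "x * y - q * r = x * (y - r) + r * (x - q)" by (simp add: algebra_simps)
  hence "nrm (x * y - q * r) < e" using 1 2 nrm_add_le_max[of "x * (y - r)" "r * (x - q)"] by simp
  thus "\<exists>q\<in>\<rat>. nrm (x * y - q) < e" using q r by (intro bexI[of _ "q * r"]) auto
qed

lemma Qp_diff: fixes x y :: 'a assumes "x \<in> Qp" "y \<in> Qp" shows "x - y \<in> Qp"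
  unfolding Qp_iff
proof (intro allI impI)
  fix e :: real assume e: "e > 0"
  obtain r where r: "r \<in> \<rat>" "nrm (y - r) < e" using assms(2) e unfolding Qp_iff by blast
  obtain q where q: "q \<in> \<rat>" "nrm (x - q) < e" using assms(1) e unfolding Qp_iff by blast
  have *: "x - y - (q - r) = (x - q) - (y - r)" by simp
  have "nrm (x - y - (q - r)) < e"
    unfolding * by (rule le_less_trans[OF nrm_diff_le_max]) (simp add: q r)
  thus "\<exists>q\<in>\<rat>. nrm (x - y - q) < e" using q r by (intro bexI[of _ "q - r"]) auto
qed

lemma Rats_subset_Qp: "\<rat> \<subseteq> (Qp :: 'a set)"
  unfolding Qp_def by (rule closure_subset)

lemma Qp_inverse: fixes x :: 'a assumes "x \<in> Qp" shows "inverse x \<in> Qp"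
proof (cases "x = 0")
  case False
  show ?thesis unfolding Qp_iff
  proof (intro allI impI)
    fix e :: real assume e: "e > 0"
    have "min (nrm x) (e * (nrm x * nrm x)) > 0" using False e by simp
    then obtain q where q: "q \<in> \<rat>" "nrm (x - q) < min (nrm x) (e * (nrm x * nrm x))"
      using assms unfolding Qp_iff by blast
    hence nq: "nrm x = nrm q" using nrm_eq_if_close[of x q] by auto
    hence q0: "q \<noteq> 0" using False by (metis nrm_eq_0_iff)
    have "inverse x - inverse q = (q - x) / (x * q)" using False q0 by (simp add: field_simps)
    hence "nrm (inverse x - inverse q) = nrm (x - q) / (nrm x * nrm x)"
      by (simp add: nrm_divide nrm_mult nq nrm_minus_commute)
    also have "\<dots> < e" using q(2) False by (simp add: divide_less_eq)
    finally show "\<exists>q\<in>\<rat>. nrm (inverse x - q) < e" using q by (intro bexI[of _ "inverse q"]) auto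
  qed
qed (use assms in simp)

lemma sub_field_Qp: "sub_field (Qp :: 'a set)"
  using Qp_mult Qp_diff Qp_inverse Rats_subset_Qp by (auto simp: sub_field_def)

lemma Qp_bar_eq: "(Qp_bar :: 'a set) = alg_over Qp"
  by (auto simp: Qp_bar_def alg_over_def poly_over_def)

lemma sub_ring_Qp_bar: "sub_ring (Qp_bar :: 'a set)"
  unfolding Qp_bar_eq by (rule sub_ring_alg_over[OF sub_field_Qp])

text \<open>Synthetic division by a root stays over \<open>Qp_bar\<close> because \<open>Qp_bar\<close> is a ring.\<close>

lemma poly_Qp_bar_splits:
  fixes f :: "'a poly"
  assumes "poly_over Qp_bar f" "f \<noteq> 0"
  obtains c us where "c \<noteq> 0" "set us \<subseteq> Qp_bar" "f = smult c (lin_prod us)"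
proof -
  have "\<exists>c us. c \<noteq> 0 \<and> set us \<subseteq> Qp_bar \<and> f = smult c (lin_prod us)"
    using assms
  proof (induction "degree f" arbitrary: f)
    case 0
    then obtain c where "f = [:c:]" by (metis degree_eq_zeroE)
    thus ?case using 0 by (intro exI[of _ c] exI[of _ "[]"]) auto
  next
    case (Suc d)
    obtain z where z: "z \<in> Qp_bar" "poly f z = 0"
      using Qp_bar_alg_closed[of f] Suc by (auto simp: poly_over_def)
    define g where "g = synthetic_div f z"
    have fg: "f = [:- z, 1:] * g" using synthetic_div_correct'[of z f] z by (simp add: g_def)
    have "poly_over Qp_bar g"
      unfolding g_def by (rule poly_over_synthetic_div[OF sub_ring_Qp_bar Suc.prems(1) z(1)])
    moreover have "degree g = d" using Suc by (simp add: g_def degree_synthetic_div flip: Suc(2))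
    moreover have "g \<noteq> 0" using fg Suc.prems by auto
    ultimately obtain c us where "c \<noteq> 0" "set us \<subseteq> Qp_bar" "g = smult c (lin_prod us)"
      using Suc.hyps(1)[of g] by blast
    thus ?case using z fg by (intro exI[of _ c] exI[of _ "z # us"]) (simp del: mult_pCons_left)
  qed
  thus ?thesis using that by blast
qed

lemma Qp_bar_approx:
  fixes x :: 'a
  assumes "e > 0" obtains y where "y \<in> Qp_bar" "nrm (x - y) < e"
proof -
  have "x \<in> closure Qp_bar" using Qp_bar_dense by simp
  thus ?thesis using assms that unfolding closure_approachable
    by (auto simp: dist_eq_nrm nrm_minus_commute)
qed

section \<open>The Newton polygon\<close>

text \<open>An edge of the Newton polygon, of horizontal extent from \<open>a\<close> to \<open>b\<close>, read off from the sizes of the terms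
  of a series on the circle of radius \<open>R\<close>; for \<open>a = b\<close> it degenerates to a vertex.\<close>

definition newton_edge :: "(nat \<Rightarrow> 'a) \<Rightarrow> real \<Rightarrow> nat \<Rightarrow> nat \<Rightarrow> real \<Rightarrow> bool" where
  "newton_edge f R a b M \<longleftrightarrow> a \<le> b \<and> nrm (f a) * R ^ a = M \<and> nrm (f b) * R ^ b = M \<and>
     (\<forall>i. nrm (f i) * R ^ i \<le> M) \<and> (\<forall>i. i < a \<or> b < i \<longrightarrow> nrm (f i) * R ^ i < M)"

lemma newton_edge_unique:
  assumes "newton_edge f R a b M" "newton_edge f R a' b' M'"
  shows "a = a'" "b = b'" "M = M'"
proof -
  show M: "M = M'" using assms unfolding newton_edge_def by (metis order_antisym)
  show "a = a'" "b = b'" using assms unfolding newton_edge_def M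
    by (metis linorder_neqE_nat less_irrefl)+
qed

text \<open>Terms of size \<open>M\<close> keep their size, and all others stay below \<open>M\<close>.\<close>

lemma newton_edge_perturb:
  assumes f: "newton_edge f R a b M" and R: "R > 0"
    and close: "\<And>i. nrm (f i - g i) * R ^ i < M"
  shows "newton_edge g R a b M"
proof -
  have eq: "nrm (g i) = nrm (f i)" if "nrm (f i) * R ^ i = M" for i
  proof -
    have "nrm (f i - g i) * R ^ i < nrm (f i) * R ^ i" using close[of i] that by simp
    hence "nrm (f i - g i) < nrm (f i)" using R by simp
    thus ?thesis using nrm_eq_if_close[of "f i" "g i"] by simp
  qed
  have "g i = f i - (f i - g i)" for i by simp
  hence le: "nrm (g i) \<le> max (nrm (f i)) (nrm (f i - g i))" for i by (metis nrm_diff_le_max)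
  have le': "nrm (g i) * R ^ i \<le> max (nrm (f i) * R ^ i) (nrm (f i - g i) * R ^ i)" for i
    using mult_right_mono[OF le, of "R ^ i" i] R by (simp add: max_mult_distrib_right)
  show ?thesis unfolding newton_edge_def
  proof (intro conjI allI impI)
    show "a \<le> b" "nrm (g a) * R ^ a = M" "nrm (g b) * R ^ b = M"
      using f eq[of a] eq[of b] by (auto simp: newton_edge_def)
    show "nrm (g i) * R ^ i \<le> M" for i
    proof -
      have "nrm (f i) * R ^ i \<le> M" using f by (simp add: newton_edge_def)
      thus ?thesis using le'[of i] close[of i] by simp
    qed
    show "nrm (g i) * R ^ i < M" if "i < a \<or> b < i" for i
    proof -
      have "nrm (f i) * R ^ i < M" using f that unfolding newton_edge_def by blast
      thus ?thesis using le'[of i] close[of i] by simp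
    qed
  qed
qed

text \<open>The coefficients of the product are \<open>f\<^sub>i\<^sub>-\<^sub>1 - z f\<^sub>i\<close>. If \<open>\<bar>z\<bar> < R\<close>, the first term dominates and the edge is
  shifted; if \<open>\<bar>z\<bar> > R\<close>, the second one dominates and the edge stays; if \<open>\<bar>z\<bar> = R\<close>, the second term decides
  at the left end and the first one at the right end, so the edge grows by one.\<close>

lemma newton_edge_linear_mult:
  fixes z :: 'a
  assumes f: "newton_edge (coeff f) R a b M" and R: "R > 0" and M: "M > 0"
  shows "newton_edge (coeff ([:- z, 1:] * f)) R
    (if nrm z < R then Suc a else a) (if nrm z \<le> R then Suc b else b) (M * max R (nrm z))" (is "newton_edge _ R ?a ?b ?M")
proof -
  define t where "t i = nrm (coeff f i) * R ^ i" for i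
  define s where "s i = (case i of 0 \<Rightarrow> 0 | Suc j \<Rightarrow> R * t j)" for i
  have t: "a \<le> b" "t a = M" "t b = M" "\<And>i. t i \<le> M" "\<And>i. i < a \<Longrightarrow> t i < M" "\<And>i. b < i \<Longrightarrow> t i < M"
    "\<And>i. 0 \<le> t i"
    using f R by (auto simp: newton_edge_def t_def)
  let ?g = "[:- z, 1:] * f"
  have cg: "coeff ?g i = (case i of 0 \<Rightarrow> 0 | Suc j \<Rightarrow> coeff f j) - z * coeff f i" for i
    by (simp add: coeff_pCons split: nat.split)
  have n1: "nrm (case i of 0 \<Rightarrow> 0 | Suc j \<Rightarrow> coeff f j) * R ^ i = s i" for i
    by (auto simp: s_def t_def split: nat.split)
  have n2: "nrm (z * coeff f i) * R ^ i = nrm z * t i" for i by (simp add: t_def nrm_mult)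
  have le: "nrm (coeff ?g i) * R ^ i \<le> max (s i) (nrm z * t i)" for i
    using mult_right_mono[OF nrm_diff_le_max[of "case i of 0 \<Rightarrow> 0 | Suc j \<Rightarrow> coeff f j" "z * coeff f i"],
        of "R ^ i"] R
    unfolding cg max_mult_distrib_right n1[symmetric] n2[symmetric] by (simp add: max_mult_distrib_right)
  have eq1: "nrm (coeff ?g i) * R ^ i = s i" if "nrm z * t i < s i" for i
  proof -
    have "nrm (z * coeff f i) * R ^ i < nrm (case i of 0 \<Rightarrow> 0 | Suc j \<Rightarrow> coeff f j) * R ^ i"
      unfolding n1 n2 by (rule that)
    hence "nrm (z * coeff f i) < nrm (case i of 0 \<Rightarrow> 0 | Suc j \<Rightarrow> coeff f j)" using R by simp
    from nrm_diff_eq[OF this] show ?thesis unfolding cg by (simp only: n1)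
  qed
  have eq2: "nrm (coeff ?g i) * R ^ i = nrm z * t i" if "s i < nrm z * t i" for i
  proof -
    have "nrm (case i of 0 \<Rightarrow> 0 | Suc j \<Rightarrow> coeff f j) * R ^ i < nrm (z * coeff f i) * R ^ i"
      unfolding n1 n2 by (rule that)
    hence "nrm (case i of 0 \<Rightarrow> 0 | Suc j \<Rightarrow> coeff f j) < nrm (z * coeff f i)" using R by simp
    from nrm_diff_eq[OF this] show ?thesis unfolding cg
      by (subst nrm_minus_commute) (simp only: n2)
  qed
  have s_le: "s i \<le> R * M" for i using t R M by (auto simp: s_def split: nat.split)
  have s_lt: "s i < R * M" if "i < Suc a \<or> Suc b < i" for i
    using t(5,6) that R M by (auto simp: s_def split: nat.split)
  have s_eq: "s (Suc a) = R * M" "s (Suc b) = R * M" using t by (auto simp: s_def)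
  have z_le: "nrm z * t i \<le> nrm z * M" for i using t by (intro mult_left_mono) auto
  consider "nrm z < R" | "nrm z = R" | "nrm z > R" by linarith
  thus ?thesis
  proof cases
    case 1
    have zs: "nrm z * t i < R * M" for i
      using z_le[of i] 1 M by (meson le_less_trans mult_strict_right_mono)
    show ?thesis unfolding newton_edge_def
    proof (intro conjI allI impI)
      show "?a \<le> ?b" using 1 t by simp
      show "nrm (coeff ?g ?a) * R ^ ?a = ?M"
        using 1 eq1[of "Suc a"] zs[of "Suc a"] s_eq by (simp add: mult.commute)
      show "nrm (coeff ?g ?b) * R ^ ?b = ?M"
        using 1 eq1[of "Suc b"] zs[of "Suc b"] s_eq by (simp add: mult.commute)
      show "nrm (coeff ?g i) * R ^ i \<le> ?M" for i
        using le[of i] zs[of i] s_le[of i] 1 by (simp add: mult.commute)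
      show "nrm (coeff ?g i) * R ^ i < ?M"
        if "i < ?a \<or> ?b < i" for i
        using le[of i] zs[of i] s_lt[of i] 1 that by (simp add: mult.commute)
    qed
  next
    case 2
    have zlt: "nrm z * t i < R * M" if "i < a \<or> b < i" for i
      using 2 t(5,6) that R by auto
    show ?thesis unfolding newton_edge_def
    proof (intro conjI allI impI)
      show "?a \<le> ?b" using 2 t by simp
      show "nrm (coeff ?g ?a) * R ^ ?a = ?M"
        using 2 eq2[of a] s_lt[of a] t by (simp add: mult.commute)
      show "nrm (coeff ?g ?b) * R ^ ?b = ?M"
        using 2 eq1[of "Suc b"] zlt[of "Suc b"] s_eq by (simp add: mult.commute)
      show "nrm (coeff ?g i) * R ^ i \<le> ?M" for i
        using le[of i] z_le[of i] s_le[of i] 2 by (simp add: mult.commute)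
      show "nrm (coeff ?g i) * R ^ i < ?M"
        if "i < ?a \<or> ?b < i" for i
      proof -
        have "i < a \<or> b < i" "i < Suc a \<or> Suc b < i" using 2 that by auto
        thus ?thesis using le[of i] zlt[of i] s_lt[of i] 2
          by (simp add: mult.commute del: mult_pCons_left mult_pCons_right)
      qed
    qed
  next
    case 3
    have ss: "s i < nrm z * M" for i
      using s_le[of i] 3 M by (meson le_less_trans mult_strict_right_mono)
    have z0: "nrm z > 0" using 3 R by linarith
    have zlt: "nrm z * t i < nrm z * M" if "i < a \<or> b < i" for i
      using mult_strict_left_mono[OF _ z0] t(5,6) that by blast
    show ?thesis unfolding newton_edge_def
    proof (intro conjI allI impI)
      show "?a \<le> ?b" using 3 t by simp
      show "nrm (coeff ?g ?a) * R ^ ?a = ?M"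
        using 3 eq2[of a] ss[of a] t by (simp add: mult.commute)
      show "nrm (coeff ?g ?b) * R ^ ?b = ?M"
        using 3 eq2[of b] ss[of b] t by (simp add: mult.commute)
      show "nrm (coeff ?g i) * R ^ i \<le> ?M" for i
        using le[of i] z_le[of i] ss[of i] 3 by (simp add: mult.commute)
      show "nrm (coeff ?g i) * R ^ i < ?M"
        if "i < ?a \<or> ?b < i" for i
        using le[of i] zlt[of i] ss[of i] 3 that by (simp add: mult.commute)
    qed
  qed
qed

lemma newton_edge_prod_linear:
  assumes R: "R > 0" and c: "c \<noteq> 0"
  shows "newton_edge (coeff (smult c (lin_prod us))) R
     (length (filter (\<lambda>u. nrm u < R) us)) (length (filter (\<lambda>u. nrm u \<le> R) us))
     (nrm c * (\<Prod>u\<leftarrow>us. max R (nrm u)))"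
proof (induction us)
  case Nil
  show ?case using c by (auto simp: newton_edge_def coeff_pCons split: nat.split)
next
  case (Cons u us)
  have "(\<Prod>u\<leftarrow>us. max R (nrm u)) > 0" using R by (induction us) (auto simp: less_max_iff_disj)
  hence "0 < nrm c * (\<Prod>u\<leftarrow>us. max R (nrm u))" using c by simp
  note E = newton_edge_linear_mult[OF Cons R this, of u]
  have eq: "smult c (lin_prod (u # us)) = [:- u, 1:] * smult c (lin_prod us)"
    by (simp only: list.map prod_list.Cons mult_smult_right)
  have l: "length (filter P (u # us)) = (if P u then Suc (length (filter P us)) else length (filter P us))" for P
    by simp
  have m: "nrm c * (\<Prod>u\<leftarrow>u # us. max R (nrm u)) = nrm c * (\<Prod>u\<leftarrow>us. max R (nrm u)) * max R (nrm u)"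
    by simp
  show ?case unfolding eq l m by (rule E)
qed

text \<open>A factor \<open>x - u\<close> with \<open>\<bar>u\<bar> \<noteq> R\<close> has the norm \<open>max R \<bar>u\<bar>\<close> on the circle; the power of \<open>R\<close> on the left
  makes up for the factors with \<open>\<bar>u\<bar> = R\<close>.\<close>

lemma nrm_poly_on_circle:
  assumes x: "nrm x = R"
  shows "nrm (poly (smult c (lin_prod us)) x) * R ^ length (filter (\<lambda>u. nrm u = R) us)
    = nrm c * (\<Prod>u\<leftarrow>us. max R (nrm u)) * (\<Prod>u\<leftarrow>filter (\<lambda>u. nrm u = R) us. nrm (x - u))"
proof (induction us)
  case (Cons u us)
  have "nrm (x - u) = max R (nrm u)" if "nrm u \<noteq> R"
    using that x nrm_diff_eq[of u x] nrm_diff_eq[of x u] nrm_minus_commute[of u x]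
    by (cases "nrm u < R") auto
  moreover have "poly (smult c (lin_prod (u # us))) x
      = (x - u) * poly (smult c (lin_prod us)) x" by (simp add: algebra_simps)
  hence "nrm (poly (smult c (lin_prod (u # us))) x)
      = nrm (x - u) * nrm (poly (smult c (lin_prod us)) x)" by (simp only: nrm_mult)
  ultimately show ?case using Cons
    by (cases "nrm u = R") (simp_all add: mult_ac del: poly_smult mult_pCons_left mult_pCons_right)
qed (simp add: nrm_mult)

text \<open>Such a polynomial splits into linear factors. Each of them moves the edge in a known way, so the edge counts
  the roots on the circle, and the other factors have constant norm there.\<close>

lemma roots_on_circle_Qp_bar:
  fixes f :: "'a poly"
  assumes f: "poly_over Qp_bar f" "f \<noteq> 0" and edge: "newton_edge (coeff f) R a b M" and R: "R > 0"
  obtains us where "length us = b - a" "\<And>u. u \<in> set us \<Longrightarrow> u \<in> Qp_bar \<and> nrm u = R \<and> poly f u = 0"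
    "\<And>x. nrm x = R \<Longrightarrow> nrm (poly f x) * R ^ (b - a) = M * (\<Prod>u\<leftarrow>us. nrm (x - u))"
    "\<And>u. nrm u = R \<Longrightarrow> poly f u = 0 \<Longrightarrow> u \<in> set us"
proof -
  obtain c ws where w: "c \<noteq> 0" "set ws \<subseteq> Qp_bar" "f = smult c (lin_prod ws)"
    using poly_Qp_bar_splits[OF f] by blast
  have e: "newton_edge (coeff f) R (length (filter (\<lambda>u. nrm u < R) ws)) (length (filter (\<lambda>u. nrm u \<le> R) ws))
     (nrm c * (\<Prod>u\<leftarrow>ws. max R (nrm u)))"
    unfolding w(3) by (rule newton_edge_prod_linear[OF R w(1)])
  note u = newton_edge_unique[OF edge e]
  let ?us = "filter (\<lambda>u. nrm u = R) ws"
  have len: "length ?us = b - a"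
  proof -
    have "length (filter (\<lambda>u. nrm u \<le> R) ws) = length (filter (\<lambda>u. nrm u < R) ws) + length ?us"
      by (induction ws) auto
    thus ?thesis using u by simp
  qed
  show ?thesis
  proof (rule that[of ?us])
    fix x assume "nrm x = R"
    from nrm_poly_on_circle[OF this, of c ws]
    show "nrm (poly f x) * R ^ (b - a) = M * (\<Prod>u\<leftarrow>?us. nrm (x - u))" by (simp add: w(3) len u(3))
  qed (use w in \<open>auto simp: len poly_prod_list prod_list_zero_iff\<close>)
qed

section \<open>Roots of a power series on a circle\<close>

text \<open>Far out the coefficients are small enough to be dropped, and the others are approximated by density.\<close>

lemma fps_Qp_bar_approx:
  fixes F :: "'a fps"
  assumes F: "conv_on F R" and R: "R > 0" and E: "E > 0"
  obtains f where "poly_over Qp_bar f" "\<And>i. nrm (fps_nth F i - coeff f i) * R ^ i < E"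
proof -
  obtain n where n: "\<And>i. i \<ge> n \<Longrightarrow> nrm (fps_nth F i) * R ^ i < E"
    using F E R by (auto simp: conv_on_def LIMSEQ_def)
  have "\<forall>i. \<exists>y\<in>Qp_bar. nrm (fps_nth F i - y) < E / R ^ i"
    using Qp_bar_approx E R by (metis divide_pos_pos zero_less_power)
  then obtain y where y: "\<And>i. y i \<in> Qp_bar" "\<And>i. nrm (fps_nth F i - y i) < E / R ^ i" by metis
  define f where "f = Poly (map y [0..<n])"
  have cf: "coeff f i = (if i < n then y i else 0)" for i by (simp add: f_def nth_default_def)
  show ?thesis
  proof (rule that[of f])
    show "poly_over Qp_bar f" using y sub_ring_0[OF sub_ring_Qp_bar] by (auto simp: poly_over_def cf)
    show "nrm (fps_nth F i - coeff f i) * R ^ i < E" for i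
      using y(2)[of i] n[of i] R by (simp add: cf pos_less_divide_eq)
  qed
qed

lemma prod_list_gt_power:
  fixes g :: "'b \<Rightarrow> real"
  assumes "us \<noteq> []" "\<And>u. u \<in> set us \<Longrightarrow> d < g u" "0 \<le> d"
  shows "d ^ length us < prod_list (map g us)"
  using assms
proof (induction us)
  case (Cons u us)
  show ?case
  proof (cases "us = []")
    case False
    hence "d ^ length us < prod_list (map g us)" using Cons by auto
    thus ?thesis using Cons.prems by (auto intro!: mult_strict_mono' )
  qed (use Cons in auto)
qed simp

lemma prod_list_le_member:
  fixes g :: "'b \<Rightarrow> real"
  assumes "u \<in> set us" "\<And>w. w \<in> set us \<Longrightarrow> 0 \<le> g w \<and> g w \<le> R" "0 \<le> R"
  shows "prod_list (map g us) \<le> g u * R ^ (length us - 1)"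
proof -
  have le: "0 \<le> prod_list (map g xs) \<and> prod_list (map g xs) \<le> R ^ length xs"
    if "set xs \<subseteq> set us" for xs
    using that assms(2,3) by (induction xs) (auto intro: mult_mono)
  obtain xs ys where us: "us = xs @ u # ys" using assms(1) by (meson split_list)
  have "prod_list (map g us) = g u * prod_list (map g (xs @ ys))" by (simp add: us)
  also have "\<dots> \<le> g u * R ^ length (xs @ ys)"
    using le[of "xs @ ys"] assms(1,2) us by (intro mult_left_mono) auto
  finally show ?thesis by (simp add: us)
qed

text \<open>Polynomials over \<open>Qp_bar\<close> approximating \<open>F\<close> better and better have the same edge, hence roots on
  the circle. Each polynomial is small at a root of its predecessor, so it has a root nearby, and the
  sequence of roots obtained in this way converges to a root of \<open>F\<close>.\<close>

lemma ex_root_on_circle: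
  fixes F :: "'a fps"
  assumes F: "conv_on F R" and R: "R > 0" and M: "M > 0"
    and edge: "newton_edge (fps_nth F) R a b M" and ab: "a < b"
  obtains z where "nrm z = R" "fps_value F z = 0"
proof -
  define N where "N = b - a"
  define \<delta> where "\<delta> T = R * (1/2) ^ Suc T" for T
  \<comment> \<open>so that a product of \<open>N\<close> distances which is at most \<open>E T / M * R ^ N\<close> has a factor at most \<open>\<delta> T\<close>\<close>
  define E where "E T = M * (\<delta> T / R) ^ N" for T
  have N: "N > 0" using ab by (simp add: N_def)
  have \<delta>: "\<delta> T > 0" for T using R by (simp add: \<delta>_def)
  have E_pos: "E T > 0" for T using M R \<delta> by (simp add: E_def)
  have quot: "\<delta> T / R = (1/2) ^ Suc T" for T using R by (simp add: \<delta>_def)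
  have E_less: "E T < M" for T
  proof -
    obtain N' where N': "N = Suc N'" using N by (cases N) auto
    have "(1/2 :: real) ^ Suc T < 1" by (rule power_Suc_less_one) auto
    hence "((1/2 :: real) ^ Suc T) ^ N < 1" unfolding N' by (intro power_Suc_less_one) auto
    hence "M * ((1/2) ^ Suc T) ^ N < M * 1" using M by (intro mult_strict_left_mono)
    thus ?thesis by (simp only: E_def quot mult_1_right)
  qed
  have E_dec: "E (Suc T) \<le> E T" for T
    unfolding E_def quot using M by (intro mult_left_mono power_mono) auto
  have "\<forall>T. \<exists>f. poly_over Qp_bar f \<and> (\<forall>i. nrm (fps_nth F i - coeff f i) * R ^ i < E T)"
    using fps_Qp_bar_approx[OF F R E_pos] by metis
  then obtain f where f: "\<And>T. poly_over Qp_bar (f T)"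
    "\<And>T i. nrm (fps_nth F i - coeff (f T) i) * R ^ i < E T" by metis
  have fe: "newton_edge (coeff (f T)) R a b M" for T
    using f(2)[of _ T] E_less[of T] by (intro newton_edge_perturb[OF edge R]) (meson less_trans)
  have f0: "f T \<noteq> 0" for T using fe[of T] M by (auto simp: newton_edge_def)
  have close: "nrm (fps_value F x - poly (f T) x) \<le> E T" if "nrm x = R" for x T
    by (rule nrm_fps_value_diff_poly) (use F f(2) that in \<open>auto simp: less_imp_le\<close>)
  have "\<exists>z. \<forall>T. (nrm (z T) = R \<and> poly (f T) (z T) = 0) \<and> nrm (z T - z (Suc T)) \<le> \<delta> T"
  proof (rule dependent_nat_choice)
    obtain us where us: "length us = b - a" "\<And>u. u \<in> set us \<Longrightarrow> u \<in> Qp_bar \<and> nrm u = R \<and> poly (f 0) u = 0"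
      using roots_on_circle_Qp_bar[OF f(1) f0 fe R] by metis
    hence "us \<noteq> []" using ab by auto
    thus "\<exists>x. nrm x = R \<and> poly (f 0) x = 0" using us(2) by (metis list.set_sel(1))
  next
    fix x T assume x: "nrm x = R \<and> poly (f T) x = 0"
    obtain us where us: "length us = b - a" "\<And>u. u \<in> set us \<Longrightarrow> u \<in> Qp_bar \<and> nrm u = R \<and> poly (f (Suc T)) u = 0"
      "\<And>x. nrm x = R \<Longrightarrow> nrm (poly (f (Suc T)) x) * R ^ (b - a) = M * (\<Prod>u\<leftarrow>us. nrm (x - u))"
      using roots_on_circle_Qp_bar[OF f(1) f0 fe R] by metis
    have ne: "us \<noteq> []" using us(1) ab by auto
    have "nrm (poly (f (Suc T)) x) \<le> E T"
    proof -
      have eq: "poly (f (Suc T)) x = (fps_value F x - poly (f T) x) - (fps_value F x - poly (f (Suc T)) x)"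
        using x by simp
      have x': "nrm x = R" using x by simp
      show ?thesis
        by (subst eq, rule nrm_ultra_diff[OF close[OF x'] order_trans[OF close[OF x'] E_dec]])
    qed
    hence "nrm (poly (f (Suc T)) x) * R ^ N \<le> E T * R ^ N"
      using R by (intro mult_right_mono) auto
    hence "M * (\<Prod>u\<leftarrow>us. nrm (x - u)) \<le> E T * R ^ N"
      using us(3)[of x] x unfolding N_def by linarith
    also have "E T * R ^ N = M * \<delta> T ^ N" using R by (simp add: E_def power_divide)
    finally have "(\<Prod>u\<leftarrow>us. nrm (x - u)) \<le> \<delta> T ^ length us" using M us(1) by (simp add: N_def)
    hence "\<exists>u\<in>set us. nrm (x - u) \<le> \<delta> T"
      using prod_list_gt_power[OF ne, of "\<delta> T" "\<lambda>u. nrm (x - u)"] less_imp_le[OF \<delta>[of T]]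
      by (meson not_le)
    thus "\<exists>y. (nrm y = R \<and> poly (f (Suc T)) y = 0) \<and> nrm (x - y) \<le> \<delta> T" using us(2) by blast
  qed
  then obtain z where z: "\<And>T. nrm (z T) = R" "\<And>T. poly (f T) (z T) = 0"
    "\<And>T. nrm (z T - z (Suc T)) \<le> \<delta> T" by blast
  have \<delta>_lim: "\<delta> \<longlonglongrightarrow> 0"
    unfolding \<delta>_def by (intro tendsto_mult_right_zero LIMSEQ_Suc LIMSEQ_power_zero) simp
  have "(\<lambda>T. nrm (z (Suc T) - z T)) \<longlonglongrightarrow> 0"
    using z(3) by (intro LIMSEQ_0_le_max[OF _ _ \<delta>_lim \<delta>_lim]) (auto simp: nrm_minus_commute)
  hence "Cauchy z" by (rule Cauchy_if_consecutive)
  then obtain l where "z \<longlonglongrightarrow> l" by (auto simp: Cauchy_convergent_iff convergent_def)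
  hence l: "(\<lambda>T. nrm (z T - l)) \<longlonglongrightarrow> 0" by (simp flip: tendsto_nrm_iff)
  have nl: "nrm l = R"
  proof -
    obtain T where "nrm (z T - l) < R" using l R by (auto simp: LIMSEQ_def)
    thus ?thesis using nrm_eq_if_close[of "z T" l] z(1)[of T] by simp
  qed
  have "(\<lambda>T::nat. nrm (fps_value F l)) \<longlonglongrightarrow> 0"
  proof (rule LIMSEQ_0_le_max)
    show "E \<longlonglongrightarrow> 0"
    proof -
      have "(\<lambda>T. \<delta> T / R) \<longlonglongrightarrow> 0" using tendsto_divide_zero[OF \<delta>_lim] .
      from tendsto_power[OF this, of N] N have "(\<lambda>T. (\<delta> T / R) ^ N) \<longlonglongrightarrow> 0" by (simp add: zero_power)
      thus ?thesis unfolding E_def by (rule tendsto_mult_right_zero)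
    qed
    show "(\<lambda>T. (M / R) * nrm (l - z T)) \<longlonglongrightarrow> 0"
      using tendsto_mult_right_zero[OF l, of "M / R"] by (simp add: nrm_minus_commute)
    show "nrm (fps_value F l) \<le> max (E T) (M / R * nrm (l - z T))" for T
    proof -
      obtain us where us: "length us = b - a" "\<And>u. u \<in> set us \<Longrightarrow> u \<in> Qp_bar \<and> nrm u = R \<and> poly (f T) u = 0"
        "\<And>x. nrm x = R \<Longrightarrow> nrm (poly (f T) x) * R ^ (b - a) = M * (\<Prod>u\<leftarrow>us. nrm (x - u))"
        "\<And>u. nrm u = R \<Longrightarrow> poly (f T) u = 0 \<Longrightarrow> u \<in> set us"
        using roots_on_circle_Qp_bar[OF f(1) f0 fe R] by metis
      have zus: "z T \<in> set us" using us(4) z by blast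
      have "(\<Prod>u\<leftarrow>us. nrm (l - u)) \<le> nrm (l - z T) * R ^ (length us - 1)"
        using us(2) nl R by (intro prod_list_le_member[OF zus]) (auto intro: nrm_ultra_diff)
      hence "nrm (poly (f T) l) * R ^ N \<le> M * (nrm (l - z T) * R ^ (N - 1))"
        using us(3)[OF nl] us(1) M by (simp add: N_def mult_left_mono)
      moreover have "R ^ N = R * R ^ (N - 1)" using N by (cases N) auto
      ultimately have "(nrm (poly (f T) l) * R) * R ^ (N - 1) \<le> (M * nrm (l - z T)) * R ^ (N - 1)"
        by (simp add: mult_ac)
      hence "nrm (poly (f T) l) * R \<le> M * nrm (l - z T)" using R by simp
      hence 1: "nrm (poly (f T) l) \<le> M / R * nrm (l - z T)" using R by (simp add: field_simps)
      have "fps_value F l = (fps_value F l - poly (f T) l) + poly (f T) l" by simp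
      hence "nrm (fps_value F l) \<le> max (nrm (fps_value F l - poly (f T) l)) (nrm (poly (f T) l))"
        by (metis nrm_add_le_max)
      also have "\<dots> \<le> max (E T) (M / R * nrm (l - z T))" using 1 close[OF nl, of T] by (intro max.mono)
      finally show ?thesis .
    qed
  qed simp
  hence "fps_value F l = 0" by (simp add: LIMSEQ_const_iff)
  thus ?thesis using nl that by blast
qed

text \<open>The quotient of \<open>F\<close> by \<open>X - z\<close> has the coefficients \<open>- (\<Sum>j\<le>i. F\<^sub>j z\<^sup>j) / z\<^sup>i\<^sup>+\<^sup>1\<close>; the partial
  sums tend to \<open>F(z) = 0\<close>, which gives both convergence and the new edge.\<close>

lemma divide_by_root_on_circle:
  fixes F :: "'a fps"
  assumes F: "conv_on F R" and R: "R > 0" and M: "M > 0"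
    and edge: "newton_edge (fps_nth F) R a b M" and ab: "a < b"
    and z: "nrm z = R" "fps_value F z = 0"
  obtains H where "F = fps_of_poly [:- z, 1:] * H" "conv_on H R"
    "newton_edge (fps_nth H) R a (b - 1) (M / R)"
proof -
  define S where "S n = (\<Sum>j<n. fps_nth F j * z ^ j)" for n
  define H where "H = Abs_fps (\<lambda>i. - S (Suc i) / z ^ Suc i)"
  have z0: "z \<noteq> 0" using z R by auto
  have t: "nrm (fps_nth F j * z ^ j) = nrm (fps_nth F j) * R ^ j" for j by (simp add: nrm_mult nrm_power z)
  have e: "nrm (fps_nth F a * z ^ a) = M" "nrm (fps_nth F b * z ^ b) = M" 
    "\<And>i. nrm (fps_nth F i * z ^ i) \<le> M" "\<And>i. i < a \<or> b < i \<Longrightarrow> nrm (fps_nth F i * z ^ i) < M"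
    using edge unfolding newton_edge_def t by blast+
  have S_lim: "(\<lambda>n. nrm (S n)) \<longlonglongrightarrow> 0"
    using fps_value_LIMSEQ[of F z] F z by (simp add: S_def)
  have S_le: "nrm (S n) \<le> M" for n unfolding S_def by (rule nrm_sum_le) (use e M in auto)
  have S_low: "nrm (S n) < M" if "n \<le> a" for n
    unfolding S_def by (rule nrm_sum_less) (use e M that in auto)
  have S_high: "nrm (S n) < M" if n: "n > b" for n
  proof -
    obtain J where "\<And>j. j \<ge> J \<Longrightarrow> nrm (S j) < M" using S_lim M by (auto simp: LIMSEQ_def)
    hence J: "nrm (S (n + J)) < M" by simp
    have d: "S (n + J) - S n = (\<Sum>j = n..<n + J. fps_nth F j * z ^ j)"
      unfolding S_def using sum_diff_nat_ivl[of 0 n "n + J" "\<lambda>j. fps_nth F j * z ^ j"] by (simp add: atLeast0LessThan)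
    have "nrm (S (n + J) - S n) < M" unfolding d by (rule nrm_sum_less) (use e M n in auto)
    moreover have "S n = S (n + J) - (S (n + J) - S n)" by simp
    ultimately show ?thesis using J nrm_diff_le_max[of "S (n + J)" "S (n + J) - S n"] by simp
  qed
  have S_a: "nrm (S (Suc a)) = M"
    using nrm_add_eq[of "S a" "fps_nth F a * z ^ a"] S_low[of a] e(1) by (simp add: S_def)
  have S_b: "nrm (S b) = M"
    using nrm_diff_eq[of "S (Suc b)" "fps_nth F b * z ^ b"] S_high[of "Suc b"] e(2)
    by (simp add: S_def)
  have nH: "nrm (fps_nth H i) * R ^ i = nrm (S (Suc i)) / R" for i
    using R by (simp add: H_def nrm_divide nrm_mult nrm_power z)
  show ?thesis
  proof (rule that)
    show "F = fps_of_poly [:- z, 1:] * H"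
    proof (rule fps_ext)
      fix i
      show "fps_nth F i = fps_nth (fps_of_poly [:- z, 1:] * H) i"
        unfolding fps_nth_linear_mult using z0
        by (cases i) (simp_all add: H_def S_def field_simps)
    qed
    show "conv_on H R" unfolding conv_on_def nH
      by (intro tendsto_divide_zero LIMSEQ_Suc S_lim)
    show "newton_edge (fps_nth H) R a (b - 1) (M / R)"
      unfolding newton_edge_def nH
    proof (intro conjI allI impI)
      show "a \<le> b - 1" using ab by simp
      show "nrm (S (Suc a)) / R = M / R" by (simp add: S_a)
      show "nrm (S (Suc (b - 1))) / R = M / R" using S_b ab by simp
      show "nrm (S (Suc i)) / R \<le> M / R" for i using S_le R by (simp add: divide_right_mono)
      show "nrm (S (Suc i)) / R < M / R" if "i < a \<or> b - 1 < i" for i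
        using that ab S_low[of "Suc i"] S_high[of "Suc i"] R by (auto intro!: divide_strict_right_mono)
    qed
  qed
qed

text \<open>Each division by a root on the circle shortens the edge by one, until only a vertex is left.\<close>

lemma fps_factor_on_circle:
  fixes F :: "'a fps"
  assumes "conv_on F R" and R: "R > 0" and "M > 0" and "newton_edge (fps_nth F) R a b M"
  obtains zs H where "length zs = b - a" "\<And>z. z \<in> set zs \<Longrightarrow> nrm z = R"
    "F = fps_of_poly (lin_prod zs) * H" "conv_on H R"
    "newton_edge (fps_nth H) R a a (M / R ^ (b - a))"
proof -
  have "\<exists>zs H. length zs = b - a \<and> (\<forall>z\<in>set zs. nrm z = R) \<and>
    F = fps_of_poly (lin_prod zs) * H \<and> conv_on H R \<and>
    newton_edge (fps_nth H) R a a (M / R ^ (b - a))"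
    using assms
  proof (induction "b - a" arbitrary: b F M)
    case 0
    hence "a = b" by (auto simp: newton_edge_def)
    thus ?case using 0 by (intro exI[of _ "[]"] exI[of _ F]) auto
  next
    case (Suc n)
    hence ab: "a < b" by simp
    obtain z where z: "nrm z = R" "fps_value F z = 0"
      using ex_root_on_circle[OF Suc.prems(1,2,3,4) ab] by blast
    obtain H where H: "F = fps_of_poly [:- z, 1:] * H" "conv_on H R"
       "newton_edge (fps_nth H) R a (b - 1) (M / R)"
      using divide_by_root_on_circle[OF Suc.prems ab z] by blast
    have n: "n = b - 1 - a" using Suc.hyps(2) by simp
    obtain zs H' where H': "length zs = b - 1 - a" "\<forall>z\<in>set zs. nrm z = R"
      "H = fps_of_poly (lin_prod zs) * H'" "conv_on H' R"
      "newton_edge (fps_nth H') R a a (M / R / R ^ (b - 1 - a))"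
      using Suc.hyps(1)[OF n H(2) R _ H(3)] Suc.prems(3) R by auto
    have "M / R / R ^ (b - 1 - a) = M / R ^ (b - a)" using Suc.hyps(2) n by (metis divide_divide_eq_left power_Suc)
    moreover have "F = fps_of_poly (lin_prod (z # zs)) * H'"
      unfolding H(1) H'(3) by (simp only: list.map prod_list.Cons fps_of_poly_mult mult.assoc)
    moreover have "length (z # zs) = b - a" using H'(1) ab by simp
    ultimately show ?case using H' z by (intro exI[of _ "z # zs"] exI[of _ H']) auto
  qed
  thus ?thesis using that by blast
qed

text \<open>A single term dominates all the others.\<close>

lemma nrm_fps_value_vertex:
  fixes H :: "'a fps"
  assumes H: "conv_on H R" and edge: "newton_edge (fps_nth H) R a a M" and M: "M > 0" and x: "nrm x = R"
  shows "nrm (fps_value H x) = M"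
proof -
  let ?m = "monom (fps_nth H a) a"
  have t: "nrm (poly ?m x) = M" using edge by (simp add: poly_monom nrm_mult nrm_power x newton_edge_def)
  have "nrm (fps_value (H - fps_of_poly ?m) x) < M"
  proof (rule nrm_fps_value_less)
    show "conv_on (H - fps_of_poly ?m) (nrm x)"
      by (rule conv_on_diff) (use H conv_on_poly x in auto)
    show "nrm (fps_nth (H - fps_of_poly ?m) i) * nrm x ^ i < M" for i
    proof (cases "i = a")
      case False
      hence "i < a \<or> a < i" by linarith
      hence "nrm (fps_nth H i) * R ^ i < M" using edge unfolding newton_edge_def by blast
      thus ?thesis using False x by simp
    qed (use M in simp)
  qed (rule M)
  also have "fps_value (H - fps_of_poly ?m) x = fps_value H x - poly ?m x"
    using fps_value_diff[of H x "fps_of_poly ?m"] H x conv_on_poly by (simp add: fps_value_poly)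
  finally show ?thesis using nrm_eq_if_close[of "fps_value H x" "poly ?m x"] t by simp
qed

lemma conv_on_linear_factors_mult:
  fixes H :: "'a fps"
  assumes "conv_on H R" "R \<ge> 0"
  shows "conv_on (fps_of_poly (lin_prod zs) * H) R"
proof (induction zs)
  case (Cons z zs)
  from conv_on_linear_mult[OF Cons assms(2), of z] show ?case
    by (simp only: list.map prod_list.Cons fps_of_poly_mult mult.assoc)
qed (use assms in simp)

lemma fps_value_linear_factors_mult:
  fixes H :: "'a fps"
  assumes "conv_on H (nrm x)"
  shows "fps_value (fps_of_poly (lin_prod zs) * H) x = (\<Prod>z\<leftarrow>zs. x - z) * fps_value H x"
proof (induction zs)
  case (Cons z zs)
  from fps_value_linear_mult[OF conv_on_linear_factors_mult[OF assms nrm_nonneg], of z zs] Cons show ?case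
    by (simp only: list.map prod_list.Cons fps_of_poly_mult mult.assoc)
qed simp

lemma fps_value_of_nat_mult:
  fixes F :: "'a fps"
  assumes F: "conv_on F (nrm x)"
  shows "conv_on (of_nat k * F) (nrm x) \<and> fps_value (of_nat k * F) x = of_nat k * fps_value F x"
proof (induction k)
  case 0
  show ?case using conv_on_poly[of 0 "nrm x"] fps_value_poly[of 0 x] by simp
next
  case (Suc k)
  have neg: "of_nat (Suc k) * F = of_nat k * F - (fps_of_poly 0 - F)" by (simp add: algebra_simps)
  have c: "conv_on (fps_of_poly 0 - F) (nrm x)" by (rule conv_on_diff[OF conv_on_poly F nrm_nonneg])
  have "fps_value (fps_of_poly 0 - F) x = - fps_value F x"
    using fps_value_diff[OF conv_on_poly F, of 0] fps_value_poly[of 0 x] by simp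
  moreover have "conv_on (of_nat k * F) (nrm x)" "fps_value (of_nat k * F) x = of_nat k * fps_value F x"
    using Suc by blast+
  ultimately show ?case unfolding neg using conv_on_diff[OF _ c nrm_nonneg] fps_value_diff[OF _ c]
    by (simp only: diff_minus_eq_add of_nat_Suc distrib_right mult_1 add.commute)
qed

text \<open>The \<open>i\<close>-th derivative of \<open>(X - z) G\<close> takes at \<open>z\<close> the value \<open>i G\<^sup>(\<^sup>i\<^sup>-\<^sup>1\<^sup>)(z)\<close>, which is the induction step.\<close>

lemma fps_value_deriv_linear_power_mult:
  fixes H :: "'a fps"
  assumes H: "conv_on H (nrm z)" and z: "z \<noteq> 0"
  shows "i \<le> m \<Longrightarrow> fps_value ((fps_deriv ^^ i) (fps_of_poly [:- z, 1:] ^ m * H)) z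
     = (if i = m then fact m * fps_value H z else 0)"
proof (induction m arbitrary: i)
  case (Suc m)
  let ?L = "fps_of_poly [:- z, 1:]" and ?G = "fps_of_poly [:- z, 1:] ^ m * H"
  have c: "conv_on ((fps_deriv ^^ j) ?G) (nrm z)" for j
    by (rule conv_on_deriv_iter[OF conv_on_linear_power_mult[OF H]]) (use z in auto)
  note c' = fps_value_of_nat_mult[OF c]
  have "?L ^ Suc m * H = ?L * ?G" by (simp only: power_Suc mult.assoc)
  hence "(fps_deriv ^^ i) (?L ^ Suc m * H)
     = ?L * (fps_deriv ^^ i) ?G - (fps_of_poly 0 - of_nat i * (fps_deriv ^^ (i - 1)) ?G)"
    by (simp only: fps_deriv_iter_linear_mult) simp
  also have "fps_value \<dots> z = of_nat i * fps_value ((fps_deriv ^^ (i - 1)) ?G) z"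
  proof -
    have 1: "conv_on (?L * (fps_deriv ^^ i) ?G) (nrm z)" by (rule conv_on_linear_mult[OF c nrm_nonneg])
    have 2: "conv_on (of_nat i * (fps_deriv ^^ (i - 1)) ?G) (nrm z)" using c' by blast
    have 3: "conv_on (fps_of_poly 0 - of_nat i * (fps_deriv ^^ (i - 1)) ?G) (nrm z)"
      by (rule conv_on_diff[OF conv_on_poly 2 nrm_nonneg])
    show ?thesis
      unfolding fps_value_diff[OF 1 3] fps_value_diff[OF conv_on_poly 2] fps_value_poly
        fps_value_linear_mult[OF c] using c' by simp
  qed
  finally have eq: "fps_value ((fps_deriv ^^ i) (?L ^ Suc m * H)) z
     = of_nat i * fps_value ((fps_deriv ^^ (i - 1)) ?G) z" .
  show ?case
  proof (cases i)
    case (Suc j)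
    thus ?thesis unfolding eq using Suc.IH[of j] Suc.prems by (auto simp: algebra_simps)
  qed (use eq in simp)
qed simp

lemma fps_root_mult_linear_power_mult:
  fixes H :: "'a fps"
  assumes H: "conv_on H (nrm z)" and z: "z \<noteq> 0" and nz: "fps_value H z \<noteq> 0"
  shows "fps_root_mult (fps_of_poly [:- z, 1:] ^ m * H) z = m"
  unfolding fps_root_mult_def
proof (rule Least_equality)
  show "fps_value ((fps_deriv ^^ m) (fps_of_poly [:- z, 1:] ^ m * H)) z \<noteq> 0"
    using fps_value_deriv_linear_power_mult[OF H z order_refl] nz by simp
  fix i assume i: "fps_value ((fps_deriv ^^ i) (fps_of_poly [:- z, 1:] ^ m * H)) z \<noteq> 0"
  show "m \<le> i"
    using fps_value_deriv_linear_power_mult[OF H z, of i m] i by (cases "i < m") auto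
qed

lemma prod_list_map_eq_prod_count:
  fixes f :: "'b \<Rightarrow> 'c::comm_monoid_mult"
  shows "prod_list (map f xs) = (\<Prod>x\<in>set xs. f x ^ count_list xs x)"
proof (induction xs)
  case (Cons y xs)
  have "(\<Prod>x\<in>set (y # xs). f x ^ count_list (y # xs) x)
      = (\<Prod>x\<in>insert y (set xs). f x ^ count_list xs x * (if x = y then f y else 1))"
    by (rule prod.cong) (auto simp: mult.commute)
  also have "\<dots> = (\<Prod>x\<in>insert y (set xs). f x ^ count_list xs x) * f y"
    by (simp add: prod.distrib)
  also have "(\<Prod>x\<in>insert y (set xs). f x ^ count_list xs x) = (\<Prod>x\<in>set xs. f x ^ count_list xs x)"
    by (rule prod.mono_neutral_right) (auto simp: count_list_0_iff)
  finally show ?case using Cons by (simp add: mult.commute)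
qed simp

text \<open>The Weierstrass factorisation on one circle: \<open>F\<close> is the product of the linear factors of its roots there and
  of a series whose norm is constant on the circle.\<close>

theorem circle_poly_factorization:
  fixes F :: "'a fps"
  assumes F: "conv_on F R" and R: "R > 0" and M: "M > 0" and edge: "newton_edge (fps_nth F) R a b M"
    and t: "\<And>z. v z = t \<longleftrightarrow> nrm z = R"
  obtains zs where "length zs = b - a" "\<And>z. z \<in> set zs \<longleftrightarrow> nrm z = R \<and> fps_value F z = 0"
    "circle_poly v F t = lin_prod zs"
    "\<And>x. nrm x = R \<Longrightarrow> nrm (fps_value F x) = M / R ^ (b - a) * (\<Prod>z\<leftarrow>zs. nrm (x - z))"
proof -
  obtain zs H where H: "length zs = b - a" "\<And>z. z \<in> set zs \<Longrightarrow> nrm z = R"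
    "F = fps_of_poly (lin_prod zs) * H" "conv_on H R"
    "newton_edge (fps_nth H) R a a (M / R ^ (b - a))"
    using fps_factor_on_circle[OF F R M edge] by blast
  have nH: "nrm (fps_value H x) = M / R ^ (b - a)" if "nrm x = R" for x
    by (rule nrm_fps_value_vertex[OF H(4,5) _ that]) (use R M in simp)
  have val: "fps_value F x = (\<Prod>z\<leftarrow>zs. x - z) * fps_value H x" if "nrm x = R" for x
    unfolding H(3) by (rule fps_value_linear_factors_mult) (use H that in simp)
  have nz: "fps_value H x \<noteq> 0" if "nrm x = R" for x
    using nH[OF that] R M by auto
  have roots: "z \<in> set zs \<longleftrightarrow> nrm z = R \<and> fps_value F z = 0" for z
    using val[of z] nz[of z] H(2)[of z] by (auto simp: prod_list_zero_iff)
  have root: "{z. fps_root F z \<and> v z = t} = set zs"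
    using roots F by (auto simp: fps_root_def t conv_region_iff)
  have mult: "fps_root_mult F z = count_list zs z" if z: "z \<in> set zs" for z
  proof -
    let ?ws = "filter (\<lambda>u. u \<noteq> z) zs"
    have "lin_prod zs = [:- z, 1:] ^ count_list zs z * lin_prod ?ws"
      by (induction zs) (auto simp: mult_ac simp del: mult_pCons_left mult_pCons_right)
    hence F': "F = fps_of_poly [:- z, 1:] ^ count_list zs z * (fps_of_poly (lin_prod ?ws) * H)"
      unfolding H(3) by (simp only: fps_of_poly_mult fps_of_poly_power mult.assoc)
    have nz: "nrm z = R" using H(2) z .
    show ?thesis
      unfolding F'
    proof (subst fps_root_mult_linear_power_mult)
      show "conv_on (fps_of_poly (lin_prod ?ws) * H) (nrm z)"
        by (rule conv_on_linear_factors_mult) (use H nz in auto)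
      show "z \<noteq> 0" using nz R by auto
      have "fps_value (fps_of_poly (lin_prod ?ws) * H) z = (\<Prod>u\<leftarrow>?ws. z - u) * fps_value H z"
        by (rule fps_value_linear_factors_mult) (use H nz in auto)
      moreover have "fps_value H z \<noteq> 0" using nH[OF nz] R M by auto
      ultimately show "fps_value (fps_of_poly (lin_prod ?ws) * H) z \<noteq> 0"
        by (auto simp: prod_list_zero_iff)
    qed simp
  qed
  show ?thesis
  proof (rule that[of zs])
    show "circle_poly v F t = lin_prod zs"
      unfolding circle_poly_def root prod_list_map_eq_prod_count by (rule prod.cong) (simp_all add: mult)
    fix x assume x: "nrm x = R"
    show "nrm (fps_value F x) = M / R ^ (b - a) * (\<Prod>z\<leftarrow>zs. nrm (x - z))"
      using val[OF x] nH[OF x] by (simp add: nrm_mult nrm_prod_list o_def)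
  qed (use H roots in auto)
qed

section \<open>Conjugate elements have the same norm\<close>

lemma Qp_limit:
  assumes "\<And>n. X n \<in> Qp" "(\<lambda>n. nrm (X n - l)) \<longlonglongrightarrow> 0" shows "l \<in> Qp"
proof -
  have "X \<longlonglongrightarrow> l" using assms(2) by (simp flip: tendsto_nrm_iff)
  moreover have "\<And>n. X n \<in> closure \<rat>" using assms(1) unfolding Qp_def .
  ultimately show ?thesis unfolding Qp_def using closed_sequentially[OF closed_closure] by blast
qed

text \<open>Otherwise some elements of the span converge to \<open>- b d\<close>. Their coordinates are Cauchy sequences by the lower bound,
  with limits in the complete field \<open>Qp\<close>, and the limits contradict independence.\<close>

lemma distance_from_span_pos:
  fixes b :: "nat \<Rightarrow> 'a"
  assumes c: "c > 0" "\<And>a i. (\<And>i. a i \<in> Qp) \<Longrightarrow> i < d \<Longrightarrow> c * nrm (a i) \<le> nrm (\<Sum>i<d. a i * b i)"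
    and indep: "\<And>a. (\<And>i. a i \<in> Qp) \<Longrightarrow> b d + (\<Sum>i<d. a i * b i) \<noteq> 0"
  obtains \<delta> where "\<delta> > 0" "\<forall>a. (\<forall>i. a i \<in> Qp) \<longrightarrow> \<delta> \<le> nrm (b d + (\<Sum>i<d. a i * b i))"
proof (rule ccontr)
  assume no: "\<not> thesis"
  have "\<forall>n. \<exists>a. (\<forall>i. a i \<in> Qp) \<and> nrm (b d + (\<Sum>i<d. a i * b i)) < inverse (real (Suc n))"
  proof
    fix n
    show "\<exists>a. (\<forall>i. a i \<in> Qp) \<and> nrm (b d + (\<Sum>i<d. a i * b i)) < inverse (real (Suc n))"
      using no that[of "inverse (real (Suc n))"] by (metis inverse_positive_iff_positive not_le of_nat_0_less_iff zero_less_Suc)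
  qed
  then obtain A where A: "\<And>n i. A n i \<in> Qp"
    "\<And>n. nrm (b d + (\<Sum>i<d. A n i * b i)) < inverse (real (Suc n))" by metis
  have "\<exists>l. (\<lambda>n. nrm (A n i - l)) \<longlonglongrightarrow> 0" if i: "i < d" for i
  proof -
    have step: "c * nrm (A (Suc n) i - A n i) \<le> inverse (real (Suc n))" for n
    proof -
      have "c * nrm (A (Suc n) i - A n i) \<le> nrm (\<Sum>i<d. (A (Suc n) i - A n i) * b i)"
        by (rule c(2)) (use A Qp_diff i in auto)
      also have "(\<Sum>i<d. (A (Suc n) i - A n i) * b i)
          = (b d + (\<Sum>i<d. A (Suc n) i * b i)) - (b d + (\<Sum>i<d. A n i * b i))"
        by (simp add: left_diff_distrib sum_subtractf)
      also have "nrm \<dots> \<le> inverse (real (Suc n))"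
      proof (rule nrm_ultra_diff)
        have "inverse (real (Suc (Suc n))) \<le> inverse (real (Suc n))" by (rule le_imp_inverse_le) auto
        thus "nrm (b d + (\<Sum>i<d. A (Suc n) i * b i)) \<le> inverse (real (Suc n))"
          using A(2)[of "Suc n"] by linarith
        show "nrm (b d + (\<Sum>i<d. A n i * b i)) \<le> inverse (real (Suc n))"
          by (rule less_imp_le[OF A(2)])
      qed
      finally show ?thesis .
    qed
    have "(\<lambda>n. nrm (A (Suc n) i - A n i)) \<longlonglongrightarrow> 0"
    proof (rule LIMSEQ_0_le_max)
      show "(\<lambda>n. inverse c * inverse (real (Suc n))) \<longlonglongrightarrow> 0"
        by (intro tendsto_mult_right_zero LIMSEQ_inverse_real_of_nat)
      thus "(\<lambda>n. inverse c * inverse (real (Suc n))) \<longlonglongrightarrow> 0" .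
      show "nrm (A (Suc n) i - A n i) \<le> max (inverse c * inverse (real (Suc n))) (inverse c * inverse (real (Suc n)))" for n
      proof -
        have "x \<le> inverse c * y" if "c * x \<le> y" for x y
          using that c(1) by (simp add: field_simps)
        from this[OF step[of n]] show ?thesis by simp
      qed
    qed simp
    hence "Cauchy (\<lambda>n. A n i)" by (rule Cauchy_if_consecutive)
    then obtain l where "(\<lambda>n. A n i) \<longlonglongrightarrow> l" by (auto simp: Cauchy_convergent_iff convergent_def)
    thus ?thesis by (auto simp: tendsto_nrm_iff)
  qed
  then obtain l where l: "\<And>i. i < d \<Longrightarrow> (\<lambda>n. nrm (A n i - l i)) \<longlonglongrightarrow> 0" by metis
  define l' where "l' i = (if i < d then l i else 0)" for i
  have l'Qp: "l' i \<in> Qp" for i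
    using Qp_limit[OF A(1) l] sub_ring_0[OF sub_field_imp_sub_ring[OF sub_field_Qp]] by (auto simp: l'_def)
  have "nrm (b d + (\<Sum>i<d. l' i * b i)) \<le> 0 + e" if e: "e > 0" for e
  proof -
    have "(\<lambda>n. nrm (A n i - l i) * nrm (b i)) \<longlonglongrightarrow> 0" if "i < d" for i
      by (rule tendsto_mult_left_zero[OF l[OF that]])
    hence "\<forall>\<^sub>F n in sequentially. nrm (A n i - l i) * nrm (b i) < e" if "i < d" for i
      using that e by (intro order_tendstoD(2)) auto
    hence "\<forall>\<^sub>F n in sequentially. \<forall>i\<in>{..<d}. nrm (A n i - l i) * nrm (b i) < e"
      by (intro eventually_ball_finite) auto
    moreover have "\<forall>\<^sub>F n in sequentially. inverse (real (Suc n)) < e"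
      using LIMSEQ_inverse_real_of_nat e by (intro order_tendstoD(2))
    ultimately have "\<forall>\<^sub>F n in sequentially. (\<forall>i\<in>{..<d}. nrm (A n i - l i) * nrm (b i) < e) \<and> inverse (real (Suc n)) < e"
      by (rule eventually_conj)
    then obtain n where n: "inverse (real (Suc n)) < e" "\<And>i. i < d \<Longrightarrow> nrm (A n i - l i) * nrm (b i) < e"
      unfolding eventually_sequentially by blast
    have "b d + (\<Sum>i<d. l' i * b i) = (b d + (\<Sum>i<d. A n i * b i)) - (\<Sum>i<d. (A n i - l i) * b i)"
      by (simp add: left_diff_distrib sum_subtractf l'_def)
    also have "nrm \<dots> \<le> e"
    proof (rule nrm_ultra_diff)
      show "nrm (b d + (\<Sum>i<d. A n i * b i)) \<le> e" using A(2)[of n] n(1) by linarith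
      show "nrm (\<Sum>i<d. (A n i - l i) * b i) \<le> e"
        by (rule nrm_sum_le) (use n(2) e in \<open>auto simp: nrm_mult less_imp_le\<close>)
    qed
    finally show ?thesis by simp
  qed
  hence "nrm (b d + (\<Sum>i<d. l' i * b i)) \<le> 0" by (rule field_le_epsilon)
  thus False using indep[of l'] l'Qp by simp
qed

text \<open>Comparability of the norm with the size of the coordinates, by induction on the dimension: the distance of
  the last element from the span of the others controls the last coordinate, and then the others follow.\<close>

lemma independent_bounded_below:
  fixes b :: "nat \<Rightarrow> 'a"
  assumes "\<And>a. (\<And>i. a i \<in> Qp) \<Longrightarrow> (\<Sum>i<d. a i * b i) = 0 \<Longrightarrow> (\<forall>i<d. a i = 0)"
  shows "\<exists>c>0. \<forall>a. (\<forall>i. a i \<in> Qp) \<longrightarrow> (\<forall>i<d. c * nrm (a i) \<le> nrm (\<Sum>i<d. a i * b i))"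
  using assms
proof (induction d)
  case 0
  show ?case by (intro exI[of _ 1]) simp
next
  case (Suc d)
  note Q = sub_field_imp_sub_ring[OF sub_field_Qp]
  have ind': "\<forall>i<d. a i = 0" if a: "\<And>i. a i \<in> Qp" "(\<Sum>i<d. a i * b i) = 0" for a
  proof -
    have "\<forall>i<Suc d. (a(d := 0)) i = 0"
    proof (rule Suc.prems)
      have "(\<Sum>i<d. (a(d := 0)) i * b i) = (\<Sum>i<d. a i * b i)" by (rule sum.cong) auto
      thus "(\<Sum>i<Suc d. (a(d := 0)) i * b i) = 0" using a(2) by simp
    qed (use a(1) sub_ring_0[OF Q] in auto)
    thus ?thesis by (metis fun_upd_apply less_SucI less_irrefl)
  qed
  obtain c where c: "c > 0" "\<forall>a. (\<forall>i. a i \<in> Qp) \<longrightarrow> (\<forall>i<d. c * nrm (a i) \<le> nrm (\<Sum>i<d. a i * b i))"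
    using Suc.IH[OF ind'] by blast
  have indep: "b d + (\<Sum>i<d. a i * b i) \<noteq> 0" if a: "\<And>i. a i \<in> Qp" for a
  proof
    assume z: "b d + (\<Sum>i<d. a i * b i) = 0"
    have "\<forall>i<Suc d. (a(d := 1)) i = 0"
    proof (rule Suc.prems)
      have "(\<Sum>i<d. (a(d := 1)) i * b i) = (\<Sum>i<d. a i * b i)" by (rule sum.cong) auto
      thus "(\<Sum>i<Suc d. (a(d := 1)) i * b i) = 0" using z by (simp add: add.commute)
    qed (use a sub_ring_1[OF Q] in auto)
    hence "(a(d := 1)) d = 0" by blast
    thus False by simp
  qed
  have c2: "\<And>a i. (\<And>i. a i \<in> Qp) \<Longrightarrow> i < d \<Longrightarrow> c * nrm (a i) \<le> nrm (\<Sum>i<d. a i * b i)"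
    using c(2) by blast
  obtain \<delta> where \<delta>: "\<delta> > 0" "\<forall>a. (\<forall>i. a i \<in> Qp) \<longrightarrow> \<delta> \<le> nrm (b d + (\<Sum>i<d. a i * b i))"
    by (rule distance_from_span_pos[OF c(1) c2 indep])
  define C where "C = max 1 (nrm (b d) / \<delta>)"
  have C: "C \<ge> 1" "nrm (b d) / \<delta> \<le> C" by (auto simp: C_def)
  define c' where "c' = min \<delta> (c / C)"
  have c': "c' > 0" "c' \<le> \<delta>" "c' \<le> c / C" using c \<delta> C by (auto simp: c'_def)
  have "c' * nrm (a i) \<le> nrm (\<Sum>i<Suc d. a i * b i)" if a: "\<And>i. a i \<in> Qp" and i: "i < Suc d" for a i
  proof -
    define s where "s = (\<Sum>i<Suc d. a i * b i)"
    have top: "\<delta> * nrm (a d) \<le> nrm s"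
    proof (cases "a d = 0")
      case False
      have "s = a d * (b d + (\<Sum>i<d. (a i * inverse (a d)) * b i))"
      proof -
        have "a d * (\<Sum>i<d. (a i * inverse (a d)) * b i) = (\<Sum>i<d. a i * b i)"
          unfolding sum_distrib_left by (rule sum.cong) (use False in \<open>simp_all add: field_simps\<close>)
        thus ?thesis by (simp add: s_def distrib_left add.commute)
      qed
      hence "nrm s = nrm (a d) * nrm (b d + (\<Sum>i<d. (a i * inverse (a d)) * b i))" by (simp add: nrm_mult)
      moreover have d: "\<delta> \<le> nrm (b d + (\<Sum>i<d. (a i * inverse (a d)) * b i))"
        using a Qp_mult Qp_inverse by (intro \<delta>(2)[rule_format]) blast
      ultimately show ?thesis
        using mult_left_mono[OF d nrm_nonneg[of "a d"]] by (simp only: mult.commute[of \<delta>])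
    qed simp
    show ?thesis
    proof (cases "i = d")
      case True
      thus ?thesis using top mult_right_mono[OF c'(2), of "nrm (a d)"] by (simp add: s_def)
    next
      case False
      have "nrm (a d) * nrm (b d) \<le> C * nrm s"
      proof -
        have "nrm (a d) \<le> nrm s / \<delta>" using top \<delta>(1) by (simp add: field_simps)
        hence "nrm (a d) * nrm (b d) \<le> (nrm s / \<delta>) * nrm (b d)" by (rule mult_right_mono) simp
        also have "\<dots> = nrm (b d) / \<delta> * nrm s" by simp
        also have "\<dots> \<le> C * nrm s" by (rule mult_right_mono[OF C(2)]) simp
        finally show ?thesis .
      qed
      moreover have "nrm s \<le> C * nrm s" using mult_right_mono[OF C(1), of "nrm s"] by simp
      moreover have "(\<Sum>i<d. a i * b i) = s - a d * b d" by (simp add: s_def)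
      ultimately have "nrm (\<Sum>i<d. a i * b i) \<le> C * nrm s"
        using nrm_diff_le_max[of s "a d * b d"] by (simp add: nrm_mult)
      moreover have "c * nrm (a i) \<le> nrm (\<Sum>i<d. a i * b i)" using c(2) a i False by simp
      ultimately have "c * nrm (a i) \<le> C * nrm s" by linarith
      hence "c / C * nrm (a i) \<le> nrm s" using C(1) by (simp add: field_simps)
      thus ?thesis using mult_right_mono[OF c'(3), of "nrm (a i)"] by (simp add: s_def)
    qed
  qed
  thus ?case using c'(1) by blast
qed

lemma le_if_powers_le:
  fixes x y :: real
  assumes "\<And>n. x ^ n \<le> C * y ^ n" "0 \<le> x" "0 \<le> y"
  shows "x \<le> y"
proof (rule ccontr)
  assume "\<not> x \<le> y"
  hence xy: "y < x" by simp
  show False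
  proof (cases "y = 0")
    case True
    thus ?thesis using assms(1)[of 1] xy by simp
  next
    case False
    hence y: "y > 0" using assms(3) by simp
    hence "x / y > 1" using xy by simp
    then obtain n where "C < (x / y) ^ n" using real_arch_pow by blast
    thus False using assms(1)[of n] y by (simp add: power_divide field_simps)
  qed
qed

text \<open>The norm of \<open>g(w)\<close> is comparable to the size of the coefficients of \<open>g\<close> modulo the minimal polynomial of
  \<open>w\<close>, and these also bound the norm of \<open>g(w')\<close>. The constant disappears by passing to powers of \<open>g\<close>.\<close>

lemma nrm_poly_conj_le:
  fixes w w' :: 'a
  assumes f: "min_poly_over Qp w f" and w': "poly f w' = 0" and g: "poly_over Qp g"
  shows "nrm (poly g w') \<le> nrm (poly g w)"
proof -
  note Q = sub_field_imp_sub_ring[OF sub_field_Qp]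
  define d where "d = degree f"
  have low: "h = 0" if "poly_over Qp h" "poly h w = 0" "h = 0 \<or> degree h < d" for h
    using f that by (force simp: min_poly_over_def d_def)
  have "\<forall>i<d. a i = 0" if a: "\<And>i. a i \<in> Qp" "(\<Sum>i<d. a i * w ^ i) = 0" for a
  proof -
    define h where "h = Poly (map a [0..<d])"
    have ch: "coeff h i = (if i < d then a i else 0)" for i by (simp add: h_def nth_default_def)
    have "degree h < d \<or> h = 0"
    proof (cases d)
      case 0
      thus ?thesis using ch by (simp add: poly_eq_iff)
    next
      case (Suc m)
      have "degree h \<le> m" by (rule degree_le) (use ch Suc in auto)
      thus ?thesis using Suc by simp
    qed
    moreover have "poly_over Qp h" using a sub_ring_0[OF Q] by (auto simp: poly_over_def ch)
    moreover have "poly h w = 0"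
    proof -
      have "poly h w = (\<Sum>i\<le>max (degree h) d. coeff h i * w ^ i)"
        unfolding poly_altdef by (rule sum.mono_neutral_left) (auto simp: coeff_eq_0)
      also have "\<dots> = (\<Sum>i<d. a i * w ^ i)"
        by (rule sum.mono_neutral_cong_right) (auto simp: ch)
      finally show ?thesis using a by simp
    qed
    ultimately have "h = 0" using low by blast
    hence "coeff h i = 0" for i by simp
    thus ?thesis using ch by metis
  qed
  then obtain c where c: "c > 0"
    "\<forall>a. (\<forall>i. a i \<in> Qp) \<longrightarrow> (\<forall>i<d. c * nrm (a i) \<le> nrm (\<Sum>i<d. a i * w ^ i))"
    using independent_bounded_below[where d = d and b = "\<lambda>i. w ^ i"] by blast
  \<comment> \<open>bounds the powers of \<open>w'\<close> below the degree of \<open>f\<close>\<close>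
  define K where "K = max 1 (nrm w') ^ d"
  have K: "nrm w' ^ i \<le> K" if "i < d" for i
  proof -
    have "nrm w' ^ i \<le> max 1 (nrm w') ^ i" by (rule power_mono) auto
    also have "\<dots> \<le> K" unfolding K_def by (rule power_increasing) (use that in auto)
    finally show ?thesis .
  qed
  have K1: "1 \<le> K" by (simp add: K_def one_le_power)
  have bound: "nrm (poly h w') \<le> K / c * nrm (poly h w)" if h: "poly_over Qp h" for h
  proof -
    obtain q r where qr: "poly_over Qp q" "poly_over Qp r" "h = f * q + r" "r = 0 \<or> degree r < degree f"
      using poly_over_division[OF Q _ _ h, of f] f unfolding min_poly_over_def by blast
    have val: "poly h w = poly r w" "poly h w' = poly r w'"
      using qr(3) f w' by (simp_all add: min_poly_over_def)
    have pr: "poly r x = (\<Sum>i<d. coeff r i * x ^ i)" for x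
    proof (cases "r = 0")
      case False
      thus ?thesis unfolding poly_altdef using qr(4)
        by (intro sum.mono_neutral_left) (auto simp: d_def coeff_eq_0)
    qed simp
    have "nrm (poly r w') \<le> K / c * nrm (poly r w)"
      unfolding pr[of w']
    proof (rule nrm_sum_le)
      show "0 \<le> K / c * nrm (poly r w)" using K1 c by simp
      fix i assume i: "i \<in> {..<d}"
      have "c * nrm (coeff r i) \<le> nrm (poly r w)"
        unfolding pr using c(2) qr(2) i by (simp add: poly_over_def)
      hence "nrm (coeff r i) \<le> nrm (poly r w) / c" using c(1) by (simp add: field_simps)
      hence "nrm (coeff r i) * nrm w' ^ i \<le> (nrm (poly r w) / c) * K"
        using K[of i] i c(1) by (intro mult_mono) auto
      thus "nrm (coeff r i * w' ^ i) \<le> K / c * nrm (poly r w)"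
        by (simp add: nrm_mult nrm_power mult_ac)
    qed
    thus ?thesis by (simp add: val)
  qed
  show ?thesis
  proof (rule le_if_powers_le)
    fix n
    have "poly_over Qp (g ^ n)" using sub_ring_power[OF sub_ring_poly_over[OF Q], of g n] g by simp
    from bound[OF this] show "nrm (poly g w') ^ n \<le> K / c * nrm (poly g w) ^ n"
      by (simp add: nrm_power)
  qed auto
qed

lemma nrm_poly_conj:
  fixes w w' :: 'a
  assumes f: "min_poly_over Qp w f" and w': "poly f w' = 0" and g: "poly_over Qp g"
  shows "nrm (poly g w') = nrm (poly g w)"
proof (rule antisym)
  show "nrm (poly g w') \<le> nrm (poly g w)" by (rule nrm_poly_conj_le[OF assms])
  show "nrm (poly g w) \<le> nrm (poly g w')"
    by (rule nrm_poly_conj_le[OF min_poly_over_conj[OF sub_field_Qp f w'] _ g])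
       (use f in \<open>simp add: min_poly_over_def\<close>)
qed

lemma poly_over_pcompose:
  assumes k: "sub_ring k" and h: "poly_over k h" and g: "poly_over k g"
  shows "poly_over k (pcompose h g)"
  using h
proof (induction h)
  case (pCons a h)
  note R = sub_ring_poly_over[OF k]
  have "a \<in> k" "poly_over k h"
    using pCons.prems unfolding poly_over_def by (metis coeff_pCons_0, metis coeff_pCons_Suc)
  moreover from this have "poly_over k [:a:]"
    using sub_ring_0[OF k] by (auto simp: poly_over_def coeff_pCons split: nat.split)
  ultimately show ?case
    using pCons.IH g sub_ring_add[OF R, of "[:a:]" "g * pcompose h g"] sub_ring_mult[OF R, of g "pcompose h g"]
    by (simp add: pcompose_pCons)
qed (use h sub_ring_0[OF sub_ring_poly_over[OF k]] in simp)

text \<open>Over a larger field \<open>K\<close>: the minimal polynomial \<open>h\<close> of \<open>g(w)\<close> over \<open>Qp\<close> satisfies \<open>h(g(w)) = 0\<close>, hence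
  \<open>h(g(w')) = 0\<close> for every conjugate \<open>w'\<close> of \<open>w\<close> over \<open>K\<close>.\<close>

lemma nrm_poly_conj_over:
  fixes w w' :: 'a
  assumes K: "sub_field K" "Qp \<subseteq> K" "K \<subseteq> Qp_bar" and w: "w \<in> Qp_bar"
    and f: "min_poly_over K w f" and w': "poly f w' = 0" and g: "poly_over K g"
  shows "nrm (poly g w') = nrm (poly g w)"
proof -
  have "poly_over Qp_bar g" using g K(3) by (auto simp: poly_over_def)
  hence "poly g w \<in> Qp_bar" by (rule poly_in_sub_ring[OF sub_ring_Qp_bar _ w])
  then obtain h where h: "min_poly_over Qp (poly g w) h"
    using ex_min_poly_over[OF sub_field_Qp] unfolding Qp_bar_eq by blast
  have "poly_over K h" using h K(2) by (auto simp: min_poly_over_def poly_over_def)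
  hence "poly_over K (pcompose h g)" by (rule poly_over_pcompose[OF sub_field_imp_sub_ring[OF K(1)] _ g])
  moreover have "poly (pcompose h g) w = 0" using h by (simp add: poly_pcompose min_poly_over_def)
  ultimately have "poly (pcompose h g) w' = 0" by (rule min_poly_over_transfer[OF K(1) f w'])
  hence root: "poly h (poly g w') = 0" by (simp add: poly_pcompose)
  have "poly_over Qp ([:0, 1:] :: 'a poly)"
    using sub_ring_0[OF sub_field_imp_sub_ring[OF sub_field_Qp]]
      sub_ring_1[OF sub_field_imp_sub_ring[OF sub_field_Qp]]
    by (auto simp: poly_over_def coeff_pCons split: nat.split)
  from nrm_poly_conj[OF h root this] show ?thesis by simp
qed

text \<open>A finite extension is a finitely generated \<open>Qp\<close>-module stable under multiplication by its elements.\<close>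

lemma finite_extension_subset_Qp_bar:
  fixes K :: "'a set"
  assumes K: "finite_extension_Qp K"
  shows "sub_field K" "Qp \<subseteq> K" "K \<subseteq> Qp_bar"
proof -
  note Q = sub_field_imp_sub_ring[OF sub_field_Qp]
  show QK: "Qp \<subseteq> K" using K by (simp add: finite_extension_Qp_def)
  have 1: "1 \<in> K" using QK sub_ring_1[OF Q] by blast
  show KF: "sub_field K" using K 1 by (simp add: finite_extension_Qp_def sub_field_def)
  obtain B where B: "finite B" "B \<subseteq> K" "\<And>x. x \<in> K \<Longrightarrow> \<exists>c. (\<forall>b\<in>B. c b \<in> Qp) \<and> x = (\<Sum>b\<in>B. c b * b)"
    using K unfolding finite_extension_Qp_def by blast
  have span: "x \<in> span_over Qp (\<lambda>b. b) B" if "x \<in> K" for x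
    using B(3)[OF that] by (auto simp: span_over_def)
  obtain b0 where b0: "b0 \<in> B" "b0 \<noteq> 0"
  proof (rule ccontr)
    assume "\<not> thesis"
    hence "\<forall>b\<in>B. b = 0" using that by blast
    hence "(\<Sum>b\<in>B. c b * b) = 0" for c by (intro sum.neutral) auto
    thus False using B(3)[OF 1] by auto
  qed
  show "K \<subseteq> Qp_bar"
  proof
    fix y assume y: "y \<in> K"
    have "y * b \<in> span_over Qp (\<lambda>b. b) B" if "b \<in> B" for b
      using span B(2) that y KF by (auto simp: sub_field_def)
    from alg_over_if_stable[where b = "\<lambda>b. b", OF Q B(1) b0 this]
    show "y \<in> Qp_bar" unfolding Qp_bar_eq .
  qed
qed

section \<open>The characteristic sequence as a Newton polygon\<close>

lemma v_eq_ereal_iff: "v x = ereal a \<longleftrightarrow> nrm x = p powr (- a)"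
proof (cases "x = 0")
  case False
  have "log p (nrm x) = - a \<longleftrightarrow> nrm x = p powr (- a)"
  proof
    assume "log p (nrm x) = - a"
    moreover have "p powr (log p (nrm x)) = nrm x" using p_gt_1 False by (intro powr_log_cancel) auto
    ultimately show "nrm x = p powr (- a)" by simp
  qed (use p_gt_1 in simp)
  thus ?thesis using v_eq_log[OF False] by auto
qed (use p_gt_1 in auto)

lemma char_slope_eq:
  assumes "fps_nth F k \<noteq> 0" "fps_nth F q \<noteq> 0" "k < q"
  shows "char_slope v F k q
    = ereal ((log p (nrm (fps_nth F q)) - log p (nrm (fps_nth F k))) / real (q - k))"
  using assms by (simp add: char_slope_def v_eq_log)

lemma char_slope_0:
  assumes "fps_nth F k \<noteq> 0" "fps_nth F q = 0" "k < q"
  shows "char_slope v F k q = -\<infinity>"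
  using assms by (simp add: char_slope_def v_eq_log)

lemma char_step_unique: "char_step v F k q \<Longrightarrow> char_step v F k q' \<Longrightarrow> q = q'"
  by (auto simp: char_step_def intro: antisym)

text \<open>A maximal slope \<open>a\<close> says that on the circle of radius \<open>p\<^sup>-\<^sup>a\<close> no later term exceeds the term of index
  \<open>k'\<close>. The maximum is not \<open>-\<infinity>\<close>, since otherwise it would be attained at every later index and there would be
  no last one.\<close>

lemma char_step_edge:
  assumes Fk: "fps_nth F k' \<noteq> 0" and step: "char_step v F k' k"
  obtains a where "fps_nth F k \<noteq> 0" "k' < k" "char_slope v F k' k = ereal a"
    "nrm (fps_nth F k) * (p powr (- a)) ^ k = nrm (fps_nth F k') * (p powr (- a)) ^ k'"
    "\<And>q. k' < q \<Longrightarrow> nrm (fps_nth F q) * (p powr (- a)) ^ q \<le> nrm (fps_nth F k') * (p powr (- a)) ^ k'"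
    "\<And>q. k < q \<Longrightarrow> nrm (fps_nth F q) * (p powr (- a)) ^ q < nrm (fps_nth F k') * (p powr (- a)) ^ k'"
proof -
  have max: "k' < k" "\<And>q. k' < q \<Longrightarrow> char_slope v F k' q \<le> char_slope v F k' k"
    using step unfolding char_step_def is_arg_max_def by (auto simp only: not_less de_Morgan_conj)
  have last: "q \<le> k" if "k' < q" "char_slope v F k' q = char_slope v F k' k" for q
  proof -
    have "is_arg_max (char_slope v F k') (\<lambda>q. k' < q) q"
      unfolding is_arg_max_def that(2) using that(1) max(2) by (meson not_le)
    thus ?thesis using step unfolding char_step_def by blast
  qed
  have nz: "fps_nth F k \<noteq> 0"
  proof
    assume "fps_nth F k = 0"
    hence "char_slope v F k' k = -\<infinity>" using char_slope_0 Fk max(1) by blast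
    hence "char_slope v F k' (Suc k) = char_slope v F k' k" using max(2)[of "Suc k"] max(1) by simp
    thus False using last[of "Suc k"] max(1) by simp
  qed
  define a where "a = (log p (nrm (fps_nth F k)) - log p (nrm (fps_nth F k'))) / real (k - k')"
  have slope: "char_slope v F k' k = ereal a" unfolding a_def by (rule char_slope_eq[OF Fk nz max(1)])
  define R where "R = p powr (- a)"
  have R: "R > 0" using p_gt_1 by (simp add: R_def)
  have log_term: "log p (nrm (fps_nth F q) * R ^ q) = log p (nrm (fps_nth F q)) - real q * a"
    if "fps_nth F q \<noteq> 0" for q
    using that R p_gt_1 by (simp add: log_mult log_nat_power R_def)
  have cmp: "nrm (fps_nth F q) * R ^ q \<le> nrm (fps_nth F k') * R ^ k'"
      "k < q \<Longrightarrow> nrm (fps_nth F q) * R ^ q < nrm (fps_nth F k') * R ^ k'"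
      "q = k \<Longrightarrow> nrm (fps_nth F q) * R ^ q = nrm (fps_nth F k') * R ^ k'"
    if q: "k' < q" for q
  proof -
    define s where "s = (log p (nrm (fps_nth F q)) - log p (nrm (fps_nth F k'))) / real (q - k')"
    have *: "(nrm (fps_nth F q) * R ^ q \<le> nrm (fps_nth F k') * R ^ k' \<longleftrightarrow> s \<le> a) \<and>
          (nrm (fps_nth F q) * R ^ q < nrm (fps_nth F k') * R ^ k' \<longleftrightarrow> s < a)" if "fps_nth F q \<noteq> 0"
    proof -
      have pos: "nrm (fps_nth F q) * R ^ q > 0" "nrm (fps_nth F k') * R ^ k' > 0" using that Fk R by auto
      have qk: "real (q - k') > 0" "real (q - k') = real q - real k'" using q by auto
      have "s \<le> a \<longleftrightarrow> log p (nrm (fps_nth F q)) - log p (nrm (fps_nth F k')) \<le> a * (real q - real k')"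
        "s < a \<longleftrightarrow> log p (nrm (fps_nth F q)) - log p (nrm (fps_nth F k')) < a * (real q - real k')"
        unfolding s_def using qk by (simp_all add: pos_divide_le_eq pos_divide_less_eq)
      thus ?thesis
        using log_le_cancel_iff[OF p_gt_1 pos] log_less_cancel_iff[OF p_gt_1 pos]
        unfolding log_term[OF that] log_term[OF Fk] by (auto simp: algebra_simps)
    qed
    have zero: "nrm (fps_nth F q) * R ^ q < nrm (fps_nth F k') * R ^ k'" if "fps_nth F q = 0"
      using that Fk R by simp
    have sq: "fps_nth F q \<noteq> 0 \<Longrightarrow> char_slope v F k' q = ereal s" unfolding s_def by (rule char_slope_eq[OF Fk _ q])
    have sa: "fps_nth F q \<noteq> 0 \<Longrightarrow> s \<le> a" using max(2)[OF q] sq slope by simp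
    show "nrm (fps_nth F q) * R ^ q \<le> nrm (fps_nth F k') * R ^ k'"
      using * zero sa by (cases "fps_nth F q = 0") auto
    show "nrm (fps_nth F q) * R ^ q < nrm (fps_nth F k') * R ^ k'" if "k < q"
    proof (cases "fps_nth F q = 0")
      case False
      have "s \<noteq> a" using last[OF q] that sq[OF False] slope by auto
      thus ?thesis using * False sa by auto
    qed (rule zero)
    show "nrm (fps_nth F q) * R ^ q = nrm (fps_nth F k') * R ^ k'" if "q = k"
    proof -
      have "s = a" using that by (simp add: s_def a_def)
      thus ?thesis using * nz that by (meson less_irrefl not_le order_antisym order_refl)
    qed
  qed
  show ?thesis
    by (rule that[OF nz max(1) slope]) (use cmp max(1) in \<open>auto simp: R_def\<close>)
qed

lemma char_seq_Suc:
  assumes "char_seq v F (Suc n) = Some k"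
  obtains k' where "char_seq v F n = Some k'" "char_step v F k' k"
proof -
  obtain k' where k': "char_seq v F n = Some k'"
    "(if \<exists>q. char_step v F k' q then Some (THE q. char_step v F k' q) else None) = Some k"
    using assms by (auto simp: bind_eq_Some_conv)
  then obtain q where q: "char_step v F k' q" "(THE q. char_step v F k' q) = k"
    by (auto split: if_splits)
  have "(THE q. char_step v F k' q) = q" using q(1) char_step_unique by blast
  thus ?thesis using that k' q by simp
qed

text \<open>The slopes of the characteristic sequence decrease strictly, so the radii increase. On the larger circle the
  terms before the index \<open>k\<^sub>n\<^sub>-\<^sub>1\<close>, which do not exceed the one at \<open>k\<^sub>n\<^sub>-\<^sub>1\<close> on the previous circle, are strictly smaller.\<close>

lemma char_seq_edge:
  assumes F0: "fps_nth F 0 \<noteq> 0"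
  shows "char_seq v F n = Some k \<Longrightarrow> fps_nth F k \<noteq> 0 \<and>
    (n > 0 \<longrightarrow> (\<exists>a k'. char_seq v F (n - 1) = Some k' \<and> k' < k \<and> char_val v F n = ereal a \<and>
       newton_edge (fps_nth F) (p powr (- a)) k' k (nrm (fps_nth F k) * (p powr (- a)) ^ k)))"
proof (induction n arbitrary: k)
  case 0
  thus ?case using F0 by simp
next
  case (Suc n)
  obtain k' where k': "char_seq v F n = Some k'" "char_step v F k' k"
    using char_seq_Suc[OF Suc.prems] by blast
  have Fk': "fps_nth F k' \<noteq> 0" using Suc.IH[OF k'(1)] by blast
  obtain a where a: "fps_nth F k \<noteq> 0" "k' < k" "char_slope v F k' k = ereal a"
    "nrm (fps_nth F k) * (p powr (- a)) ^ k = nrm (fps_nth F k') * (p powr (- a)) ^ k'"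
    "\<And>q. k' < q \<Longrightarrow> nrm (fps_nth F q) * (p powr (- a)) ^ q \<le> nrm (fps_nth F k') * (p powr (- a)) ^ k'"
    "\<And>q. k < q \<Longrightarrow> nrm (fps_nth F q) * (p powr (- a)) ^ q < nrm (fps_nth F k') * (p powr (- a)) ^ k'"
    using char_step_edge[OF Fk' k'(2)] by blast
  define R where "R = p powr (- a)"
  have R: "R > 0" using p_gt_1 by (simp add: R_def)
  have below: "nrm (fps_nth F q) * R ^ q < nrm (fps_nth F k') * R ^ k'" if q: "q < k'" for q
  proof -
    have "n > 0" using q k'(1) by (cases n) auto
    then obtain a' k'' where prev: "k'' < k'"
       "newton_edge (fps_nth F) (p powr (- a')) k'' k' (nrm (fps_nth F k') * (p powr (- a')) ^ k')"
      using Suc.IH[OF k'(1)] by blast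
    define R' where "R' = p powr (- a')"
    have R': "R' > 0" using p_gt_1 by (simp add: R'_def)
    have e: "nrm (fps_nth F q) * R' ^ q \<le> nrm (fps_nth F k') * R' ^ k'"
      "nrm (fps_nth F k) * R' ^ k < nrm (fps_nth F k') * R' ^ k'"
      using prev(2) a(2) by (auto simp: newton_edge_def R'_def)
    have pk: "x ^ k = x ^ k' * x ^ (k - k')" for x :: real using a(2) by (simp flip: power_add)
    have pq: "x ^ k' = x ^ q * x ^ (k' - q)" for x :: real using q by (simp flip: power_add)
    have "nrm (fps_nth F k) * R' ^ (k - k') < nrm (fps_nth F k')"
      using e(2) R' unfolding pk[of R'] by (simp add: mult.left_commute[of _ "R' ^ k'"] mult.commute[of _ "R' ^ k'"])
    moreover have "nrm (fps_nth F k) * R ^ (k - k') = nrm (fps_nth F k')"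
      using a(4) R unfolding R_def[symmetric] pk[of R] by simp
    ultimately have "nrm (fps_nth F k) * R' ^ (k - k') < nrm (fps_nth F k) * R ^ (k - k')" by simp
    hence "R' ^ (k - k') < R ^ (k - k')" using a(1) by simp
    hence "R' < R" using R by (meson less_imp_le power_less_imp_less_base)
    have "nrm (fps_nth F q) \<le> nrm (fps_nth F k') * R' ^ (k' - q)"
      using e(1) R' unfolding pq[of R'] by (simp add: mult.left_commute[of _ "R' ^ q"] mult.commute[of _ "R' ^ q"])
    also have "\<dots> < nrm (fps_nth F k') * R ^ (k' - q)"
      using Fk' q R' \<open>R' < R\<close> by (intro mult_strict_left_mono power_strict_mono) auto
    finally have "nrm (fps_nth F q) * R ^ q < nrm (fps_nth F k') * R ^ (k' - q) * R ^ q"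
      using R by simp
    thus ?thesis unfolding pq[of R] by (simp add: mult_ac)
  qed
  have "newton_edge (fps_nth F) R k' k (nrm (fps_nth F k) * R ^ k)"
    unfolding newton_edge_def
  proof (intro conjI allI impI)
    show "k' \<le> k" using a(2) by simp
    show "nrm (fps_nth F k') * R ^ k' = nrm (fps_nth F k) * R ^ k" using a(4) by (simp add: R_def)
    show "nrm (fps_nth F i) * R ^ i \<le> nrm (fps_nth F k) * R ^ k" for i
      using below[of i] a(4) a(5)[of i] unfolding R_def[symmetric] by (cases i k' rule: linorder_cases) auto
    show "nrm (fps_nth F i) * R ^ i < nrm (fps_nth F k) * R ^ k" if "i < k' \<or> k < i" for i
      using that below[of i] a(4) a(6)[of i] unfolding R_def[symmetric] by auto
  qed simp
  moreover have "char_val v F (Suc n) = ereal a"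
    using a(3) Suc.prems k'(1) by (simp add: char_val_def char_index_def char_slope_def)
  ultimately show ?case using a k'(1) unfolding R_def by auto
qed

section \<open>Two factorisations on a common circle\<close>

text \<open>The only information about a power series, or about a polynomial close to it, that enters the estimates:
  its roots on the circle and the constant \<open>A\<close>, for which \<open>- log p A\<close> is the quantity
  \<open>v(F\<^sub>k) + k' \<alpha>\<close> of the bounds.\<close>

definition factor_on :: "real \<Rightarrow> ('a \<Rightarrow> 'a) \<Rightarrow> real \<Rightarrow> 'a list \<Rightarrow> bool" where
  "factor_on R f A zs \<longleftrightarrow> A > 0 \<and> (\<forall>z\<in>set zs. nrm z = R) \<and>
     (\<forall>x. nrm x = R \<longrightarrow> nrm (f x) = A * (\<Prod>z\<leftarrow>zs. nrm (x - z)))"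

definition root_dist :: "'a list \<Rightarrow> 'a list \<Rightarrow> real" where
  "root_dist zs ws = (\<Prod>z\<leftarrow>zs. \<Prod>w\<leftarrow>ws. nrm (z - w))"

lemma prod_list_mult: "(\<Prod>x\<leftarrow>xs. f x * g x) = (\<Prod>x\<leftarrow>xs. f x) * (\<Prod>x\<leftarrow>xs. g x :: real)"
  by (induction xs) auto

lemma root_dist_commute: "root_dist zs ws = root_dist ws zs"
proof (induction zs)
  case Nil
  show ?case by (induction ws) (auto simp: root_dist_def)
next
  case (Cons z zs)
  thus ?case by (simp add: root_dist_def prod_list_mult nrm_minus_commute[of z])
qed

lemma nrm_resultant:
  "nrm (resultant (lin_prod zs) (lin_prod ws)) = root_dist zs ws"
  unfolding resultant_prod_linear_left root_dist_def nrm_prod_list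
  by (simp add: o_def poly_prod_list nrm_prod_list)

lemma prod_list_nonneg_le_1:
  fixes f :: "'b \<Rightarrow> real"
  assumes "\<And>x. x \<in> set xs \<Longrightarrow> 0 \<le> f x \<and> f x \<le> 1"
  shows "0 \<le> (\<Prod>x\<leftarrow>xs. f x) \<and> (\<Prod>x\<leftarrow>xs. f x) \<le> 1"
  using assms by (induction xs) (auto intro: mult_le_one)

lemma prod_list_le_prod_subset:
  fixes f :: "'b \<Rightarrow> real"
  assumes f: "\<And>x. x \<in> set xs \<Longrightarrow> 0 \<le> f x \<and> f x \<le> 1" and U: "U \<subseteq> set xs"
  shows "(\<Prod>x\<leftarrow>xs. f x) \<le> (\<Prod>x\<in>U. f x)"
proof -
  have "(\<Prod>x\<leftarrow>xs. f x) = (\<Prod>x\<in>set xs. f x ^ count_list xs x)" by (rule prod_list_map_eq_prod_count)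
  also have "\<dots> \<le> (\<Prod>x\<in>set xs. f x)"
  proof (rule prod_mono)
    fix x assume x: "x \<in> set xs"
    hence "1 \<le> count_list xs x" by (simp add: Suc_le_eq count_list_0_iff flip: neq0_conv)
    hence "f x ^ count_list xs x \<le> f x ^ 1" using f[OF x] by (intro power_decreasing) auto
    thus "0 \<le> f x ^ count_list xs x \<and> f x ^ count_list xs x \<le> f x" using f[OF x] by simp
  qed
  also have "\<dots> = (\<Prod>x\<in>U. f x) * (\<Prod>x\<in>set xs - U. f x)"
    using U by (metis List.finite_set prod.subset_diff mult.commute)
  also have "\<dots> \<le> (\<Prod>x\<in>U. f x) * 1"
    using f U by (intro mult_left_mono prod_le_1 prod_nonneg) auto
  finally show ?thesis by simp
qed

context
  fixes R :: real assumes R: "0 < R" "R \<le> 1"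
begin

lemma factor_on_dist_le_1:
  assumes "factor_on R f A zs" "nrm x = R" "z \<in> set zs"
  shows "nrm (x - z) \<le> 1"
  using assms R by (intro order_trans[OF nrm_diff_le_max]) (auto simp: factor_on_def)

lemma factor_on_prod_le_1:
  assumes "factor_on R f A zs" "nrm x = R"
  shows "0 \<le> (\<Prod>z\<leftarrow>zs. nrm (x - z)) \<and> (\<Prod>z\<leftarrow>zs. nrm (x - z)) \<le> 1"
  using factor_on_dist_le_1[OF assms] by (intro prod_list_nonneg_le_1) auto

text \<open>As \<open>R \<le> 1\<close>, the roots are integral and the remaining factors of the resultant have norm at most 1.\<close>

lemma root_dist_le_prod:
  assumes F: "factor_on R f A zs" and ws: "\<forall>w\<in>set ws. nrm w = R" and w: "w \<in> set ws"
  shows "root_dist ws zs \<le> (\<Prod>z\<leftarrow>zs. nrm (w - z))"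
  unfolding root_dist_def
  using prod_list_le_prod_subset[of ws "\<lambda>w. \<Prod>z\<leftarrow>zs. nrm (w - z)" "{w}"]
    factor_on_prod_le_1[OF F] ws w by auto

text \<open>Replacing \<open>x\<close> by the root \<open>u\<close> of \<open>f\<close> or \<open>g\<close> closest to it does not increase its distance to any
  other root, by the ultrametric inequality.\<close>

lemma max_le_at_nearest_root:
  assumes F: "factor_on R f A zs" and G: "factor_on R g B ws" and ne: "zs \<noteq> []" and x: "nrm x = R"
  obtains u where "u \<in> set zs \<union> set ws" "max (nrm (f u)) (nrm (g u)) \<le> max (nrm (f x)) (nrm (g x))"
proof -
  define U where "U = set zs \<union> set ws"
  have U: "finite U" "U \<noteq> {}" using ne by (auto simp: U_def)
  obtain u where u: "u \<in> U" "\<And>y. y \<in> U \<Longrightarrow> nrm (x - u) \<le> nrm (x - y)"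
    using ex_is_arg_min_if_finite[OF U, of "\<lambda>y. nrm (x - y)"] by (auto simp: is_arg_min_linorder)
  have nu: "nrm u = R" using u(1) F G by (auto simp: factor_on_def U_def)
  have near: "nrm (u - y) \<le> nrm (x - y)" if "y \<in> U" for y
  proof -
    have "u - y = (x - y) - (x - u)" by simp
    thus ?thesis using nrm_diff_le_max[of "x - y" "x - u"] u(2)[OF that] by simp
  qed
  have "(\<Prod>y\<leftarrow>ys. nrm (u - y)) \<le> (\<Prod>y\<leftarrow>ys. nrm (x - y)) \<and> 0 \<le> (\<Prod>y\<leftarrow>ys. nrm (u - y))"
    if "set ys \<subseteq> U" for ys
    using that near by (induction ys) (auto intro!: mult_mono)
  from this[of zs] this[of ws] have "nrm (f u) \<le> nrm (f x)" "nrm (g u) \<le> nrm (g x)"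
    using F G x nu by (auto simp: factor_on_def U_def intro!: mult_left_mono)
  hence "max (nrm (f u)) (nrm (g u)) \<le> max (nrm (f x)) (nrm (g x))" by (rule max.mono)
  thus ?thesis using that[of u] u(1) unfolding U_def by blast
qed

text \<open>At a root of one function the other one equals its constant times a partial product of the resultant.\<close>

lemma max_ge_root_dist:
  assumes F: "factor_on R f A zs" and G: "factor_on R g B ws" and ne: "zs \<noteq> []" and x: "nrm x = R"
  shows "min A B * root_dist zs ws \<le> max (nrm (f x)) (nrm (g x))"
proof -
  obtain u where u: "u \<in> set zs \<union> set ws" "max (nrm (f u)) (nrm (g u)) \<le> max (nrm (f x)) (nrm (g x))"
    using max_le_at_nearest_root[OF F G ne x] by blast
  have rd0: "0 \<le> root_dist zs ws"
    unfolding root_dist_def using G F factor_on_prod_le_1[OF G]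
    by (intro prod_list_nonneg) (auto simp: factor_on_def)
  have AB: "A > 0" "B > 0" using F G by (auto simp: factor_on_def)
  have Fz: "\<forall>z\<in>set zs. nrm z = R" and Gw: "\<forall>w\<in>set ws. nrm w = R"
    using F G by (auto simp: factor_on_def)
  from u(1) have "min A B * root_dist zs ws \<le> max (nrm (f u)) (nrm (g u))"
  proof
    assume z: "u \<in> set zs"
    have "min A B * root_dist zs ws \<le> B * (\<Prod>w\<leftarrow>ws. nrm (u - w))"
      using root_dist_le_prod[OF G Fz z] rd0 AB by (intro mult_mono) auto
    also have "\<dots> = nrm (g u)" using G Fz z by (simp add: factor_on_def)
    finally show ?thesis by simp
  next
    assume w: "u \<in> set ws"
    have "min A B * root_dist zs ws \<le> A * (\<Prod>z\<leftarrow>zs. nrm (u - z))"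
      using root_dist_le_prod[OF F Gw w] rd0 AB unfolding root_dist_commute[of zs]
      by (intro mult_mono) auto
    also have "\<dots> = nrm (f u)" using F Gw w by (simp add: factor_on_def)
    finally show ?thesis by simp
  qed
  thus ?thesis using u(2) by (rule order_trans)
qed

lemma prod_list_nrm_at_roots:
  assumes F: "factor_on R f A zs" and ws: "\<forall>w\<in>set ws. nrm w = R"
  shows "(\<Prod>w\<leftarrow>ws. nrm (f w)) = A ^ length ws * root_dist ws zs"
  using ws F by (induction ws) (auto simp: factor_on_def root_dist_def)

text \<open>At the points of \<open>ws\<close> the norm of \<open>f\<close> exceeds the error, so \<open>f'\<close> has the same norm there, and the product
  of these norms determines the product of the distances.\<close>

lemma root_dist_perturb:
  assumes F: "factor_on R f A zs" and F': "factor_on R f' A zs'"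
    and close: "\<forall>x. nrm x = R \<longrightarrow> nrm (f x - f' x) \<le> E"
    and ws: "\<forall>w\<in>set ws. nrm w = R" and E: "E < A * root_dist ws zs"
  shows "root_dist ws zs' = root_dist ws zs"
proof -
  have A: "A > 0" using F by (simp add: factor_on_def)
  have "nrm (f' w) = nrm (f w)" if w: "w \<in> set ws" for w
  proof -
    have "E < A * (\<Prod>z\<leftarrow>zs. nrm (w - z))"
      using root_dist_le_prod[OF F ws w] A E by (meson less_le_trans mult_left_mono less_imp_le)
    also have "\<dots> = nrm (f w)" using F ws w by (simp add: factor_on_def)
    finally show ?thesis using close[rule_format, of w] ws w nrm_eq_if_close[of "f w" "f' w"] by simp
  qed
  hence "(\<Prod>w\<leftarrow>ws. nrm (f' w)) = (\<Prod>w\<leftarrow>ws. nrm (f w))" by (intro arg_cong[where f = prod_list] map_cong) auto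
  thus ?thesis unfolding prod_list_nrm_at_roots[OF F ws] prod_list_nrm_at_roots[OF F' ws] using A by simp
qed

end

text \<open>The larger of the two values keeps its norm, and the smaller one cannot overtake it.\<close>

lemma max_nrm_perturb:
  assumes "nrm (x - x') \<le> E" "nrm (y - y') \<le> E" "E < max (nrm x) (nrm y)"
  shows "max (nrm x') (nrm y') = max (nrm x) (nrm y)"
proof -
  have le: "nrm u' \<le> max (nrm u) E" if "nrm (u - u') \<le> E" for u u'
    using that nrm_diff_le_max[of u "u - u'"] by auto
  have eq: "nrm u' = nrm u" if "nrm (u - u') \<le> E" "E < nrm u" for u u'
    using that nrm_eq_if_close[of u u'] by auto
  show ?thesis
    using le[OF assms(1)] le[OF assms(2)] eq[OF assms(1)] eq[OF assms(2)] assms(3) by (auto simp: max_def split: if_splits)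
qed

section \<open>Ramification\<close>

lemma nrm_p: "nrm (of_nat p) = inverse p"
proof -
  have "v (of_nat p) = ereal 1" using v_p by simp
  thus ?thesis unfolding v_eq_ereal_iff using p_gt_1 by (simp add: powr_minus)
qed

lemma nrm_of_nat:
  "n > 0 \<Longrightarrow> \<exists>m::int. nrm (of_nat n) = p powr (real_of_int m)"
proof (induction n rule: less_induct)
  case (less n)
  show ?case
  proof (cases "p dvd n")
    case True
    then obtain n' where n': "n = p * n'" by (auto elim: dvdE)
    hence "n' < n" "n' > 0" using less.prems p_gt_1 by auto
    then obtain m where "nrm (of_nat n') = p powr (real_of_int m)" using less.IH by blast
    hence "nrm (of_nat n) = p powr (real_of_int (m - 1))"
      using p_gt_1 by (simp add: n' nrm_mult nrm_p powr_diff field_simps)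
    thus ?thesis by blast
  next
    case False
    hence "coprime (int n) (int p)"
      using prime_imp_coprime[OF prime_p False] by (simp add: coprime_commute)
    hence "gcd (int n) (int p) = 1" by (simp only: coprime_iff_gcd_eq_1)
    then obtain a b where ab: "a * int n + b * int p = 1" using bezout_int[of "int n" "int p"] by auto
    have int_le: "nrm (of_int c) \<le> 1" for c
      using nrm_of_nat_le_1[of "nat \<bar>c\<bar>"] by (cases "c \<ge> 0") (auto simp: abs_if)
    have "of_int a * of_nat n + of_int b * of_nat p = (of_int (a * int n + b * int p) :: 'a)" by simp
    hence one: "of_int a * of_nat n + of_int b * of_nat p = (1 :: 'a)" unfolding ab by simp
    have "nrm (of_int b * of_nat p) < 1"
      using int_le[of b] p_gt_1 by (simp add: nrm_mult nrm_p divide_inverse[symmetric])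
    hence "1 \<le> nrm (of_int a * of_nat n)"
      using nrm_add_le_max[of "of_int a * of_nat n" "of_int b * of_nat p"] unfolding one by auto
    also have "\<dots> \<le> 1 * nrm (of_nat n)" unfolding nrm_mult by (rule mult_right_mono[OF int_le nrm_nonneg])
    finally have "nrm (of_nat n) = p powr (real_of_int 0)" using nrm_of_nat_le_1[of n] p_gt_1 by simp
    thus ?thesis by blast
  qed
qed

lemma nrm_Qp:
  assumes x: "x \<in> Qp" "x \<noteq> 0" shows "\<exists>m::int. nrm x = p powr (real_of_int m)"
proof -
  obtain q where q: "q \<in> \<rat>" "nrm (x - q) < nrm x" using x unfolding Qp_iff by (metis nrm_pos_iff)
  hence nq: "nrm x = nrm q" using nrm_eq_if_close by blast
  obtain a b :: int where "b > 0" and ab': "q = of_int a / of_int b" using q(1) by (elim Rats_cases')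
  hence ab: "b \<noteq> 0" "q = of_int a / of_int b" by auto
  have abs: "nrm (of_int c) = nrm (of_nat (nat \<bar>c\<bar>))" for c
    by (cases "c \<ge> 0") (auto simp: abs_if)
  have a: "a \<noteq> 0" using nq x ab by auto
  obtain i where i: "nrm (of_nat (nat \<bar>a\<bar>)) = p powr (real_of_int i)" using nrm_of_nat[of "nat \<bar>a\<bar>"] a by auto
  obtain j where j: "nrm (of_nat (nat \<bar>b\<bar>)) = p powr (real_of_int j)" using nrm_of_nat[of "nat \<bar>b\<bar>"] ab by auto
  have "nrm x = p powr (real_of_int (i - j))"
    using p_gt_1 unfolding nq ab(2) nrm_divide abs i j by (simp add: powr_diff)
  thus ?thesis by blast
qed

lemma real_v: "x \<noteq> 0 \<Longrightarrow> real_of_ereal (v x) = - log p (nrm x)"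
  by (simp add: v_eq_log)

lemma value_group_mult:
  assumes "sub_field K" "s \<in> value_group v K" "t \<in> value_group v K"
  shows "s + t \<in> value_group v K" "s - t \<in> value_group v K"
proof -
  obtain x y where xy: "x \<in> K" "x \<noteq> 0" "s = real_of_ereal (v x)" "y \<in> K" "y \<noteq> 0" "t = real_of_ereal (v y)"
    using assms by (auto simp: value_group_def)
  have "s + t = real_of_ereal (v (x * y))" "s - t = real_of_ereal (v (x * inverse y))"
    using xy p_gt_1 by (simp_all add: real_v nrm_mult nrm_inverse log_mult log_inverse)
  moreover have "x * y \<in> K - {0}" "x * inverse y \<in> K - {0}" using assms(1) xy by (auto simp: sub_field_def)
  ultimately show "s + t \<in> value_group v K" "s - t \<in> value_group v K" unfolding value_group_def by blast+
qed

text \<open>The normalised valuation of an element of \<open>K\<close> is an integer, so the floor in its definition is exact; if the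
  ramification index is 0, because the quotient of value groups is infinite, both sides vanish.\<close>

lemma v_unif_eq:
  assumes K: "sub_field K" and x: "x \<in> K" "x \<noteq> 0"
  shows "real_of_int (v_unif v K x) = - real (ramification_index v K) * log p (nrm x)"
proof -
  have sub: "value_group v (Qp :: 'a set) \<subseteq> \<int>"
  proof
    fix s assume "s \<in> value_group v (Qp :: 'a set)"
    then obtain y where y: "y \<in> Qp" "y \<noteq> 0" "s = real_of_ereal (v y)" by (auto simp: value_group_def)
    obtain m :: int where "nrm y = p powr (real_of_int m)" using nrm_Qp y by blast
    thus "s \<in> \<int>" using y p_gt_1 by (simp add: real_v)
  qed
  have 1: "(1 :: 'a) \<in> Qp - {0}" using sub_field_Qp by (simp add: sub_field_def)
  have "real (ramification_index v K) * real_of_ereal (v x) \<in> \<int>"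
    unfolding ramification_index_def
  proof (rule card_cosets_mult_in_Ints)
    show "0 \<in> value_group v (Qp :: 'a set)"
      using imageI[OF 1, of "\<lambda>x. real_of_ereal (v x)"] by (simp add: value_group_def real_v)
  qed (use sub x value_group_mult[OF K] value_group_mult[OF sub_field_Qp] in \<open>auto simp: value_group_def\<close>)
  thus ?thesis using x by (auto simp: v_unif_def real_v elim!: Ints_cases)
qed

section \<open>Conjugates of a root on the circle\<close>

text \<open>The product of the conjugates of \<open>w\<close> lies in \<open>K\<close> up to sign and has valuation \<open>d \<alpha>\<close>. As \<open>e d \<alpha>\<close>
  is an integer and \<open>e (l - l') \<alpha>\<close> is the difference of the normalised valuations of the end coefficients,
  the number \<open>d\<close> of conjugates is divisible by \<open>(l - l') / gcd\<close>.\<close>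

lemma conjugates_on_circle:
  fixes K :: "'a set"
  assumes K: "finite_extension_Qp K" and g: "poly_over K g"
    and edge: "newton_edge (coeff g) R l' l M" and M: "M > 0" and R: "R > 0" and l: "l' < l"
    and w: "w \<in> Qp_bar" "nrm w = R" "poly g w = 0"
  obtains U where "finite U" "w \<in> U" "\<forall>u\<in>U. nrm u = R \<and> poly g u = 0"
    "\<forall>h. poly_over K h \<longrightarrow> (\<forall>u\<in>U. nrm (poly h u) = nrm (poly h w))"
    "int (l - l') \<le> int (card U) * gcd (v_unif v K (coeff g l) - v_unif v K (coeff g l')) (int (l - l'))"
proof -
  note KF = finite_extension_subset_Qp_bar[OF K]
  have KR: "sub_ring K" by (rule sub_field_imp_sub_ring[OF KF(1)])
  have "w \<in> alg_over K"
  proof -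
    have "g \<noteq> 0" using edge M by (auto simp: newton_edge_def)
    thus ?thesis using g w(3) by (auto simp: alg_over_def)
  qed
  then obtain h where h: "min_poly_over K w h" using ex_min_poly_over[OF KF(1)] by blast
  have h_over: "poly_over K h" "lead_coeff h = 1" using h by (auto simp: min_poly_over_def)
  have "poly_over Qp_bar h" "h \<noteq> 0" using h_over KF(3) by (auto simp: poly_over_def)
  then obtain c us where us: "c \<noteq> 0" "h = smult c (lin_prod us)"
    using poly_Qp_bar_splits by metis
  have "lead_coeff (lin_prod us) = 1" by (induction us) (simp_all add: lead_coeff_mult del: mult_pCons_left)
  hence "c = 1" using h_over(2) us by (simp add: lead_coeff_smult)
  hence hus: "h = lin_prod us" using us by simp
  have dist: "distinct us" using distinct_roots_min_poly_over[OF KF(1)] h unfolding hus by blast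
  have root: "poly h u = 0 \<longleftrightarrow> u \<in> set us" for u
    by (auto simp: hus poly_prod_list prod_list_zero_iff)
  have conj: "nrm (poly f u) = nrm (poly f w)" if "poly_over K f" "u \<in> set us" for f u
    by (rule nrm_poly_conj_over[OF KF w(1) h _ that(1)]) (use that(2) root in simp)
  have X: "poly_over K ([:0, 1:] :: 'a poly)"
    using sub_ring_0[OF KR] sub_ring_1[OF KR] by (auto simp: poly_over_def coeff_pCons split: nat.split)
  have nu: "nrm u = R" if "u \<in> set us" for u using conj[OF X that] w(2) by simp
  define d where "d = length us"
  have d: "card (set us) = d" using dist by (simp add: d_def distinct_card)
  have w_us: "w \<in> set us" using h root by (simp add: min_poly_over_def)
  hence d_pos: "d > 0" by (auto simp: d_def)
  define e where "e = ramification_index v K"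
  define \<alpha> where "\<alpha> = - log p R"
  define N where "N = int (l - l')"
  have N: "N > 0" using l by (simp add: N_def)
  \<comment> \<open>up to sign \<open>h(0)\<close> is the product of the conjugates, an element of \<open>K\<close> of valuation \<open>d \<alpha>\<close>\<close>
  have "nrm (poly h 0) = R ^ d"
  proof -
    have "(\<Prod>u\<leftarrow>us. nrm u) = R ^ length us" using nu by (induction us) auto
    thus ?thesis by (simp add: hus poly_prod_list nrm_prod_list o_def d_def)
  qed
  moreover have h0K: "poly h 0 \<in> K" using poly_in_sub_ring[OF KR h_over(1) sub_ring_0[OF KR]] .
  moreover have "poly h 0 \<noteq> 0" using \<open>nrm (poly h 0) = R ^ d\<close> R by (metis nrm_0 less_irrefl zero_less_power)
  ultimately have j: "real_of_int (v_unif v K (poly h 0)) = real e * (real d * \<alpha>)"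
    using v_unif_eq[OF KF(1), of "poly h 0"] R p_gt_1 by (simp add: e_def \<alpha>_def log_nat_power)
  have "0 < nrm (coeff g l) * R ^ l" "0 < nrm (coeff g l') * R ^ l'"
    using edge M by (simp_all add: newton_edge_def)
  hence nz: "coeff g l \<noteq> 0" "coeff g l' \<noteq> 0" by auto
  have gK: "coeff g l \<in> K" "coeff g l' \<in> K" using g by (auto simp: poly_over_def)
  have "log p (nrm (coeff g l) * R ^ l) = log p (nrm (coeff g l') * R ^ l')"
    using edge by (simp add: newton_edge_def)
  hence "log p (nrm (coeff g l)) - real l * \<alpha> = log p (nrm (coeff g l')) - real l' * \<alpha>"
    using nz R p_gt_1 by (simp add: log_mult log_nat_power \<alpha>_def)
  hence slope: "real_of_int N * \<alpha> = log p (nrm (coeff g l)) - log p (nrm (coeff g l'))"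
    using l by (simp add: N_def algebra_simps of_nat_diff)
  define D where "D = v_unif v K (coeff g l) - v_unif v K (coeff g l')"
  have "real_of_int D = - real e * (real_of_int N * \<alpha>)"
    unfolding D_def slope using v_unif_eq[OF KF(1)] nz gK by (simp add: e_def algebra_simps)
  hence "real_of_int (N * v_unif v K (poly h 0)) = real_of_int (- int d * D)"
    using j by simp
  hence "N * v_unif v K (poly h 0) = - int d * D" by (simp only: of_int_eq_iff)
  hence "N dvd int d * D" by (metis dvd_minus_iff dvd_triv_left mult_minus_left)
  hence "N dvd gcd (int d * D) (int d * N)" by simp
  hence "N dvd int d * gcd D N" unfolding gcd_mult_distrib_int[symmetric] by simp
  moreover have "int d * gcd D N > 0" using d_pos N by simp
  ultimately have le: "N \<le> int d * gcd D N" by (rule zdvd_imp_le)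
  have g0: "poly g u = 0" if "u \<in> set us" for u
    by (rule min_poly_over_transfer[OF KF(1) h _ g w(3)]) (use root that in simp)
  show ?thesis
  proof (rule that[of "set us"])
    show "\<forall>u\<in>set us. nrm u = R \<and> poly g u = 0" using nu g0 by blast
    show "\<forall>h. poly_over K h \<longrightarrow> (\<forall>u\<in>set us. nrm (poly h u) = nrm (poly h w))" using conj by blast
    show "int (l - l') \<le> int (card (set us))
      * gcd (v_unif v K (coeff g l) - v_unif v K (coeff g l')) (int (l - l'))"
      using le unfolding d N_def D_def .
  qed (use w_us in auto)
qed

text \<open>The inequality \<open>1 / d \<le> g / N\<close> is reversed by the factor \<open>log p \<rho> \<le> 0\<close>.\<close>

lemma log_le_of_root_dist_le_power:
  assumes \<rho>: "0 < \<rho>" "\<rho> \<le> 1" "\<rho> \<le> q ^ d" and q: "0 < q" and d: "d > 0"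
    and N: "N > 0" "real N \<le> real d * g"
  shows "g / real N * log p \<rho> \<le> log p q"
proof -
  have "log p \<rho> \<le> log p (q ^ d)" using \<rho> q p_gt_1 by simp
  also have "\<dots> = real d * log p q" using q p_gt_1 by (simp add: log_nat_power)
  finally have 1: "log p \<rho> / real d \<le> log p q" using d by (simp add: field_simps)
  have "1 / real d \<le> g / real N" using N d by (simp add: field_simps)
  moreover have "log p \<rho> \<le> 0" using \<rho> p_gt_1 by simp
  ultimately have "g / real N * log p \<rho> \<le> 1 / real d * log p \<rho>" by (rule mult_right_mono_neg)
  thus ?thesis using 1 by simp
qed

text \<open>The constant \<open>c\<close> of the sharpened bound is the maximum of two such ratios. By the lemma above the inverse of
  a ratio bounds the number of conjugates from below.\<close>

definition gcd_ratio :: "'a set \<Rightarrow> 'a \<Rightarrow> 'a \<Rightarrow> nat \<Rightarrow> real" where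
  "gcd_ratio K x y n = real_of_int (gcd (v_unif v K x - v_unif v K y) (int n)) / real n"

text \<open>All conjugates of \<open>w\<close> contribute the same factor \<open>q\<close> to the resultant and all other factors have norm at
  most 1, so the resultant is at most \<open>q\<^sup>d\<close>.\<close>

lemma log_nrm_at_root_ge:
  fixes K :: "'a set"
  assumes K: "finite_extension_Qp K" and f: "poly_over K f" and g: "poly_over K g"
    and edge: "newton_edge (coeff g) R l' l M" and M: "M > 0" and R: "0 < R" "R \<le> 1" and l: "l' < l"
    and F: "factor_on R (poly f) A zs"
    and ws: "\<And>w. w \<in> set ws \<longleftrightarrow> nrm w = R \<and> poly g w = 0" "set ws \<subseteq> Qp_bar"
    and \<rho>: "0 < root_dist ws zs" and w: "w \<in> set ws"
  shows "log p A + gcd_ratio K (coeff g l) (coeff g l') (l - l') * log p (root_dist ws zs) \<le> log p (nrm (poly f w))"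
proof -
  have wp: "w \<in> Qp_bar" "nrm w = R" "poly g w = 0" using ws w by auto
  obtain U where U: "finite U" "w \<in> U" "\<forall>u\<in>U. nrm u = R \<and> poly g u = 0"
    "\<forall>h. poly_over K h \<longrightarrow> (\<forall>u\<in>U. nrm (poly h u) = nrm (poly h w))"
    "int (l - l') \<le> int (card U) * gcd (v_unif v K (coeff g l) - v_unif v K (coeff g l')) (int (l - l'))"
    using conjugates_on_circle[OF K g edge M R(1) l wp] by blast
  have A: "A > 0" using F by (simp add: factor_on_def)
  have wR: "\<forall>w\<in>set ws. nrm w = R" using ws(1) by blast
  define q where "q u = (\<Prod>z\<leftarrow>zs. nrm (u - z))" for u
  have fq: "nrm (poly f u) = A * q u" if "nrm u = R" for u using F that by (simp add: factor_on_def q_def)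
  have q1: "0 \<le> q u \<and> q u \<le> 1" if "nrm u = R" for u
    unfolding q_def by (rule factor_on_prod_le_1[OF R F that])
  have qU: "q u = q w" if "u \<in> U" for u
    using U(4)[rule_format, OF f that] fq[of u] fq[of w] U(3)[rule_format, OF that] wR[rule_format, OF w] A by simp
  have "root_dist ws zs = (\<Prod>u\<leftarrow>ws. q u)" by (simp add: root_dist_def q_def)
  also have "\<dots> \<le> (\<Prod>u\<in>U. q u)"
    using q1 wR U(3) ws(1) by (intro prod_list_le_prod_subset) auto
  also have "\<dots> = q w ^ card U" using qU by simp
  finally have le: "root_dist ws zs \<le> q w ^ card U" .
  have rd1: "root_dist ws zs \<le> 1"
    using root_dist_le_prod[OF R F wR w] factor_on_prod_le_1[OF R F wR[rule_format, OF w]] by linarith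
  have cU: "card U > 0" using U(1,2) by (auto simp: card_gt_0_iff)
  have qw: "q w > 0"
  proof (rule ccontr)
    assume "\<not> 0 < q w"
    hence "q w = 0" using q1[OF wR[rule_format, OF w]] by simp
    thus False using le \<rho> cU by (simp add: zero_power)
  qed
  have N: "real (l - l') \<le> real (card U) * real_of_int (gcd (v_unif v K (coeff g l) - v_unif v K (coeff g l')) (int (l - l')))"
    using U(5) by (metis of_int_le_iff of_int_mult of_int_of_nat_eq)
  have "gcd_ratio K (coeff g l) (coeff g l') (l - l') * log p (root_dist ws zs) \<le> log p (q w)"
    unfolding gcd_ratio_def by (rule log_le_of_root_dist_le_power[OF \<rho> rd1 le qw cU _ N]) (use l in simp)
  moreover have "log p (nrm (poly f w)) = log p A + log p (q w)"
    using fq[OF wR[rule_format, OF w]] A qw p_gt_1 by (simp add: log_mult)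
  ultimately show ?thesis by simp
qed

lemma truncate_close:
  fixes F :: "'a fps"
  assumes F: "conv_on F R" and R: "R > 0" and E: "E > 0"
  obtains f where "\<And>i. coeff f i = fps_nth F i \<or> coeff f i = 0"
    "\<And>i. nrm (fps_nth F i - coeff f i) * R ^ i < E"
proof -
  obtain n where n: "\<And>i. i \<ge> n \<Longrightarrow> nrm (fps_nth F i) * R ^ i < E"
    using F E R by (auto simp: conv_on_def LIMSEQ_def)
  define f where "f = Poly (map (fps_nth F) [0..<n])"
  have cf: "coeff f i = (if i < n then fps_nth F i else 0)" for i by (simp add: f_def nth_default_def)
  show ?thesis by (rule that[of f]) (use n E in \<open>auto simp: cf\<close>)
qed

text \<open>Convergence is given at points of the circle, so such a point has to be found first. The polynomial made of
  the terms up to the end of the edge converges everywhere and has a root there.\<close>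

lemma ex_on_circle:
  fixes F :: "'a fps"
  assumes edge: "newton_edge (fps_nth F) R a b M" and R: "R > 0" and M: "M > 0" and ab: "a < b"
  obtains x where "nrm x = R"
proof -
  define f where "f = Poly (map (fps_nth F) [0..<Suc b])"
  have cf: "coeff f i = (if i \<le> b then fps_nth F i else 0)" for i
    by (simp add: f_def nth_default_def del: upt_Suc)
  have "newton_edge (fps_nth (fps_of_poly f)) R a b M"
    using edge M by (auto simp: newton_edge_def cf)
  from ex_root_on_circle[OF conv_on_poly R M this ab] show ?thesis using that by blast
qed

lemma factor_on_poly:
  fixes f :: "'a poly"
  assumes f: "poly_over Qp_bar f" and edge: "newton_edge (coeff f) R a b M" and R: "R > 0" and M: "M > 0"
  obtains zs where "factor_on R (poly f) (M / R ^ (b - a)) zs" "length zs = b - a"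
    "\<And>z. z \<in> set zs \<longleftrightarrow> nrm z = R \<and> poly f z = 0" "set zs \<subseteq> Qp_bar"
proof -
  have f0: "f \<noteq> 0" using edge M by (auto simp: newton_edge_def)
  obtain us where us: "length us = b - a" "\<And>u. u \<in> set us \<Longrightarrow> u \<in> Qp_bar \<and> nrm u = R \<and> poly f u = 0"
    "\<And>x. nrm x = R \<Longrightarrow> nrm (poly f x) * R ^ (b - a) = M * (\<Prod>u\<leftarrow>us. nrm (x - u))"
    "\<And>u. nrm u = R \<Longrightarrow> poly f u = 0 \<Longrightarrow> u \<in> set us"
    using roots_on_circle_Qp_bar[OF f f0 edge R] by metis
  have "factor_on R (poly f) (M / R ^ (b - a)) us"
    unfolding factor_on_def using us(2,3) R M by (auto simp: field_simps)
  thus ?thesis using that us by blast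
qed

text \<open>Over a finite extension of \<open>Qp\<close> both series are replaced by truncations which are so close that neither
  the resultant nor \<open>max \<bar>F\<bar> \<bar>G\<bar>\<close> changes; their roots are algebraic and have conjugates.\<close>

lemma log_max_ge_over_finite_extension:
  fixes K :: "'a set" and F G :: "'a fps"
  assumes K: "finite_extension_Qp K" and FK: "\<And>i. fps_nth F i \<in> K" and GK: "\<And>i. fps_nth G i \<in> K"
    and R: "0 < R" "R \<le> 1" and cF: "conv_on F R" and cG: "conv_on G R"
    and eF: "newton_edge (fps_nth F) R k' k M" "M > 0" "k' < k"
    and eG: "newton_edge (fps_nth G) R l' l M'" "M' > 0" "l' < l"
    and fF: "factor_on R (fps_value F) A zs" "A = M / R ^ (k - k')" "zs \<noteq> []"
    and fG: "factor_on R (fps_value G) B ws" "B = M' / R ^ (l - l')"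
    and \<rho>: "0 < root_dist zs ws" "root_dist zs ws \<le> 1" and x: "nrm x = R"
  shows "min (log p A) (log p B)
    + max (gcd_ratio K (fps_nth F k) (fps_nth F k') (k - k'))
          (gcd_ratio K (fps_nth G l) (fps_nth G l') (l - l'))
      * log p (root_dist zs ws)
    \<le> log p (max (nrm (fps_value F x)) (nrm (fps_value G x)))"
proof -
  note KF = finite_extension_subset_Qp_bar[OF K]
  have K0: "0 \<in> K" by (rule sub_ring_0[OF sub_field_imp_sub_ring[OF KF(1)]])
  have A: "A > 0" and B: "B > 0" using fF fG by (auto simp: factor_on_def)
  \<comment> \<open>small enough for the edges, the resultant and \<open>max \<bar>F\<bar> \<bar>G\<bar>\<close> all to be unaffected by the truncation\<close>
  define E where "E = min (min M M') (min A B * root_dist zs ws) / 2"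
  have E: "E > 0" "E \<le> M" "E \<le> M'" "E < min A B * root_dist zs ws"
    using eF eG A B \<rho> by (auto simp: E_def min_def)
  have EA: "E < A * root_dist zs ws" and EB: "E < B * root_dist zs ws"
  proof -
    have "min A B * root_dist zs ws \<le> A * root_dist zs ws" "min A B * root_dist zs ws \<le> B * root_dist zs ws"
      using \<rho> by (auto intro!: mult_right_mono)
    thus "E < A * root_dist zs ws" "E < B * root_dist zs ws" using E(4) by linarith+
  qed
  obtain f where f: "\<And>i. coeff f i = fps_nth F i \<or> coeff f i = 0"
    "\<And>i. nrm (fps_nth F i - coeff f i) * R ^ i < E" using truncate_close[OF cF R(1) E(1)] by blast
  obtain g where g: "\<And>i. coeff g i = fps_nth G i \<or> coeff g i = 0"
    "\<And>i. nrm (fps_nth G i - coeff g i) * R ^ i < E" using truncate_close[OF cG R(1) E(1)] by blast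
  have fK: "poly_over K f" "poly_over K g" using f(1) g(1) FK GK K0 unfolding poly_over_def by metis+
  hence fQ: "poly_over Qp_bar f" "poly_over Qp_bar g" using KF(3) by (auto simp: poly_over_def)
  have ef: "newton_edge (coeff f) R k' k M"
    by (rule newton_edge_perturb[OF eF(1) R(1)]) (use f(2) E in \<open>meson less_le_trans\<close>)
  have eg: "newton_edge (coeff g) R l' l M'"
    by (rule newton_edge_perturb[OF eG(1) R(1)]) (use g(2) E in \<open>meson less_le_trans\<close>)
  have ends: "coeff f k = fps_nth F k" "coeff f k' = fps_nth F k'" "coeff g l = fps_nth G l" "coeff g l' = fps_nth G l'"
    using ef eg eF(2) eG(2) f(1) g(1) unfolding newton_edge_def by (metis less_irrefl mult_zero_left nrm_0)+
  obtain zs' where zs': "factor_on R (poly f) A zs'" "length zs' = k - k'"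
    "\<And>z. z \<in> set zs' \<longleftrightarrow> nrm z = R \<and> poly f z = 0" "set zs' \<subseteq> Qp_bar"
    using factor_on_poly[OF fQ(1) ef R(1) eF(2)] fF(2) by blast
  obtain ws' where ws': "factor_on R (poly g) B ws'" "length ws' = l - l'"
    "\<And>z. z \<in> set ws' \<longleftrightarrow> nrm z = R \<and> poly g z = 0" "set ws' \<subseteq> Qp_bar"
    using factor_on_poly[OF fQ(2) eg R(1) eG(2)] fG(2) by blast
  have closeF: "\<forall>y. nrm y = R \<longrightarrow> nrm (fps_value F y - poly f y) \<le> E"
    by (intro allI impI nrm_fps_value_diff_poly) (use cF f(2) in \<open>auto simp: less_imp_le\<close>)
  have closeG: "\<forall>y. nrm y = R \<longrightarrow> nrm (fps_value G y - poly g y) \<le> E"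
    by (intro allI impI nrm_fps_value_diff_poly) (use cG g(2) in \<open>auto simp: less_imp_le\<close>)
  have wsR: "\<forall>w\<in>set ws. nrm w = R" using fG by (simp add: factor_on_def)
  have zsR': "\<forall>z\<in>set zs'. nrm z = R" using zs' by blast
  have r1: "root_dist ws zs' = root_dist zs ws"
    using root_dist_perturb[OF R fF(1) zs'(1) closeF wsR] EA by (simp add: root_dist_commute[of zs])
  have r2: "root_dist zs' ws' = root_dist zs ws"
    using root_dist_perturb[OF R fG(1) ws'(1) closeG zsR'] EB r1 by (simp add: root_dist_commute[of zs'])
  have same: "max (nrm (poly f y)) (nrm (poly g y)) = max (nrm (fps_value F y)) (nrm (fps_value G y))"
    if y: "nrm y = R" for y
    by (rule max_nrm_perturb[OF closeF[rule_format, OF y] closeG[rule_format, OF y]])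
       (rule less_le_trans[OF E(4) max_ge_root_dist[OF R fF(1) fG(1) fF(3) y]])
  have ne: "zs' \<noteq> []" using zs'(2) eF(3) by auto
  obtain u where u: "u \<in> set zs' \<union> set ws'"
    "max (nrm (poly f u)) (nrm (poly g u)) \<le> max (nrm (poly f x)) (nrm (poly g x))"
    using max_le_at_nearest_root[OF R zs'(1) ws'(1) ne x] by blast
  define cF where "cF = gcd_ratio K (fps_nth F k) (fps_nth F k') (k - k')"
  define cG where "cG = gcd_ratio K (fps_nth G l) (fps_nth G l') (l - l')"
  have log_\<rho>: "log p (root_dist zs ws) \<le> 0" using \<rho> p_gt_1 by simp
  have c_le: "max cF cG * log p (root_dist zs ws) \<le> cF * log p (root_dist zs ws)"
     "max cF cG * log p (root_dist zs ws) \<le> cG * log p (root_dist zs ws)"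
    using log_\<rho> by (auto intro!: mult_right_mono_neg)
  have uR: "nrm u = R" using u(1) zs'(3) ws'(3) by blast
  have pos: "0 < max (nrm (poly f u)) (nrm (poly g u))"
    using same[OF uR] max_ge_root_dist[OF R fF(1) fG(1) fF(3) uR] E(1,4) by linarith
  have "min (log p A) (log p B) + max cF cG * log p (root_dist zs ws)
     \<le> log p (max (nrm (poly f u)) (nrm (poly g u)))"
    using u(1)
  proof
    assume z: "u \<in> set zs'"
    have "log p B + cF * log p (root_dist zs' ws') \<le> log p (nrm (poly g u))"
      using log_nrm_at_root_ge[OF K fK(2,1) ef eF(2) R eF(3) ws'(1) zs'(3,4) _ z] r2 \<rho>(1)
      by (simp add: cF_def ends)
    moreover have "poly f u = 0" using z zs'(3) by blast
    ultimately show ?thesis using c_le r2 by simp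
  next
    assume w: "u \<in> set ws'"
    have "log p A + cG * log p (root_dist ws' zs') \<le> log p (nrm (poly f u))"
      using log_nrm_at_root_ge[OF K fK(1,2) eg eG(2) R eG(3) zs'(1) ws'(3,4) _ w] r2 \<rho>(1)
      by (simp add: cG_def ends root_dist_commute[of ws'])
    moreover have "poly g u = 0" using w ws'(3) by blast
    ultimately show ?thesis using c_le r2 by (simp add: root_dist_commute[of ws'])
  qed
  also have "\<dots> \<le> log p (max (nrm (poly f x)) (nrm (poly g x)))"
    using u(2) pos p_gt_1 by (subst log_le_cancel_iff) auto
  finally show ?thesis unfolding same[OF x] cF_def cG_def .
qed

section \<open>The bounds\<close>

lemma char_seq_factor_on:
  fixes F :: "'a fps"
  assumes F0: "fps_nth F 0 \<noteq> 0" and n: "1 \<le> n" "char_seq v F n \<noteq> None"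
  obtains a k k' where "char_index v F n = k" "char_index v F (n - 1) = k'" "k' < k" "char_val v F n = ereal a"
    "fps_nth F k \<noteq> 0" "newton_edge (fps_nth F) (p powr (- a)) k' k (nrm (fps_nth F k) * (p powr (- a)) ^ k)"
proof -
  obtain k where k: "char_seq v F n = Some k" using n(2) by auto
  obtain a k' where a: "fps_nth F k \<noteq> 0" "char_seq v F (n - 1) = Some k'" "k' < k" "char_val v F n = ereal a"
    "newton_edge (fps_nth F) (p powr (- a)) k' k (nrm (fps_nth F k) * (p powr (- a)) ^ k)"
    using char_seq_edge[OF F0 k] n(1) by auto
  show ?thesis by (rule that[of k k' a]) (use a k in \<open>auto simp: char_index_def\<close>)
qed

lemma circle_poly_factor_on:
  fixes F :: "'a fps"
  assumes F: "conv_on F R" and R: "R > 0" and edge: "newton_edge (fps_nth F) R k' k (nrm (fps_nth F k) * R ^ k)"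
    and k: "fps_nth F k \<noteq> 0" "k' < k" and t: "\<And>z. v z = t \<longleftrightarrow> nrm z = R"
  obtains zs where "factor_on R (fps_value F) (nrm (fps_nth F k) * R ^ k') zs" "length zs = k - k'"
    "\<forall>z. z \<in> set zs \<longleftrightarrow> nrm z = R \<and> fps_value F z = 0"
    "circle_poly v F t = lin_prod zs"
proof -
  have M: "nrm (fps_nth F k) * R ^ k > 0" using k R by simp
  obtain zs where zs: "length zs = k - k'" "\<And>z. z \<in> set zs \<longleftrightarrow> nrm z = R \<and> fps_value F z = 0"
    "circle_poly v F t = lin_prod zs"
    "\<And>x. nrm x = R \<Longrightarrow> nrm (fps_value F x)
       = nrm (fps_nth F k) * R ^ k / R ^ (k - k') * (\<Prod>z\<leftarrow>zs. nrm (x - z))"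
    using circle_poly_factorization[OF F R M edge t] by blast
  have "R ^ k = R ^ k' * R ^ (k - k')" using k(2) by (simp flip: power_add)
  hence A: "nrm (fps_nth F k) * R ^ k / R ^ (k - k') = nrm (fps_nth F k) * R ^ k'" using R by simp
  have "factor_on R (fps_value F) (nrm (fps_nth F k) * R ^ k') zs"
    unfolding factor_on_def using zs(2,4) k R by (simp add: A)
  thus ?thesis using that zs by blast
qed

lemma min_v_eq_log:
  assumes "0 < max (nrm x) (nrm y)"
  shows "min (v x) (v y) = ereal (- log p (max (nrm x) (nrm y)))"
proof (cases "nrm x \<le> nrm y")
  case True
  hence "v y \<le> v x" "max (nrm x) (nrm y) = nrm y" by (simp_all add: nrm_le_iff_v)
  thus ?thesis using assms v_eq_log[of y] by (simp add: min_def)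
next
  case False
  hence "v x \<le> v y" "max (nrm x) (nrm y) = nrm x" by (simp_all add: nrm_le_iff_v)
  thus ?thesis using assms v_eq_log[of x] by (simp add: min_def)
qed

lemma v_plus_slope_eq_log:
  assumes "x \<noteq> 0"
  shows "v x + ereal (real k) * ereal a = ereal (- log p (nrm x * (p powr (- a)) ^ k))"
  using assms p_gt_1 by (simp add: v_eq_log log_mult log_nat_power)

text \<open>Multiplying the values at the roots of one function gives a power of its constant times the resultant.
  So the smallest value is at most the corresponding geometric mean.\<close>

lemma log_min_le_mean:
  assumes R: "0 < R" "R \<le> 1" and F: "factor_on R f A zs" and ws: "\<forall>w\<in>set ws. nrm w = R" "ws \<noteq> []"
    and m: "0 < m" "\<And>w. w \<in> set ws \<Longrightarrow> m \<le> nrm (f w)" and \<rho>: "0 < root_dist ws zs"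
  shows "log p m \<le> log p A + log p (root_dist ws zs) / real (length ws)"
proof -
  have A: "A > 0" using F by (simp add: factor_on_def)
  have "m ^ length ws \<le> (\<Prod>w\<leftarrow>ws. nrm (f w))"
    using m(2) m(1) by (induction ws) (auto intro!: mult_mono)
  also have "\<dots> = A ^ length ws * root_dist ws zs" by (rule prod_list_nrm_at_roots[OF R F ws(1)])
  finally have "log p (m ^ length ws) \<le> log p (A ^ length ws * root_dist ws zs)"
    using m(1) p_gt_1 A \<rho> by (subst log_le_cancel_iff) auto
  hence "real (length ws) * log p m \<le> real (length ws) * log p A + log p (root_dist ws zs)"
    using m(1) A \<rho> p_gt_1 by (simp add: log_mult log_nat_power)
  thus ?thesis using ws(2) by (simp add: field_simps)
qed

end

theorem theorem5p1:
  fixes p n m :: nat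
    and v :: "'a::{field_char_0, complete_space} \<Rightarrow> ereal"
    and F G :: "'a fps"
  assumes Cp: "padic_complex p v"
    and F0: "fps_nth F 0 \<noteq> 0" and G0: "fps_nth G 0 \<noteq> 0"
    and no_common_root: "\<nexists>z. fps_root F z \<and> fps_root G z"
    and unit_disc: "fps_conv_region F \<inter> fps_conv_region G = {x. 0 < v x} \<or>
                    fps_conv_region F \<inter> fps_conv_region G = {x. 0 \<le> v x}"
    and n: "1 \<le> n" "char_seq v F n \<noteq> None"
    and m: "1 \<le> m" "char_seq v G m \<noteq> None"
    and common_valuation: "char_val v F n = char_val v G m"
    and circle_in_disc: "{x. v x = char_val v F n} \<subseteq> fps_conv_region F \<inter> fps_conv_region G"
  shows
    "let \<alpha> = char_val v F n; \<beta> = char_val v G m;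
         k = char_index v F n; k' = char_index v F (n - 1);
         l = char_index v G m; l' = char_index v G (m - 1);
         a = min (v (fps_nth F k) + ereal (real k') * \<alpha>) (v (fps_nth G l) + ereal (real l') * \<alpha>);
         b = max (v (fps_nth F k) + ereal (real k') * \<alpha>) (v (fps_nth G l) + ereal (real l') * \<alpha>);
         r = resultant (circle_poly v F \<alpha>) (circle_poly v G \<beta>);
         C = {x. v x = \<alpha>};
         \<phi> = (\<lambda>x. min (v (fps_value F x)) (v (fps_value G x)))
     in \<exists>M. M \<in> \<phi> ` C \<and> (\<forall>x\<in>C. \<phi> x \<le> M) \<and>
          a + v r / ereal (real (min (l - l') (k - k'))) \<le> M \<and>
          M \<le> b + v r \<and>
          (\<forall>K \<pi>. finite_extension_Qp K \<and> uniformizer v K \<pi> \<and>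
                  (\<forall>i. fps_nth F i \<in> K) \<and> (\<forall>i. fps_nth G i \<in> K) \<longrightarrow>
             (let c = max
                  (real_of_int (gcd (v_unif v K (fps_nth F k) - v_unif v K (fps_nth F k')) (int (k - k')))
                     / real (k - k'))
                  (real_of_int (gcd (v_unif v K (fps_nth G l) - v_unif v K (fps_nth G l')) (int (l - l')))
                     / real (l - l'))
              in M \<le> b + ereal c * v r))"
proof -
  interpret padic_complex p v by (rule Cp)
  obtain a k k' where F: "char_index v F n = k" "char_index v F (n - 1) = k'" "k' < k" "char_val v F n = ereal a"
    "fps_nth F k \<noteq> 0" "newton_edge (fps_nth F) (p powr (- a)) k' k (nrm (fps_nth F k) * (p powr (- a)) ^ k)"
    by (rule char_seq_factor_on[OF F0 n])
  obtain a' l l' where G': "char_index v G m = l" "char_index v G (m - 1) = l'" "l' < l" "char_val v G m = ereal a'"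
    "fps_nth G l \<noteq> 0" "newton_edge (fps_nth G) (p powr (- a')) l' l (nrm (fps_nth G l) * (p powr (- a')) ^ l)"
    by (rule char_seq_factor_on[OF G0 m])
  have "a' = a" using common_valuation F(4) G'(4) by simp
  note G = G'[unfolded this]
  define R where "R = p powr (- a)"
  note eF = F(6)[folded R_def] and eG = G(6)[folded R_def]
  have R0: "0 < R" using p_gt_1 by (simp add: R_def)
  have t: "v z = ereal a \<longleftrightarrow> nrm z = R" for z unfolding R_def by (rule v_eq_ereal_iff)
  have MF: "0 < nrm (fps_nth F k) * R ^ k" and MG: "0 < nrm (fps_nth G l) * R ^ l"
    using F(5) G(5) R0 by auto
  obtain x0 where x0: "nrm x0 = R" by (rule ex_on_circle[OF eF R0 MF F(3)])
  have x0_in: "x0 \<in> fps_conv_region F \<inter> fps_conv_region G"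
    using circle_in_disc x0 unfolding F(4) t by blast
  hence conv: "conv_on F R" "conv_on G R" using x0 by (auto simp: conv_region_iff)
  \<comment> \<open>the common valuation is nonnegative because the circle lies in the unit disc\<close>
  have R1: "R \<le> 1"
  proof -
    have "x0 \<in> {x. 0 < v x} \<or> x0 \<in> {x. 0 \<le> v x}" using x0_in unit_disc by blast
    hence "0 \<le> v x0" by auto
    hence "0 \<le> a" using x0 t[of x0] by simp
    hence "p powr (- a) \<le> p powr 0" using p_gt_1 by (intro powr_mono) auto
    thus ?thesis using p_gt_1 by (simp add: R_def)
  qed
  note R = R0 R1
  define A where "A = nrm (fps_nth F k) * R ^ k'"
  define B where "B = nrm (fps_nth G l) * R ^ l'"
  obtain zs where zs: "factor_on R (fps_value F) A zs" "length zs = k - k'"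
    "\<forall>z. z \<in> set zs \<longleftrightarrow> nrm z = R \<and> fps_value F z = 0"
    "circle_poly v F (ereal a) = lin_prod zs"
    by (rule circle_poly_factor_on[OF conv(1) R0 eF F(5,3) t, folded A_def])
  obtain ws where ws: "factor_on R (fps_value G) B ws" "length ws = l - l'"
    "\<forall>z. z \<in> set ws \<longleftrightarrow> nrm z = R \<and> fps_value G z = 0"
    "circle_poly v G (ereal a) = lin_prod ws"
    by (rule circle_poly_factor_on[OF conv(2) R0 eG G(5,3) t, folded B_def])
  have ne: "zs \<noteq> []" "ws \<noteq> []" using zs(2) ws(2) F(3) G(3) by auto
  have AB: "A > 0" "B > 0" using zs(1) ws(1) by (auto simp: factor_on_def)
  have on: "\<forall>z\<in>set zs. nrm z = R" "\<forall>w\<in>set ws. nrm w = R" using zs(3) ws(3) by auto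

  define \<rho> where "\<rho> = root_dist zs ws"
  define r where "r = resultant (circle_poly v F (ereal a)) (circle_poly v G (ereal a))"
  have nr: "nrm r = \<rho>" unfolding r_def zs(4) ws(4) \<rho>_def by (rule nrm_resultant)
  have \<rho>0: "0 < \<rho>"
  proof -
    have "z \<noteq> w" if "z \<in> set zs" "w \<in> set ws" for z w
    proof
      assume "z = w"
      hence "fps_root F z \<and> fps_root G z"
        using that zs(3) ws(3) conv by (auto simp: fps_root_def conv_region_iff)
      thus False using no_common_root by blast
    qed
    hence "\<rho> \<noteq> 0" unfolding \<rho>_def root_dist_def by (auto simp: prod_list_zero_iff)
    thus ?thesis using nr nrm_nonneg[of r] by linarith
  qed
  have \<rho>1: "\<rho> \<le> 1"
  proof -
    obtain z where z: "z \<in> set zs" using ne(1) by (cases zs) auto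
    have "\<rho> \<le> (\<Prod>w\<leftarrow>ws. nrm (z - w))" unfolding \<rho>_def by (rule root_dist_le_prod[OF R ws(1) on(1) z])
    also have "\<dots> \<le> 1" using factor_on_prod_le_1[OF R ws(1)] on(1) z by blast
    finally show ?thesis .
  qed
  have r0: "r \<noteq> 0" using nr \<rho>0 by auto
  have vr: "v r = ereal (- log p \<rho>)" using v_eq_log[OF r0] nr by simp

  define \<psi> where "\<psi> x = max (nrm (fps_value F x)) (nrm (fps_value G x))" for x
  have \<psi>_ge: "min A B * \<rho> \<le> \<psi> x" if "nrm x = R" for x
    unfolding \<psi>_def \<rho>_def by (rule max_ge_root_dist[OF R zs(1) ws(1) ne(1) that])
  have \<psi>0: "0 < \<psi> x" if "nrm x = R" for x
  proof -
    have "0 < min A B * \<rho>" using AB \<rho>0 by simp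
    thus ?thesis using \<psi>_ge[OF that] by linarith
  qed
  define \<phi> where "\<phi> x = min (v (fps_value F x)) (v (fps_value G x))" for x
  have \<phi>: "\<phi> x = ereal (- log p (\<psi> x))" if "nrm x = R" for x
    unfolding \<phi>_def \<psi>_def by (rule min_v_eq_log) (use \<psi>0[OF that] in \<open>simp only: \<psi>_def\<close>)
  have fin: "finite (set zs \<union> set ws)" "set zs \<union> set ws \<noteq> {}" using ne by auto
  \<comment> \<open>the maximum of \<open>\<phi>\<close> is the value at the best of the finitely many roots on the circle\<close>
  obtain u where u: "u \<in> set zs \<union> set ws" "\<And>y. y \<in> set zs \<union> set ws \<Longrightarrow> \<psi> u \<le> \<psi> y"
    using ex_is_arg_min_if_finite[OF fin, of \<psi>] by (auto simp: is_arg_min_linorder)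
  have uR: "nrm u = R" using u(1) on by auto
  have u_min: "\<psi> u \<le> \<psi> x" if x: "nrm x = R" for x
  proof -
    obtain y where "y \<in> set zs \<union> set ws" "\<psi> y \<le> \<psi> x"
      using max_le_at_nearest_root[OF R zs(1) ws(1) ne(1) x] unfolding \<psi>_def by blast
    thus ?thesis using u(2) by (meson order_trans)
  qed

  define M where "M = - log p (\<psi> u)"
  have M: "\<phi> u = ereal M" using \<phi>[OF uR] by (simp add: M_def)
  have M_max: "\<phi> x \<le> ereal M" if "nrm x = R" for x
    using u_min[OF that] \<psi>0[OF uR] \<psi>0[OF that] p_gt_1 by (simp add: \<phi>[OF that] M_def)

  \<comment> \<open>averaging over the roots of \<open>F\<close> divides by \<open>k - k'\<close>, over those of \<open>G\<close> by \<open>l - l'\<close>\<close>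
  have lower: "min (- log p A) (- log p B) + - log p \<rho> / real (min (l - l') (k - k')) \<le> M"
  proof -
    have 1: "log p (\<psi> u) \<le> log p B + log p \<rho> / real (k - k')"
    proof -
      have "log p (\<psi> u) \<le> log p B + log p (root_dist zs ws) / real (length zs)"
      proof (rule log_min_le_mean[OF R ws(1) on(1) ne(1) \<psi>0[OF uR]])
        fix z assume z: "z \<in> set zs"
        hence "fps_value F z = 0" using zs(3) by blast
        thus "\<psi> u \<le> nrm (fps_value G z)" using u(2)[of z] z by (simp add: \<psi>_def[of z])
      qed (use \<rho>0 in \<open>simp add: \<rho>_def\<close>)
      thus ?thesis by (simp add: \<rho>_def zs(2))
    qed
    have 2: "log p (\<psi> u) \<le> log p A + log p \<rho> / real (l - l')"
    proof -
      have "log p (\<psi> u) \<le> log p A + log p (root_dist ws zs) / real (length ws)"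
      proof (rule log_min_le_mean[OF R zs(1) on(2) ne(2) \<psi>0[OF uR]])
        fix w assume w: "w \<in> set ws"
        hence "fps_value G w = 0" using ws(3) by blast
        thus "\<psi> u \<le> nrm (fps_value F w)" using u(2)[of w] w by (simp add: \<psi>_def[of w])
      qed (use \<rho>0 in \<open>simp add: \<rho>_def root_dist_commute[of ws]\<close>)
      thus ?thesis by (simp add: \<rho>_def ws(2) root_dist_commute[of ws])
    qed
    have arith: "s \<le> - x \<Longrightarrow> y \<le> x + z \<Longrightarrow> s + - z \<le> - y" for s x y z :: real by linarith
    show ?thesis
    proof (cases "l - l' \<le> k - k'")
      case True
      hence eq: "min (l - l') (k - k') = l - l'" by simp
      show ?thesis unfolding eq M_def divide_minus_left by (rule arith[OF min.cobounded1 2])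
    next
      case False
      hence eq: "min (l - l') (k - k') = k - k'" by simp
      show ?thesis unfolding eq M_def divide_minus_left by (rule arith[OF min.cobounded2 1])
    qed
  qed
  have upper: "M \<le> max (- log p A) (- log p B) + - log p \<rho>"
  proof -
    have "log p (min A B * \<rho>) \<le> log p (\<psi> u)"
      using \<psi>_ge[OF uR] AB \<rho>0 \<psi>0[OF uR] p_gt_1 by (subst log_le_cancel_iff) auto
    moreover have "log p (min A B * \<rho>) = log p (min A B) + log p \<rho>"
      using AB \<rho>0 p_gt_1 by (subst log_mult) auto
    moreover have "log p (min A B) = log p A \<or> log p (min A B) = log p B" by (auto simp: min_def)
    ultimately show ?thesis by (auto simp: M_def)
  qed
  have refined: "M \<le> max (- log p A) (- log p B)
    + max (gcd_ratio K (fps_nth F k) (fps_nth F k') (k - k'))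
          (gcd_ratio K (fps_nth G l) (fps_nth G l') (l - l'))
      * - log p \<rho>"
    if K: "finite_extension_Qp K" "\<forall>i. fps_nth F i \<in> K" "\<forall>i. fps_nth G i \<in> K" for K
  proof -
    have split: "R ^ k = R ^ k' * R ^ (k - k')" "R ^ l = R ^ l' * R ^ (l - l')"
      using F(3) G(3) by (simp_all flip: power_add)
    have A: "A = nrm (fps_nth F k) * R ^ k / R ^ (k - k')" and B: "B = nrm (fps_nth G l) * R ^ l / R ^ (l - l')"
      unfolding A_def B_def split using R0 by simp_all
    have "log p (\<psi> u) \<ge> min (log p A) (log p B)
    + max (gcd_ratio K (fps_nth F k) (fps_nth F k') (k - k'))
          (gcd_ratio K (fps_nth G l) (fps_nth G l') (l - l'))
      * log p \<rho>"
      unfolding \<psi>_def \<rho>_def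
      by (rule log_max_ge_over_finite_extension[OF K(1) _ _ R conv eF MF F(3) eG MG G(3) zs(1) A ne(1) ws(1) B _ _ uR])
         (use K(2,3) \<rho>0 \<rho>1 in \<open>simp_all add: \<rho>_def\<close>)
    thus ?thesis unfolding M_def by (simp add: min_def max_def split: if_splits)
  qed

  have vA: "v (fps_nth F k) + ereal (real k') * ereal a = ereal (- log p A)"
    unfolding A_def R_def by (rule v_plus_slope_eq_log[OF F(5)])
  have vB: "v (fps_nth G l) + ereal (real l') * ereal a = ereal (- log p B)"
    unfolding B_def R_def by (rule v_plus_slope_eq_log[OF G(5)])
  have quot: "v r / ereal (real (min (l - l') (k - k'))) = ereal (- log p \<rho> / real (min (l - l') (k - k')))"
    unfolding vr using F(3) G(3) by (subst ereal_divide) auto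
  have img: "ereal M \<in> \<phi> ` {x. v x = ereal a}" using M uR t by (metis (mono_tags, lifting) imageI mem_Collect_eq)
  show ?thesis
    unfolding Let_def F(1,2,4) G(1,2,4) vA vB r_def[symmetric] quot \<phi>_def[symmetric]
    unfolding vr
  proof (intro exI[of _ "ereal M"] conjI allI impI ballI)
    show "ereal M \<in> \<phi> ` {x. v x = ereal a}" by (rule img)
    show "\<phi> x \<le> ereal M" if "x \<in> {x. v x = ereal a}" for x using M_max that t by simp
    show "min (ereal (- log p A)) (ereal (- log p B)) + ereal (- log p \<rho> / real (min (l - l') (k - k'))) \<le> ereal M"
      using lower by (simp add: min_def split: if_splits)
    show "ereal M \<le> max (ereal (- log p A)) (ereal (- log p B)) + ereal (- log p \<rho>)"
      using upper by (simp add: max_def split: if_splits)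
    fix K \<pi>
    assume "finite_extension_Qp K \<and> uniformizer v K \<pi> \<and> (\<forall>i. fps_nth F i \<in> K) \<and> (\<forall>i. fps_nth G i \<in> K)"
    hence "finite_extension_Qp K" "\<forall>i. fps_nth F i \<in> K" "\<forall>i. fps_nth G i \<in> K" by auto
    from refined[OF this, unfolded gcd_ratio_def]
    show "ereal M \<le> max (ereal (- log p A)) (ereal (- log p B))
      + ereal (max (real_of_int (gcd (v_unif v K (fps_nth F k) - v_unif v K (fps_nth F k')) (int (k - k'))) / real (k - k'))
          (real_of_int (gcd (v_unif v K (fps_nth G l) - v_unif v K (fps_nth G l')) (int (l - l'))) / real (l - l')))
        * ereal (- log p \<rho>)"
      by (simp only: times_ereal.simps plus_ereal.simps ereal_less_eq flip: ereal_max)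
  qed
qed

end
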